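(* Let $\mathbf{k}$ be an algebraically closed field of characteristic zero, or of prime characteristic not dividing any of the differences $n-m$ with $m<n$ in $\{0,5,6,7,8\}$. Let $S=\langle 5,6,7,8\rangle$ be the odd symmetric numerical semigroup of genus $5$, and let $\overline{\mathcal{M}_{5,1}^{S}}$ be the compactified moduli space of pointed Gorenstein curves with Weierstrass semigroup $S$ defined in the context. Then $$\overline{\mathcal{M}_{5,1}^{S}}=\mathbb{P}\big(T^{1,-}_{\mathbf{k}[S]|\mathbf{k}}\big)\cong\mathbb{P}^9_{\alpha},\qquad \alpha=(2,3,4,4,5,6,7,8,9,10),$$ where $\mathbb{P}^9_\alpha$ is the weighted projective space with weights $\alpha$.
   Context: $\mathbf{k}[S]$ is the semigroup ring $\bigoplus_{n\in S}\mathbf{k}t^n$. $T^{1,-}_{\mathbf{k}[S]|\mathbf{k}}$ is the negatively graded part of the first cotangent cohomology module $T^1_{\mathbf{k}[S]|\mathbf{k}}$, and $\mathbb{P}(T^{1,-}_{\mathbf{k}[S]|\mathbf{k}})$ is the weighted projective space in which a coordinate on the graded component of degree $-s$ has weight $s$. In $\mathbf{k}[X_0,X_5,X_6,X_7,X_8]$ the variable $X_n$ has weight $n$. Basis monomials, exactly one of each weight $n\in S$, $n\le 8r$, in degree $r$, are as follows. Degree 2: $X_0X_n$ ($n=0,5,6,7,8$), $X_5^2,X_5X_6,X_5X_7,X_5X_8,X_6X_8,X_7X_8,X_8^2$. Degree $r\ge3$: $X_0^{r-1}X_n$; $X_0^{r-2-i}MX_8^i$ ($0\le i\le r-2$, $M$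 one of the seven degree-2 basis monomials not involving $X_0$); $X_0^{r-3-i}X_5^2X_7X_8^i$ ($0\le i\le r-3$). Let $\Lambda_r$ be their span. Initial forms: $F_{12}^{(0)}=X_6^2-X_5X_7$, $F_{13}^{(0)}=X_6X_7-X_5X_8$, $F_{14}^{(0)}=X_7^2-X_6X_8$, $G_{15}^{(0)}=X_5^3-X_0X_7X_8$, $G_{16}^{(0)}=X_5^2X_6-X_0X_8^2$, $G_{18}^{(0)}=X_6^3-X_5^2X_8$, $G_{21}^{(0)}=X_7^3-X_5X_8^2$. Put $F_i=F_i^{(0)}-\sum_{j\ge1}c_{i,j}Z_{i-j}$ and $G_i=G_i^{(0)}-\sum_{j\ge1}d_{i,j}Z_{i-j}$, where $j$ runs over integers $1\le j\le i$ with $i-j\in S$ and $Z_{i-j}$ is the basis monomial of weight $i-j$ of degree 2 (for $F_i$) or degree 3 (for $G_i$). The coefficients are normalized by $c_{12,1}=c_{12,2}=c_{12,7}=c_{13,1}=c_{13,2}=c_{13,3}=c_{13,8}=d_{16,1}=d_{16,6}=d_{21,5}=0$, leaving 64 coefficients; $c_{i,j}$ and $d_{i,j}$ have weight $j$. Consider the four syzygies $X_8F^{(0)}_{12}-X_7F^{(0)}_{13}+X_6F^{(0)}_{14}=0$, $X_8G^{(0)}_{15}-X_5X_6F^{(0)}_{12}+X_5G^{(0)}_{18}-X_7G^{(0)}_{16}=0$, $X_8G^{(0)}_{18}-X_5G^{(0)}_{21}+X_5X_7F^{(0)}_{14}-X_6X_8F^{(0)}_{12}=0$, $X_8G^{(0)}_{21}-X_7X_8F^{(0)}_{14}-X_8^2F^{(0)}_{13}=0$.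 Replace in their left-hand sides every $F_i^{(0)},G_i^{(0)}$ by $F_i,G_i$. Reduce the result by repeated division by the $F_i,G_i$ (subtracting isobaric multiples of them of strictly smaller leading weight than that of the original syzygy) until a remainder in $\Lambda_3$ (first syzygy) or $\Lambda_4$ (the other three) is obtained. The coefficients of the four remainders are quasi-homogeneous polynomials in the $c_{i,j},d_{i,j}$. Their common zero set is an affine quasi-cone $Q\subset\mathbb{A}^{64}$ with the $\mathbb{G}_m$-action $c_{i,j}\mapsto c^jc_{i,j}$, $d_{i,j}\mapsto c^jd_{i,j}$. Its orbits correspond bijectively to the isomorphism classes of pointed complete integral Gorenstein curves with Weierstrass semigroup $S$ at the (nonsingular) marked point. By definition $\overline{\mathcal{M}_{5,1}^{S}}=(Q\setminus\{0\})/\mathbb{G}_m$, a closed subset of a weighted projective space. *)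

theory Defs
  imports
    "HOL-Computational_Algebra.Computational_Algebra"
    "HOL-Library.Poly_Mapping"
begin

section \<open>Polynomials in several variables\<close>

text \<open>
  A polynomial is a finitely supported map from exponents to coefficients; the ring structure
  is that of \<^theory>\<open>HOL-Library.Poly_Mapping\<close>.
\<close>

type_synonym ('v, 'a) mpoly = "('v \<Rightarrow>\<^sub>0 nat) \<Rightarrow>\<^sub>0 'a"

definition Var :: "'v \<Rightarrow> ('v, 'a::comm_ring_1) mpoly" where
  "Var v = Poly_Mapping.single (Poly_Mapping.single v 1) 1"

definition Const :: "'a \<Rightarrow> ('v, 'a::comm_ring_1) mpoly" where
  "Const a = Poly_Mapping.single 0 a"

definition polys_in :: "'v set \<Rightarrow> ('v, 'a::comm_ring_1) mpoly set" where
  "polys_in V = {p. \<forall>m \<in> Poly_Mapping.keys p. Poly_Mapping.keys m \<subseteq> V}"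

text \<open>Evaluation at \<open>x\<close>, where coefficients are mapped by \<open>h\<close>.\<close>

definition eval_mpoly ::
  "('a::comm_ring_1 \<Rightarrow> 'b::comm_ring_1) \<Rightarrow> ('v \<Rightarrow> 'b) \<Rightarrow> ('v, 'a) mpoly \<Rightarrow> 'b" where
  "eval_mpoly h x p = (\<Sum>m\<in>Poly_Mapping.keys p. h (Poly_Mapping.lookup p m) *
     (\<Prod>v\<in>Poly_Mapping.keys m. x v ^ Poly_Mapping.lookup m v))"

definition mono_weight :: "('v \<Rightarrow> nat) \<Rightarrow> ('v \<Rightarrow>\<^sub>0 nat) \<Rightarrow> nat" where
  "mono_weight w m = (\<Sum>v\<in>Poly_Mapping.keys m. Poly_Mapping.lookup m v * w v)"

text \<open>Quasi-homogeneous of weight \<open>d\<close> in the variables \<open>V\<close>; zero has every weight.\<close>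

definition isobaric :: "'v set \<Rightarrow> ('v \<Rightarrow> nat) \<Rightarrow> nat \<Rightarrow> ('v, 'a::comm_ring_1) mpoly \<Rightarrow> bool" where
  "isobaric V w d p \<longleftrightarrow> p \<in> polys_in V \<and> (\<forall>m \<in> Poly_Mapping.keys p. mono_weight w m = d)"


section \<open>Quasi-cones and weighted projective varieties\<close>

text \<open>
  A quasi-cone is a set with an apex, an action of the multiplicative group of the field
  (only \<open>cone_act C c\<close> with \<open>c \<noteq> 0\<close> is used), and for every weight \<open>s\<close> the set of coordinate
  functions of weight \<open>s\<close>, of which only the restrictions to the set matter.
\<close>

record ('v, 'a) quasi_cone =
  cone_set :: "'v set"
  cone_apex :: 'v
  cone_act :: "'a \<Rightarrow> 'v \<Rightarrow> 'v"
  cone_coords :: "nat \<Rightarrow> ('v \<Rightarrow> 'a) set"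

text \<open>Quasi-homogeneous polynomial functions of given weight in weighted coordinates \<open>L\<close>.\<close>

inductive qhom :: "(nat \<Rightarrow> ('v \<Rightarrow> 'a::comm_ring_1) set) \<Rightarrow> nat \<Rightarrow> ('v \<Rightarrow> 'a) \<Rightarrow> bool"
  for L :: "nat \<Rightarrow> ('v \<Rightarrow> 'a) set" where
  const: "qhom L 0 (\<lambda>_. a)"
| zero: "qhom L d (\<lambda>_. 0)"
| coord: "l \<in> L s \<Longrightarrow> qhom L s l"
| add: "qhom L d f \<Longrightarrow> qhom L d g \<Longrightarrow> qhom L d (\<lambda>x. f x + g x)"
| mult: "qhom L d f \<Longrightarrow> qhom L e g \<Longrightarrow> qhom L (d + e) (\<lambda>x. f x * g x)"

definition affine_cone ::
  "'i set \<Rightarrow> ('i \<Rightarrow> nat) \<Rightarrow> ('i \<Rightarrow> 'a::comm_ring_1, 'a) quasi_cone" where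
  "affine_cone I w = \<lparr>
     cone_set = {x. \<forall>i. i \<notin> I \<longrightarrow> x i = 0},
     cone_apex = (\<lambda>_. 0),
     cone_act = (\<lambda>c x i. c ^ w i * x i),
     cone_coords = (\<lambda>s. {\<lambda>x. x i | i. i \<in> I \<and> w i = s}) \<rparr>"

text \<open>
  Isomorphism of quasi-cones: an equivariant bijection under which quasi-homogeneous polynomial
  functions correspond to quasi-homogeneous polynomial functions of the same weight.
\<close>

definition quasi_cone_iso ::
  "('v, 'a::field) quasi_cone \<Rightarrow> ('w, 'a) quasi_cone \<Rightarrow> ('v \<Rightarrow> 'w) \<Rightarrow> bool" where
  "quasi_cone_iso C D \<Phi> \<longleftrightarrow>
     bij_betw \<Phi> (cone_set C) (cone_set D) \<and>
     (\<forall>c x. c \<noteq> 0 \<longrightarrow> x \<in> cone_set C \<longrightarrow> \<Phi> (cone_act C c x) = cone_act D c (\<Phi> x)) \<and>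
     (\<forall>d f. qhom (cone_coords D) d f \<longrightarrow>
        (\<exists>g. qhom (cone_coords C) d g \<and> (\<forall>x \<in> cone_set C. g x = f (\<Phi> x)))) \<and>
     (\<forall>d g. qhom (cone_coords C) d g \<longrightarrow>
        (\<exists>f. qhom (cone_coords D) d f \<and> (\<forall>x \<in> cone_set C. g x = f (\<Phi> x))))"

text \<open>
  Varieties in the classical sense: a set of points, its Zariski open subsets, and the predicate
  ``regular on an open subset'' for functions, of which only the values on that subset matter.
\<close>

record ('p, 'a) variety =
  points :: "'p set"
  is_open :: "'p set \<Rightarrow> bool"
  is_regular :: "'p set \<Rightarrow> ('p \<Rightarrow> 'a) \<Rightarrow> bool"

definition variety_iso ::
  "('p, 'a) variety \<Rightarrow> ('q, 'a) variety \<Rightarrow> ('p \<Rightarrow> 'q) \<Rightarrow> bool" where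
  "variety_iso X Y \<phi> \<longleftrightarrow>
     bij_betw \<phi> (points X) (points Y) \<and>
     (\<forall>U \<subseteq> points X. is_open X U \<longleftrightarrow> is_open Y (\<phi> ` U)) \<and>
     (\<forall>U f. is_open X U \<longrightarrow> (is_regular X U (f \<circ> \<phi>) \<longleftrightarrow> is_regular Y (\<phi> ` U) f))"

definition isomorphic_varieties :: "('p, 'a) variety \<Rightarrow> ('q, 'a) variety \<Rightarrow> bool" where
  "isomorphic_varieties X Y \<longleftrightarrow> (\<exists>\<phi>. variety_iso X Y \<phi>)"

text \<open>
  The projectivization of a quasi-cone \<open>C\<close>: points are the orbits of the action on the complement
  of the apex, open sets are the complements of common zero sets of quasi-homogeneous
  functions, and regular functions are locally quotients of quasi-homogeneous functions of equal
  weight. For a subcone \<open>C\<close> of a weighted affine space this is the induced structure of a closed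
  subset of weighted projective space.
\<close>

definition proj_points :: "('v, 'a::field) quasi_cone \<Rightarrow> 'v set set" where
  "proj_points C =
     (let V = cone_set C - {cone_apex C}
      in V // {(x, y). x \<in> V \<and> y \<in> V \<and> (\<exists>c. c \<noteq> 0 \<and> y = cone_act C c x)})"

definition proj_open :: "('v, 'a::field) quasi_cone \<Rightarrow> 'v set set \<Rightarrow> bool" where
  "proj_open C U \<longleftrightarrow>
     (\<exists>F. (\<forall>f \<in> F. \<exists>d. qhom (cone_coords C) d f) \<and>
          U = {P \<in> proj_points C. \<exists>f \<in> F. \<exists>x \<in> P. f x \<noteq> 0})"

definition proj_regular :: "('v, 'a::field) quasi_cone \<Rightarrow> 'v set set \<Rightarrow> ('v set \<Rightarrow> 'a) \<Rightarrow> bool" where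
  "proj_regular C U f \<longleftrightarrow>
     (\<forall>P \<in> U. \<exists>W d g h. proj_open C W \<and> P \<in> W \<and> W \<subseteq> U \<and>
        qhom (cone_coords C) d g \<and> qhom (cone_coords C) d h \<and>
        (\<forall>R \<in> W. \<forall>x \<in> R. h x \<noteq> 0 \<and> f R = g x / h x))"

definition wproj :: "('v, 'a::field) quasi_cone \<Rightarrow> ('v set, 'a) variety" where
  "wproj C = \<lparr> points = proj_points C, is_open = proj_open C, is_regular = proj_regular C \<rparr>"


section \<open>The semigroup, basis monomials and initial forms\<close>

definition S :: "nat set" where
  "S = {5 * a + 6 * b + 7 * c + 8 * d | a b c d. True}"

text \<open>The variables \<open>X\<^sub>n\<close>, \<open>n \<in> xvars\<close>, are indexed by their weights.\<close>

definition xvars :: "nat set" where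
  "xvars = {0, 5, 6, 7, 8}"

definition deg2_monos :: "(nat \<Rightarrow>\<^sub>0 nat) set" where
  "deg2_monos = {Poly_Mapping.single a 1 + Poly_Mapping.single b 1 | a b.
     (a, b) \<in> {(5,5), (5,6), (5,7), (5,8), (6,8), (7,8), (8,8)}}"

text \<open>For \<open>r = 2\<close> this is the list of basis monomials of degree 2, the last set being empty.\<close>

definition basis_monos :: "nat \<Rightarrow> (nat \<Rightarrow>\<^sub>0 nat) set" where
  "basis_monos r =
     {Poly_Mapping.single 0 (r - 1) + Poly_Mapping.single n 1 | n. n \<in> xvars} \<union>
     {Poly_Mapping.single 0 (r - 2 - i) + M + Poly_Mapping.single 8 i | i M.
        i + 2 \<le> r \<and> M \<in> deg2_monos} \<union>
     {Poly_Mapping.single 0 (r - 3 - i) + Poly_Mapping.single 5 2 + Poly_Mapping.single 7 1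
        + Poly_Mapping.single 8 i | i. i + 3 \<le> r}"

definition Lambda :: "nat \<Rightarrow> (nat, 'a::comm_ring_1) mpoly set" where
  "Lambda r = {p. Poly_Mapping.keys p \<subseteq> basis_monos r}"

definition Z :: "nat \<Rightarrow> nat \<Rightarrow> (nat, 'a::comm_ring_1) mpoly" where
  "Z r n = Poly_Mapping.single (THE m. m \<in> basis_monos r \<and> mono_weight id m = n) 1"

text \<open>
  The forms \<open>F\<^sub>i\<close> (\<open>i = 12, 13, 14\<close>, quadratic) and \<open>G\<^sub>i\<close> (\<open>i = 15, 16, 18, 21\<close>, cubic) have
  different weights \<open>i\<close>, so they and their coefficients are indexed uniformly.
\<close>

definition form_weights :: "nat set" where
  "form_weights = {12, 13, 14, 15, 16, 18, 21}"

definition form_degree :: "nat \<Rightarrow> nat" where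
  "form_degree i = (if i \<in> {12, 13, 14} then 2 else 3)"

definition initial_form :: "nat \<Rightarrow> (nat, 'a::comm_ring_1) mpoly" where
  "initial_form i =
    (if i = 12 then Var 6 ^ 2 - Var 5 * Var 7
     else if i = 13 then Var 6 * Var 7 - Var 5 * Var 8
     else if i = 14 then Var 7 ^ 2 - Var 6 * Var 8
     else if i = 15 then Var 5 ^ 3 - Var 0 * Var 7 * Var 8
     else if i = 16 then Var 5 ^ 2 * Var 6 - Var 0 * Var 8 ^ 2
     else if i = 18 then Var 6 ^ 3 - Var 5 ^ 2 * Var 8
     else if i = 21 then Var 7 ^ 3 - Var 5 * Var 8 ^ 2
     else 0)"

text \<open>Left-hand sides of the four syzygies, indexed by their weights, as functions of the forms.\<close>

definition syzygy_weights :: "nat set" where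
  "syzygy_weights = {20, 23, 26, 29}"

definition syzygy_degree :: "nat \<Rightarrow> nat" where
  "syzygy_degree w = (if w = 20 then 3 else 4)"

definition syzygy ::
  "nat \<Rightarrow> (nat \<Rightarrow> (nat, 'a::comm_ring_1) mpoly) \<Rightarrow> (nat, 'a) mpoly" where
  "syzygy w F =
    (if w = 20 then Var 8 * F 12 - Var 7 * F 13 + Var 6 * F 14
     else if w = 23 then Var 8 * F 15 - Var 5 * Var 6 * F 12 + Var 5 * F 18 - Var 7 * F 16
     else if w = 26 then Var 8 * F 18 - Var 5 * F 21 + Var 5 * Var 7 * F 14 - Var 6 * Var 8 * F 12
     else if w = 29 then Var 8 * F 21 - Var 7 * Var 8 * F 14 - Var 8 ^ 2 * F 13
     else 0)"


section \<open>The moduli space\<close>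

text \<open>
  The pair \<open>(i, j)\<close> stands for the coefficient \<open>c\<^bsub>i,j\<^esub>\<close> or \<open>d\<^bsub>i,j\<^esub>\<close>, of weight \<open>j\<close>; the
  coefficients normalized to zero are left out.
\<close>

definition coeff_index :: "(nat \<times> nat) set" where
  "coeff_index = {(i, j). i \<in> form_weights \<and> 1 \<le> j \<and> j \<le> i \<and> i - j \<in> S} -
     {(12,1), (12,2), (12,7), (13,1), (13,2), (13,3), (13,8), (16,1), (16,6), (21,5)}"

text \<open>Polynomials in the \<open>X\<^sub>n\<close> over the polynomial ring in the coefficients \<open>c\<^bsub>i,j\<^esub>\<close>, \<open>d\<^bsub>i,j\<^esub>\<close>.\<close>

type_synonym 'a family_poly = "(nat, (nat \<times> nat, 'a) mpoly) mpoly"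

definition form :: "nat \<Rightarrow> 'a::comm_ring_1 family_poly" where
  "form i = initial_form i -
     (\<Sum>j \<in> {j. (i, j) \<in> coeff_index}. Const (Var (i, j)) * Z (form_degree i) (i - j))"

text \<open>
  One step of the division of a homogeneous polynomial of degree \<open>r\<close>, isobaric of weight \<open>w\<close> if the
  weights of the coefficients \<open>c\<^bsub>i,j\<^esub>\<close>, \<open>d\<^bsub>i,j\<^esub>\<close> are counted: the subtracted multiple has the same
  properties, and its leading form has weight \<open>h + i < w\<close> in the variables \<open>X\<^sub>n\<close>.
\<close>

definition division_step ::
  "nat \<Rightarrow> nat \<Rightarrow> 'a::comm_ring_1 family_poly \<Rightarrow> 'a family_poly \<Rightarrow> bool" where
  "division_step r w p q \<longleftrightarrow>
     (\<exists>i H h. i \<in> form_weights \<and> form_degree i \<le> r \<and> h + i < w \<and>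
        isobaric xvars (\<lambda>_. 1) (r - form_degree i) H \<and>
        isobaric xvars id h H \<and>
        (\<forall>m. isobaric coeff_index snd (w - (h + i)) (Poly_Mapping.lookup H m)) \<and>
        q = p - H * form i)"

text \<open>
  \<open>R w\<close> is a remainder of the syzygy of weight \<open>w\<close>. The division procedure leaves choices, so this
  is a property of \<open>R\<close> rather than a definition.
\<close>

definition syzygy_remainders :: "(nat \<Rightarrow> 'a::comm_ring_1 family_poly) \<Rightarrow> bool" where
  "syzygy_remainders R \<longleftrightarrow>
     (\<forall>w \<in> syzygy_weights.
        (division_step (syzygy_degree w) w)\<^sup>*\<^sup>* (syzygy w form) (R w) \<and>
        R w \<in> Lambda (syzygy_degree w))"

text \<open>The affine quasi-cone \<open>Q\<close> in the 64-dimensional affine space, for given remainders.\<close>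

definition moduli_cone ::
  "(nat \<Rightarrow> 'a::field family_poly) \<Rightarrow> (nat \<times> nat \<Rightarrow> 'a, 'a) quasi_cone" where
  "moduli_cone R = (affine_cone coeff_index snd)
     \<lparr> cone_set := {x. (\<forall>ij. ij \<notin> coeff_index \<longrightarrow> x ij = 0) \<and>
          (\<forall>w \<in> syzygy_weights. \<forall>m. eval_mpoly id x (Poly_Mapping.lookup (R w) m) = 0)} \<rparr>"

definition moduli_space ::
  "(nat \<Rightarrow> 'a::field family_poly) \<Rightarrow> ((nat \<times> nat \<Rightarrow> 'a) set, 'a) variety" where
  "moduli_space R = wproj (moduli_cone R)"


section \<open>The first cotangent cohomology of the semigroup ring\<close>

text \<open>
  \<open>k[S]\<close> as a subring of \<open>k[t]\<close>, presented as the quotient of \<open>k[X\<^sub>5, X\<^sub>6, X\<^sub>7, X\<^sub>8]\<close> by the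
  kernel \<open>pres_ideal\<close> of \<open>X\<^sub>n \<mapsto> t\<^sup>n\<close>.
\<close>

definition semigroup_ring :: "'a::field poly set" where
  "semigroup_ring = {f. \<forall>n. coeff f n \<noteq> 0 \<longrightarrow> n \<in> S}"

definition gen_vars :: "nat set" where
  "gen_vars = {5, 6, 7, 8}"

definition pres :: "(nat, 'a::field) mpoly \<Rightarrow> 'a poly" where
  "pres = eval_mpoly (\<lambda>a. [:a:]) (\<lambda>n. monom 1 n)"

definition pres_ideal :: "(nat, 'a::field) mpoly set" where
  "pres_ideal = {p \<in> polys_in gen_vars. pres p = 0}"

text \<open>
  With \<open>P = k[X\<^sub>5, X\<^sub>6, X\<^sub>7, X\<^sub>8]\<close>, \<open>I = pres_ideal\<close> and \<open>B = k[S]\<close>, the module \<open>T\<^sup>1\<close> is the cokernel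
  of the restriction map from the \<open>k\<close>-derivations \<open>P \<rightarrow> B\<close> to
  \<open>Hom\<^sub>P(I, B) = Hom\<^sub>B(I/I\<^sup>2, B)\<close>. Homomorphisms are extended by zero outside \<open>I\<close>.
\<close>

definition normal_homs :: "((nat, 'a::field) mpoly \<Rightarrow> 'a poly) set" where
  "normal_homs = {\<phi>.
     (\<forall>p \<in> pres_ideal. \<phi> p \<in> semigroup_ring) \<and>
     (\<forall>p \<in> pres_ideal. \<forall>q \<in> pres_ideal. \<phi> (p + q) = \<phi> p + \<phi> q) \<and>
     (\<forall>a \<in> polys_in gen_vars. \<forall>p \<in> pres_ideal. \<phi> (a * p) = pres a * \<phi> p) \<and>
     (\<forall>p. p \<notin> pres_ideal \<longrightarrow> \<phi> p = 0)}"

definition derivations :: "((nat, 'a::field) mpoly \<Rightarrow> 'a poly) set" where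
  "derivations = {\<delta>.
     (\<forall>p \<in> polys_in gen_vars. \<delta> p \<in> semigroup_ring) \<and>
     (\<forall>a. \<delta> (Const a) = 0) \<and>
     (\<forall>p \<in> polys_in gen_vars. \<forall>q \<in> polys_in gen_vars. \<delta> (p + q) = \<delta> p + \<delta> q) \<and>
     (\<forall>p \<in> polys_in gen_vars. \<forall>q \<in> polys_in gen_vars.
        \<delta> (p * q) = pres p * \<delta> q + pres q * \<delta> p)}"

definition t1_class ::
  "((nat, 'a::field) mpoly \<Rightarrow> 'a poly) \<Rightarrow> ((nat, 'a) mpoly \<Rightarrow> 'a poly) set" where
  "t1_class \<phi> = {\<psi> \<in> normal_homs. \<exists>\<delta> \<in> derivations. \<forall>p \<in> pres_ideal. \<psi> p = \<phi> p + \<delta> p}"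

definition T1 :: "((nat, 'a::field) mpoly \<Rightarrow> 'a poly) set set" where
  "T1 = t1_class ` normal_homs"

text \<open>Homomorphisms of degree \<open>-s\<close> and the graded component of \<open>T1\<close> of degree \<open>-s\<close>.\<close>

definition normal_homs_neg :: "nat \<Rightarrow> ((nat, 'a::field) mpoly \<Rightarrow> 'a poly) set" where
  "normal_homs_neg s = {\<phi> \<in> normal_homs.
     \<forall>w. \<forall>p \<in> pres_ideal. isobaric gen_vars id w p \<longrightarrow>
       (\<forall>n. coeff (\<phi> p) n \<noteq> 0 \<longrightarrow> n + s = w)}"

definition T1_neg :: "nat \<Rightarrow> ((nat, 'a::field) mpoly \<Rightarrow> 'a poly) set set" where
  "T1_neg s = {C \<in> T1. C \<inter> normal_homs_neg s \<noteq> {}}"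

definition T1_zero :: "((nat, 'a::field) mpoly \<Rightarrow> 'a poly) set" where
  "T1_zero = t1_class (\<lambda>_. 0)"

text \<open>Scaling of a class by a nonzero scalar.\<close>

definition T1_scale ::
  "'a::field \<Rightarrow> ((nat, 'a) mpoly \<Rightarrow> 'a poly) set \<Rightarrow> ((nat, 'a) mpoly \<Rightarrow> 'a poly) set" where
  "T1_scale a C = (\<lambda>\<phi> p. smult a (\<phi> p)) ` C"

definition T1_linear :: "nat \<Rightarrow> (((nat, 'a::field) mpoly \<Rightarrow> 'a poly) set \<Rightarrow> 'a) \<Rightarrow> bool" where
  "T1_linear s l \<longleftrightarrow>
     (\<forall>\<phi> \<in> normal_homs_neg s. \<forall>\<psi> \<in> normal_homs_neg s.
        l (t1_class (\<lambda>p. \<phi> p + \<psi> p)) = l (t1_class \<phi>) + l (t1_class \<psi>)) \<and>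
     (\<forall>a. \<forall>\<phi> \<in> normal_homs_neg s. l (t1_class (\<lambda>p. smult a (\<phi> p))) = a * l (t1_class \<phi>))"

text \<open>
  The negatively graded part, as the direct sum of the \<open>T1_neg s\<close> with \<open>s \<ge> 1\<close>. The coordinates of
  weight \<open>s\<close> are the linear forms on the component of degree \<open>-s\<close>.
\<close>

definition T1_minus ::
  "(nat \<Rightarrow> ((nat, 'a::field) mpoly \<Rightarrow> 'a poly) set, 'a) quasi_cone" where
  "T1_minus = \<lparr>
     cone_set = {v. v 0 = T1_zero \<and> (\<forall>s \<ge> 1. v s \<in> T1_neg s) \<and> finite {s. v s \<noteq> T1_zero}},
     cone_apex = (\<lambda>_. T1_zero),
     cone_act = (\<lambda>c v s. T1_scale (c ^ s) (v s)),
     cone_coords = (\<lambda>s. {\<lambda>v. l (v s) | l. 1 \<le> s \<and> T1_linear s l}) \<rparr>"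

end

theory Submission
  imports Defs
begin

text \<open>
  The monomial curve is cut out by the Pfaffians of a skew-symmetric \<open>5 \<times> 5\<close> matrix. Perturbing the
  entries gives a family with ten parameters, of the weights in \<open>\<alpha>\<close>. The relations between the Pfaffians
  deform with the matrix, so by Buchberger's criterion the basis monomials stay linearly independent
  modulo the deformed ideal. Hence the remainders of the syzygies vanish on this family, however the
  division was carried out. Conversely, the substitution \<open>X\<^sub>n \<mapsto> t\<^sup>n\<close> shows that in each weight the part
  of the remainders that is linear in the new coefficients does not depend on the division either,
  and these linear parts determine a point of \<open>Q\<close> by ten of its coordinates. So \<open>Q\<close> is the
  graph of a quasi-homogeneous polynomial map on the ten-dimensional space.

  On the other side, every homomorphism of degree \<open>-s\<close> from the ideal of the curve to \<open>k[S]\<close> is the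
  restriction of a derivation \<open>X\<^sub>n \<mapsto> \<beta>\<^sub>n t\<^sup>n\<^sup>-\<^sup>s\<close> with values in the Laurent polynomials. This needs \<open>5 \<noteq> 0\<close> in
  the field, and it reduces \<open>T\<^sup>1\<close> to linear algebra in at most four variables in every degree.
\<close>

text \<open>The division leaves choices, so \<open>Q\<close> is never computed from explicit
  remainders. What is used of a remainder is that it differs from its syzygy by isobaric multiples
  of the forms and that it is supported on basis monomials. The first fact controls its linear part;
  both together make it vanish on the family. Weight alone cannot select leading monomials, since
  the two terms of an initial form have equal weight; the auxiliary weight \<open>tau\<close> breaks
  these ties. The forms of weights 12 to 16 carry the Groebner basis and match the five Pfaffians:
  the first terms X_6^3 and X_7^3 of the other two forms are multiples of X_6^2 and X_7^2. The prime
  5 enters as a determinant. A derivation X_n -> beta_n t^n has on the generators of weights 12, 13,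
  15 three values that are linear in the four numbers beta_n, and the Euler vector beta_n = n lies
  in the kernel. Setting beta_5 = 0 leaves a 3 x 3 system of determinant -5. Syzygies give the
  values at 14 and 16, so what distinguishes the degrees is where the gaps of \<open>S\<close>
  fall.\<close>

abbreviation keys :: "('v \<Rightarrow>\<^sub>0 'a::zero) \<Rightarrow> 'v set" where
  "keys \<equiv> Poly_Mapping.keys"

abbreviation lookup :: "('v \<Rightarrow>\<^sub>0 'a::zero) \<Rightarrow> 'v \<Rightarrow> 'a" where
  "lookup \<equiv> Poly_Mapping.lookup"

abbreviation single :: "'v \<Rightarrow> 'a \<Rightarrow> 'v \<Rightarrow>\<^sub>0 'a::zero" where
  "single \<equiv> Poly_Mapping.single"

section \<open>Polynomials\<close>

lemma mono_weight_superset: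
  assumes "finite A" "keys m \<subseteq> A"
  shows "mono_weight w m = (\<Sum>v\<in>A. lookup m v * w v)"
  unfolding mono_weight_def using assms
  by (intro sum.mono_neutral_left) (auto simp: in_keys_iff)

lemma keys_add_nat:
  "keys (m + m' :: 'v \<Rightarrow>\<^sub>0 nat) = keys m \<union> keys m'"
  by (auto simp: in_keys_iff lookup_add)

lemma mono_weight_add [simp]: "mono_weight w (m + m') = mono_weight w m + mono_weight w m'"
proof -
  let ?A = "keys m \<union> keys m'"
  have "mono_weight w (m + m') = (\<Sum>v\<in>?A. lookup (m + m') v * w v)"
    by (intro mono_weight_superset) (auto simp: keys_add_nat)
  also have "\<dots> = (\<Sum>v\<in>?A. lookup m v * w v) + (\<Sum>v\<in>?A. lookup m' v * w v)"
    by (simp add: lookup_add algebra_simps sum.distrib)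
  also have "\<dots> = mono_weight w m + mono_weight w m'"
    by (intro arg_cong2[of _ _ _ _ "(+)"] mono_weight_superset[symmetric]) auto
  finally show ?thesis .
qed

lemma mono_weight_zero [simp]: "mono_weight w 0 = 0"
  by (simp add: mono_weight_def)

lemma mono_weight_single [simp]: "mono_weight w (single v k) = k * w v"
  by (simp add: mono_weight_def)

lemma poly_mapping_sum_single:
  "(p :: 'v \<Rightarrow>\<^sub>0 'a::comm_monoid_add) = (\<Sum>m\<in>keys p. single m (lookup p m))"
proof (rule poly_mapping_eqI)
  fix k
  show "lookup p k =
    lookup (\<Sum>m\<in>keys p. single m (lookup p m)) k"
    by (simp add: lookup_sum lookup_single when_def in_keys_iff)
qed

lemma poly_mapping_induct [case_names zero single add]:
  assumes "P 0" "\<And>m c. P (single m c)" "\<And>p q. P p \<Longrightarrow> P q \<Longrightarrow> P (p + q)"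
  shows "P (p :: 'v \<Rightarrow>\<^sub>0 'a::comm_monoid_add)"
proof -
  have "P (\<Sum>m\<in>A. single m (lookup p m))" if "finite A" for A
    using that by (induction A) (auto intro: assms)
  from this[of "keys p"] show ?thesis
    using poly_mapping_sum_single[of p] by simp
qed

lemma keys_multE:
  assumes "k \<in> keys (p * q)"
  obtains a b where "a \<in> keys p" "b \<in> keys q" "k = a + b"
  using keys_mult[of p q] assms by blast

lemma Var_power: "Var v ^ n = single (single v n) 1"
  by (induction n) (simp_all add: Var_def mult_single single_add[symmetric])

lemma Const_0 [simp]: "Const 0 = 0"
  and Const_1 [simp]: "Const 1 = 1"
  and Const_add: "Const (a + b) = Const a + Const b"
  and Const_mult: "Const (a * b) = Const a * Const b"
  by (simp_all add: Const_def single_add mult_single)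

lemma Const_uminus: "Const (- a) = - Const a"
  by (simp add: Const_def single_uminus)

lemma Const_diff: "Const (a - b) = Const a - Const b"
  by (simp add: Const_def single_diff)

lemma Const_mult_single: "Const a * single m b = single m (a * b)"
  by (simp add: Const_def mult_single)

section \<open>Evaluation as a ring homomorphism\<close>

definition mono_eval :: "('v \<Rightarrow> 'b::comm_ring_1) \<Rightarrow> ('v \<Rightarrow>\<^sub>0 nat) \<Rightarrow> 'b" where
  "mono_eval x m = (\<Prod>v\<in>keys m. x v ^ lookup m v)"

lemma mono_eval_superset:
  assumes "finite A" "keys m \<subseteq> A"
  shows "mono_eval x m = (\<Prod>v\<in>A. x v ^ lookup m v)"
  unfolding mono_eval_def using assms
  by (intro prod.mono_neutral_left) (auto simp: in_keys_iff)

lemma mono_eval_add: "mono_eval x (m + m') = mono_eval x m * mono_eval x m'"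
proof -
  let ?A = "keys m \<union> keys m'"
  have "mono_eval x (m + m') = (\<Prod>v\<in>?A. x v ^ lookup (m + m') v)"
    by (intro mono_eval_superset) (auto simp: keys_add_nat)
  also have "\<dots> = (\<Prod>v\<in>?A. x v ^ lookup m v) * (\<Prod>v\<in>?A. x v ^ lookup m' v)"
    by (simp add: lookup_add power_add prod.distrib)
  also have "\<dots> = mono_eval x m * mono_eval x m'"
    by (intro arg_cong2[of _ _ _ _ "(*)"] mono_eval_superset[symmetric]) auto
  finally show ?thesis .
qed

lemma mono_eval_zero [simp]: "mono_eval x 0 = 1"
  by (simp add: mono_eval_def)

lemma mono_eval_single [simp]: "mono_eval x (single v k) = x v ^ k"
  by (simp add: mono_eval_def)

lemma eval_mpoly_alt:
  "eval_mpoly h x p = (\<Sum>m\<in>keys p. h (lookup p m) * mono_eval x m)"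
  by (simp add: eval_mpoly_def mono_eval_def)

text \<open>Evaluation is used with several coefficient maps: the identity for points,
  \<open>[:a:]\<close> for \<open>pres\<close>, and \<open>Const\<close> after an inner evaluation
  for \<open>spec\<close>. The locale treats them at once.\<close>

locale coeff_hom =
  fixes h :: "'a::comm_ring_1 \<Rightarrow> 'b::comm_ring_1"
  assumes hom_add: "h (a + b) = h a + h b"
    and hom_mult: "h (a * b) = h a * h b"
    and hom_one: "h 1 = 1"
begin

lemma hom_zero [simp]: "h 0 = 0"
  using hom_add[of 0 0] by simp

lemma hom_uminus: "h (- a) = - h a"
  using hom_add[of a "- a"] by (simp add: eq_neg_iff_add_eq_0 add.commute)

lemma eval_superset:
  assumes "finite A" "keys p \<subseteq> A"
  shows "eval_mpoly h x p = (\<Sum>m\<in>A. h (lookup p m) * mono_eval x m)"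
  unfolding eval_mpoly_alt using assms
  by (intro sum.mono_neutral_left) (auto simp: in_keys_iff)

lemma eval_zero [simp]: "eval_mpoly h x 0 = 0"
  by (simp add: eval_mpoly_def)

lemma eval_single: "eval_mpoly h x (single m c) = h c * mono_eval x m"
  by (simp add: eval_mpoly_alt)

lemma eval_add: "eval_mpoly h x (p + q) = eval_mpoly h x p + eval_mpoly h x q"
proof -
  let ?A = "keys p \<union> keys q"
  have "eval_mpoly h x (p + q) = (\<Sum>m\<in>?A. h (lookup (p + q) m) * mono_eval x m)"
    using keys_add[of p q] by (intro eval_superset) auto
  also have "\<dots> = (\<Sum>m\<in>?A. h (lookup p m) * mono_eval x m)
      + (\<Sum>m\<in>?A. h (lookup q m) * mono_eval x m)"
    by (simp add: lookup_add hom_add algebra_simps sum.distrib)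
  also have "\<dots> = eval_mpoly h x p + eval_mpoly h x q"
    by (intro arg_cong2[of _ _ _ _ "(+)"] eval_superset[symmetric]) auto
  finally show ?thesis .
qed

lemma eval_mult: "eval_mpoly h x (p * q) = eval_mpoly h x p * eval_mpoly h x q"
proof (induction p rule: poly_mapping_induct)
  case (single m c)
  show ?case
  proof (induction q rule: poly_mapping_induct)
    case (single n d)
    then show ?case
      by (simp add: mult_single eval_single hom_mult mono_eval_add algebra_simps)
  qed (simp_all add: algebra_simps eval_add)
qed (simp_all add: algebra_simps eval_add)

lemma eval_Const [simp]: "eval_mpoly h x (Const c) = h c"
  by (simp add: Const_def eval_single)

lemma eval_Var [simp]: "eval_mpoly h x (Var v) = x v"
  by (simp add: Var_def eval_single hom_one)

lemma eval_one [simp]: "eval_mpoly h x 1 = 1"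
  using eval_Const[of x 1] by (simp add: hom_one)

lemma eval_uminus: "eval_mpoly h x (- p) = - eval_mpoly h x p"
  using eval_add[of x p "- p"] by (simp add: eq_neg_iff_add_eq_0 add.commute)

lemma eval_diff: "eval_mpoly h x (p - q) = eval_mpoly h x p - eval_mpoly h x q"
  using eval_add[of x p "- q"] by (simp add: eval_uminus)

lemma eval_power: "eval_mpoly h x (p ^ n) = eval_mpoly h x p ^ n"
  by (induction n) (simp_all add: eval_mult)

lemma eval_sum: "eval_mpoly h x (\<Sum>i\<in>A. f i) = (\<Sum>i\<in>A. eval_mpoly h x (f i))"
  by (induction A rule: infinite_finite_induct) (simp_all add: eval_add)

lemmas eval_simps = eval_add eval_mult eval_uminus eval_diff eval_power eval_sum

lemma coeff_hom_eval: "coeff_hom (eval_mpoly h x)"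
  by unfold_locales (simp_all add: eval_add eval_mult)

end

lemma coeff_hom_id: "coeff_hom id"
  by unfold_locales auto

lemma coeff_hom_Const: "coeff_hom (Const :: 'a::comm_ring_1 \<Rightarrow> ('v, 'a) mpoly)"
  by unfold_locales (auto simp: Const_add Const_mult)

lemma coeff_hom_comp: "coeff_hom g \<Longrightarrow> coeff_hom h \<Longrightarrow> coeff_hom (\<lambda>x. g (h x))"
  by (auto simp: coeff_hom_def)

lemma coeff_hom_const_poly: "coeff_hom (\<lambda>a::'a::comm_ring_1. [:a:])"
  by unfold_locales (auto simp: one_pCons)

lemma mono_eval_Var: "mono_eval Var m = single m (1::'a::comm_ring_1)"
proof (induction m rule: poly_mapping_induct)
  case (single v k)
  then show ?case by (simp add: Var_power)
qed (simp_all add: mono_eval_add mult_single)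

section \<open>The parametrization of the monomial curve\<close>

interpretation pres: coeff_hom "\<lambda>a::'a::field. [:a:]"
  by (rule coeff_hom_const_poly)

lemma pres_simps:
  "pres (p + q) = pres p + pres q" "pres (p * q) = pres p * pres q" "pres (- p) = - pres p"
  "pres (p - q) = pres p - pres q" "pres (p ^ k) = pres p ^ k" "pres (Const c) = [:c:]"
  "pres (Var v) = monom 1 v" "pres 0 = 0" "pres 1 = 1"
  by (simp_all add: pres_def pres.eval_simps)

lemma pres_sum: "pres (\<Sum>i\<in>A. f i) = (\<Sum>i\<in>A. pres (f i))"
  by (simp add: pres_def pres.eval_sum)

lemma mono_eval_monom: "mono_eval (\<lambda>n. monom (1::'a::field) n) m = monom 1 (mono_weight id m)"
proof (induction m rule: poly_mapping_induct)
  case (single v k)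
  then show ?case by (simp add: monom_power mult.commute)
qed (simp_all add: mono_eval_add mult_monom)

lemma pres_single: "pres (single m c) = monom c (mono_weight id m)"
  by (simp add: pres_def pres.eval_single mono_eval_monom smult_monom)

lemma pres_expand:
  "pres p = (\<Sum>m\<in>keys p. monom (lookup p m) (mono_weight id m))"
  by (simp add: pres_def eval_mpoly_alt mono_eval_monom smult_monom)

section \<open>Isomorphisms of quasi-cones and of their projectivizations\<close>

text \<open>Quasi-homogeneous functions are generated by coordinates, so a correspondence has to be
  checked on coordinates only. The two maps \<open>u\<close> and \<open>v\<close> out of
  \<open>X\<close> let one induction serve both directions: pulling back takes \<open>v\<close> as
  the identity, pushing forward takes \<open>u\<close> as the identity.\<close>

lemma qhom_transfer:
  assumes "qhom L d f"
    and coords: "\<And>s l. l \<in> L s \<Longrightarrow> \<exists>g. qhom L' s g \<and> (\<forall>x \<in> X. g (v x) = l (u x))"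
  shows "\<exists>g. qhom L' d g \<and> (\<forall>x \<in> X. g (v x) = f (u x))"
  using assms(1)
proof induction
  case (const a)
  then show ?case by (intro exI[of _ "\<lambda>_. a"]) (auto intro: qhom.intros)
next
  case (zero d)
  then show ?case by (intro exI[of _ "\<lambda>_. 0"]) (auto intro: qhom.intros)
next
  case (coord l s)
  then show ?case by (rule coords)
next
  case (add d f g)
  then obtain f' g' where "qhom L' d f'" "\<forall>x \<in> X. f' (v x) = f (u x)"
    "qhom L' d g'" "\<forall>x \<in> X. g' (v x) = g (u x)" by blast
  then show ?case by (intro exI[of _ "\<lambda>x. f' x + g' x"]) (auto intro: qhom.intros)
next
  case (mult d f e g)
  then obtain f' g' where "qhom L' d f'" "\<forall>x \<in> X. f' (v x) = f (u x)"
    "qhom L' e g'" "\<forall>x \<in> X. g' (v x) = g (u x)" by blast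
  then show ?case by (intro exI[of _ "\<lambda>x. f' x * g' x"]) (auto intro: qhom.intros)
qed

lemma quasi_cone_isoI:
  assumes bij: "bij_betw \<Phi> (cone_set C) (cone_set D)"
    and act: "\<And>c x. c \<noteq> 0 \<Longrightarrow> x \<in> cone_set C \<Longrightarrow> \<Phi> (cone_act C c x) = cone_act D c (\<Phi> x)"
    and pull: "\<And>s l. l \<in> cone_coords D s \<Longrightarrow>
      \<exists>g. qhom (cone_coords C) s g \<and> (\<forall>x \<in> cone_set C. g x = l (\<Phi> x))"
    and push: "\<And>s l. l \<in> cone_coords C s \<Longrightarrow>
      \<exists>f. qhom (cone_coords D) s f \<and> (\<forall>x \<in> cone_set C. l x = f (\<Phi> x))"
  shows "quasi_cone_iso C D \<Phi>"
proof -
  have "\<exists>g. qhom (cone_coords C) d g \<and> (\<forall>x \<in> cone_set C. g x = f (\<Phi> x))"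
    if "qhom (cone_coords D) d f" for d f
    using qhom_transfer[OF that, where v = "\<lambda>x. x" and u = \<Phi> and X = "cone_set C"] pull by blast
  moreover have "\<exists>f. qhom (cone_coords D) d f \<and> (\<forall>x \<in> cone_set C. g x = f (\<Phi> x))"
    if "qhom (cone_coords C) d g" for d g
    using qhom_transfer[OF that, where u = "\<lambda>x. x" and v = \<Phi> and X = "cone_set C"] push
    by (metis (lifting))
  ultimately show ?thesis
    unfolding quasi_cone_iso_def using bij act by blast
qed

text \<open>
  The apex and the invariance of the set under the action are not part of
  \<^const>\<open>quasi_cone_iso\<close>, but the projectivization depends on them.
\<close>

definition cone_iso ::
  "('v, 'a::field) quasi_cone \<Rightarrow> ('w, 'a) quasi_cone \<Rightarrow> ('v \<Rightarrow> 'w) \<Rightarrow> bool" where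
  "cone_iso C D \<Phi> \<longleftrightarrow> quasi_cone_iso C D \<Phi> \<and> cone_apex C \<in> cone_set C \<and>
     \<Phi> (cone_apex C) = cone_apex D \<and>
     (\<forall>c x. c \<noteq> 0 \<longrightarrow> x \<in> cone_set C \<longrightarrow> cone_act C c x \<in> cone_set C)"

lemma cone_isoD:
  assumes "cone_iso C D \<Phi>"
  shows "bij_betw \<Phi> (cone_set C) (cone_set D)"
    "\<And>c x. c \<noteq> 0 \<Longrightarrow> x \<in> cone_set C \<Longrightarrow> \<Phi> (cone_act C c x) = cone_act D c (\<Phi> x)"
    "\<And>d f. qhom (cone_coords D) d f \<Longrightarrow>
        \<exists>g. qhom (cone_coords C) d g \<and> (\<forall>x \<in> cone_set C. g x = f (\<Phi> x))"
    "\<And>d g. qhom (cone_coords C) d g \<Longrightarrow>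
        \<exists>f. qhom (cone_coords D) d f \<and> (\<forall>x \<in> cone_set C. g x = f (\<Phi> x))"
    "cone_apex C \<in> cone_set C" "\<Phi> (cone_apex C) = cone_apex D"
    "\<And>c x. c \<noteq> 0 \<Longrightarrow> x \<in> cone_set C \<Longrightarrow> cone_act C c x \<in> cone_set C"
  using assms unfolding cone_iso_def quasi_cone_iso_def by blast+

lemma cone_iso_inv:
  assumes "cone_iso C D \<Phi>"
  shows "cone_iso D C (inv_into (cone_set C) \<Phi>)"
proof -
  note iso = cone_isoD[OF assms]
  let ?\<Psi> = "inv_into (cone_set C) \<Phi>"
  have inj: "inj_on \<Phi> (cone_set C)" and im: "\<Phi> ` cone_set C = cone_set D"
    using iso(1) by (auto simp: bij_betw_def)
  have inv: "?\<Psi> (\<Phi> x) = x" if "x \<in> cone_set C" for x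
    using inj that by simp
  have ex: "\<exists>x \<in> cone_set C. y = \<Phi> x \<and> ?\<Psi> y = x" if "y \<in> cone_set D" for y
    using that im inv by (metis imageE)
  have act: "?\<Psi> (cone_act D c y) = cone_act C c (?\<Psi> y) \<and> cone_act D c y \<in> cone_set D"
    if cy: "c \<noteq> 0" "y \<in> cone_set D" for c y
  proof -
    obtain x where x: "x \<in> cone_set C" "y = \<Phi> x" "?\<Psi> y = x" using ex cy by blast
    have "cone_act D c y = \<Phi> (cone_act C c x)" using iso(2) cy x by simp
    then show ?thesis using inv iso(7) cy x im by auto
  qed
  have "quasi_cone_iso D C ?\<Psi>"
  proof (rule quasi_cone_isoI)
    show "bij_betw ?\<Psi> (cone_set D) (cone_set C)" by (rule bij_betw_inv_into[OF iso(1)])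
  next
    fix s l assume "l \<in> cone_coords C s"
    then have "qhom (cone_coords C) s l" by (rule qhom.coord)
    from iso(4)[OF this] obtain f where
      "qhom (cone_coords D) s f" "\<forall>x \<in> cone_set C. l x = f (\<Phi> x)" by blast
    then show "\<exists>g. qhom (cone_coords D) s g \<and> (\<forall>x \<in> cone_set D. g x = l (?\<Psi> x))"
      using ex by (intro exI[of _ f]) metis
  next
    fix s l assume "l \<in> cone_coords D s"
    then have "qhom (cone_coords D) s l" by (rule qhom.coord)
    from iso(3)[OF this] obtain f where
      "qhom (cone_coords C) s f" "\<forall>x \<in> cone_set C. f x = l (\<Phi> x)" by blast
    then show "\<exists>f. qhom (cone_coords C) s f \<and> (\<forall>x \<in> cone_set D. l x = f (?\<Psi> x))"
      using ex by (intro exI[of _ f]) metis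
  qed (use act in auto)
  moreover have "cone_apex D \<in> cone_set D" "?\<Psi> (cone_apex D) = cone_apex C"
    using iso(5,6) im inv[OF iso(5)] imageI[OF iso(5), of \<Phi>] by auto
  ultimately show ?thesis
    using act unfolding cone_iso_def by blast
qed

lemma cone_iso_comp:
  assumes "cone_iso C D \<Phi>" "cone_iso D E \<Psi>"
  shows "cone_iso C E (\<Psi> \<circ> \<Phi>)"
proof -
  note iso1 = cone_isoD[OF assms(1)] and iso2 = cone_isoD[OF assms(2)]
  have mem: "\<Phi> x \<in> cone_set D" if "x \<in> cone_set C" for x
    using iso1(1) that by (auto simp: bij_betw_def)
  have "quasi_cone_iso C E (\<Psi> \<circ> \<Phi>)"
  proof (rule quasi_cone_isoI)
    show "bij_betw (\<Psi> \<circ> \<Phi>) (cone_set C) (cone_set E)"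
      by (rule bij_betw_trans[OF iso1(1) iso2(1)])
  next
    fix s l assume "l \<in> cone_coords E s"
    then have "qhom (cone_coords E) s l" by (rule qhom.coord)
    from iso2(3)[OF this] obtain f where
      f: "qhom (cone_coords D) s f" "\<forall>x \<in> cone_set D. f x = l (\<Psi> x)" by blast
    from iso1(3)[OF f(1)] f(2) mem show
      "\<exists>g. qhom (cone_coords C) s g \<and> (\<forall>x \<in> cone_set C. g x = l ((\<Psi> \<circ> \<Phi>) x))"
      by auto
  next
    fix s l assume "l \<in> cone_coords C s"
    then have "qhom (cone_coords C) s l" by (rule qhom.coord)
    from iso1(4)[OF this] obtain f where
      f: "qhom (cone_coords D) s f" "\<forall>x \<in> cone_set C. l x = f (\<Phi> x)" by blast
    from iso2(4)[OF f(1)] f(2) mem show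
      "\<exists>f. qhom (cone_coords E) s f \<and> (\<forall>x \<in> cone_set C. l x = f ((\<Psi> \<circ> \<Phi>) x))"
      by auto
  qed (use iso1 iso2 mem in auto)
  then show ?thesis
    using iso1(5-7) iso2(6) unfolding cone_iso_def by auto
qed

lemma image_Collect_comp: "f ` {x \<in> A. Q (f x)} = {y \<in> f ` A. Q y}"
  by auto

section \<open>Points, open sets and regular functions of a projectivization\<close>

definition orbit :: "('v, 'a::field) quasi_cone \<Rightarrow> 'v \<Rightarrow> 'v set" where
  "orbit C x = {y \<in> cone_set C - {cone_apex C}. \<exists>c. c \<noteq> 0 \<and> y = cone_act C c x}"

lemma proj_points_orbits: "proj_points C = orbit C ` (cone_set C - {cone_apex C})"
  unfolding proj_points_def Let_def quotient_def orbit_def by auto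

lemma proj_points_subset: "P \<in> proj_points C \<Longrightarrow> P \<subseteq> cone_set C"
  by (auto simp: proj_points_orbits orbit_def)

text \<open>Used where a function is composed with an isomorphism and then with its inverse: the
  result agrees with the original on the points of the cone only.\<close>

lemma proj_regular_cong:
  assumes "proj_regular C U f" "\<And>P. P \<in> U \<Longrightarrow> f P = g P"
  shows "proj_regular C U g"
  unfolding proj_regular_def
proof
  fix P assume "P \<in> U"
  then obtain W d a b where "proj_open C W" "P \<in> W" "W \<subseteq> U" "qhom (cone_coords C) d a"
    "qhom (cone_coords C) d b" "\<forall>R \<in> W. \<forall>x \<in> R. b x \<noteq> 0 \<and> f R = a x / b x"
    using assms(1) unfolding proj_regular_def by blast
  moreover from this(3,6) have "\<forall>R \<in> W. \<forall>x \<in> R. b x \<noteq> 0 \<and> g R = a x / b x"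
    using assms(2) by (metis subsetD)
  ultimately show "\<exists>W d a b. proj_open C W \<and> P \<in> W \<and> W \<subseteq> U \<and>
        qhom (cone_coords C) d a \<and> qhom (cone_coords C) d b \<and>
        (\<forall>R \<in> W. \<forall>x \<in> R. b x \<noteq> 0 \<and> g R = a x / b x)"
    by blast
qed

context
  fixes C :: "('v, 'a::field) quasi_cone" and D :: "('w, 'a) quasi_cone" and \<Phi>
  assumes iso: "cone_iso C D \<Phi>"
begin

lemma cone_iso_orbit:
  assumes "x \<in> cone_set C"
  shows "\<Phi> ` orbit C x = orbit D (\<Phi> x)"
proof -
  note iso' = cone_isoD[OF iso]
  have inj: "inj_on \<Phi> (cone_set C)" and im: "\<Phi> ` cone_set C = cone_set D"
    using iso'(1) by (auto simp: bij_betw_def)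
  show ?thesis
  proof
    show "\<Phi> ` orbit C x \<subseteq> orbit D (\<Phi> x)"
    proof
      fix y' assume "y' \<in> \<Phi> ` orbit C x"
      then obtain c where c: "c \<noteq> 0" "y' = \<Phi> (cone_act C c x)"
        "cone_act C c x \<in> cone_set C" "cone_act C c x \<noteq> cone_apex C"
        by (auto simp: orbit_def)
      then have "y' \<in> cone_set D" "y' \<noteq> cone_apex D"
        using im inj_on_eq_iff[OF inj _ iso'(5)] iso'(6) by auto
      then show "y' \<in> orbit D (\<Phi> x)"
        using c iso'(2)[OF c(1) assms] by (auto simp: orbit_def)
    qed
    show "orbit D (\<Phi> x) \<subseteq> \<Phi> ` orbit C x"
    proof
      fix y' assume "y' \<in> orbit D (\<Phi> x)"
      then obtain c where c: "c \<noteq> 0" "y' = cone_act D c (\<Phi> x)" "y' \<noteq> cone_apex D"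
        by (auto simp: orbit_def)
      then have "y' = \<Phi> (cone_act C c x)" using iso'(2) assms by simp
      moreover from this have "cone_act C c x \<noteq> cone_apex C" using c iso'(6) by auto
      ultimately show "y' \<in> \<Phi> ` orbit C x"
        using c iso'(7)[OF c(1) assms] by (auto simp: orbit_def)
    qed
  qed
qed

lemma cone_iso_bij_points: "bij_betw ((`) \<Phi>) (proj_points C) (proj_points D)"
proof -
  note iso' = cone_isoD[OF iso]
  have inj: "inj_on \<Phi> (cone_set C)" and im: "\<Phi> ` cone_set C = cone_set D"
    using iso'(1) by (auto simp: bij_betw_def)
  have inj': "inj_on ((`) \<Phi>) (proj_points C)"
    by (rule inj_onI) (simp add: inj_on_image_eq_iff[OF inj] proj_points_subset)
  have im': "\<Phi> ` (cone_set C - {cone_apex C}) = cone_set D - {cone_apex D}"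
    using inj_on_image_set_diff[OF inj, of "cone_set C" "{cone_apex C}"] im iso'(5,6) by simp
  have "(`) \<Phi> ` proj_points C = (\<lambda>x. orbit D (\<Phi> x)) ` (cone_set C - {cone_apex C})"
    unfolding proj_points_orbits image_image by (intro image_cong) (simp_all add: cone_iso_orbit)
  also have "\<dots> = proj_points D"
    unfolding proj_points_orbits im'[symmetric] by (simp add: image_image)
  finally show ?thesis using inj' by (simp add: bij_betw_def)
qed

lemma cone_iso_proj_open:
  assumes "proj_open C U"
  shows "proj_open D ((`) \<Phi> ` U)"
proof -
  obtain F where F: "\<forall>f \<in> F. \<exists>d. qhom (cone_coords C) d f"
    "U = {P \<in> proj_points C. \<exists>f \<in> F. \<exists>x \<in> P. f x \<noteq> 0}"
    using assms unfolding proj_open_def by blast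
  \<comment> \<open>\<open>G\<close> collects every function on \<open>D\<close> that corresponds to
    some member of \<open>F\<close>, so no single counterpart has to be chosen for each
    member.\<close>
  define G where
    "G = {g. \<exists>f \<in> F. \<exists>d. qhom (cone_coords D) d g \<and> (\<forall>x \<in> cone_set C. f x = g (\<Phi> x))}"
  have FG: "\<exists>g \<in> G. \<forall>x \<in> cone_set C. f x = g (\<Phi> x)" if "f \<in> F" for f
    using F(1) that cone_isoD(4)[OF iso] unfolding G_def by blast
  have "(\<exists>f \<in> F. \<exists>x \<in> P. f x \<noteq> 0) \<longleftrightarrow> (\<exists>g \<in> G. \<exists>y \<in> \<Phi> ` P. g y \<noteq> 0)"
    if "P \<in> proj_points C" for P
  proof -
    have sub: "x \<in> cone_set C" if "x \<in> P" for x
      using proj_points_subset[OF \<open>P \<in> proj_points C\<close>] that by blast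
    show ?thesis
    proof
      assume "\<exists>f \<in> F. \<exists>x \<in> P. f x \<noteq> 0"
      then obtain f x where f: "f \<in> F" "x \<in> P" "f x \<noteq> 0" by blast
      obtain g where "g \<in> G" "\<forall>x \<in> cone_set C. f x = g (\<Phi> x)" using FG[OF f(1)] by blast
      then show "\<exists>g \<in> G. \<exists>y \<in> \<Phi> ` P. g y \<noteq> 0"
        using f sub[OF f(2)] by (intro bexI[of _ g] bexI[of _ "\<Phi> x"]) auto
    next
      assume "\<exists>g \<in> G. \<exists>y \<in> \<Phi> ` P. g y \<noteq> 0"
      then obtain g x where g: "g \<in> G" "x \<in> P" "g (\<Phi> x) \<noteq> 0" by blast
      then obtain f where "f \<in> F" "\<forall>x \<in> cone_set C. f x = g (\<Phi> x)" unfolding G_def by blast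
      then show "\<exists>f \<in> F. \<exists>x \<in> P. f x \<noteq> 0"
        using g sub[OF g(2)] by (intro bexI[of _ f] bexI[of _ x]) auto
    qed
  qed
  then have "U = {P \<in> proj_points C. \<exists>g \<in> G. \<exists>y \<in> \<Phi> ` P. g y \<noteq> 0}"
    unfolding F(2) by (intro Collect_cong conj_cong) simp_all
  then have "(`) \<Phi> ` U = (`) \<Phi> ` {P \<in> proj_points C. \<exists>g \<in> G. \<exists>y \<in> \<Phi> ` P. g y \<noteq> 0}"
    by (rule arg_cong)
  also have "\<dots> = {P \<in> (`) \<Phi> ` proj_points C. \<exists>g \<in> G. \<exists>y \<in> P. g y \<noteq> 0}"
    by (rule image_Collect_comp[where Q = "\<lambda>P. \<exists>g \<in> G. \<exists>y \<in> P. g y \<noteq> 0"])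
  also have "(`) \<Phi> ` proj_points C = proj_points D"
    using cone_iso_bij_points by (simp add: bij_betw_def)
  finally show ?thesis
    unfolding proj_open_def by (intro exI[of _ G]) (auto simp: G_def)
qed

lemma cone_iso_proj_regular:
  assumes U: "proj_open C U" and reg: "proj_regular C U (f \<circ> (`) \<Phi>)"
  shows "proj_regular D ((`) \<Phi> ` U) f"
  unfolding proj_regular_def
proof
  fix P' assume "P' \<in> (`) \<Phi> ` U"
  then obtain P where P: "P \<in> U" "P' = \<Phi> ` P" by blast
  then obtain W d a b where W: "proj_open C W" "P \<in> W" "W \<subseteq> U" "qhom (cone_coords C) d a"
    "qhom (cone_coords C) d b" "\<forall>R \<in> W. \<forall>x \<in> R. b x \<noteq> 0 \<and> (f \<circ> (`) \<Phi>) R = a x / b x"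
    using reg unfolding proj_regular_def by blast
  obtain a' where a: "qhom (cone_coords D) d a'" "\<forall>x \<in> cone_set C. a x = a' (\<Phi> x)"
    using cone_isoD(4)[OF iso W(4)] by blast
  obtain b' where b: "qhom (cone_coords D) d b'" "\<forall>x \<in> cone_set C. b x = b' (\<Phi> x)"
    using cone_isoD(4)[OF iso W(5)] by blast
  have "W \<subseteq> proj_points C" using W(1) by (auto simp: proj_open_def)
  then have "\<forall>R \<in> W. R \<subseteq> cone_set C" using proj_points_subset by blast
  then have "\<forall>R \<in> (`) \<Phi> ` W. \<forall>x \<in> R. b' x \<noteq> 0 \<and> f R = a' x / b' x"
    using W(6) a b by (auto simp: subset_iff)
  then show "\<exists>W d a b. proj_open D W \<and> P' \<in> W \<and> W \<subseteq> (`) \<Phi> ` U \<and>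
      qhom (cone_coords D) d a \<and> qhom (cone_coords D) d b \<and>
      (\<forall>R \<in> W. \<forall>x \<in> R. b x \<noteq> 0 \<and> f R = a x / b x)"
    using cone_iso_proj_open[OF W(1)] P(2) imageI[OF W(2), of "(`) \<Phi>"]
      image_mono[OF W(3), of "(`) \<Phi>"] a(1) b(1)
    by (intro exI[of _ "(`) \<Phi> ` W"] exI[of _ d] exI[of _ a'] exI[of _ b'] conjI) simp_all
qed

end

text \<open>A cone isomorphism carries open sets to open sets and regular functions to regular
  functions; the same facts for the inverse isomorphism turn these implications into
  equivalences.\<close>

lemma cone_iso_variety_iso:
  assumes iso: "cone_iso C D \<Phi>"
  shows "variety_iso (wproj C) (wproj D) ((`) \<Phi>)"
proof -
  let ?\<Psi> = "inv_into (cone_set C) \<Phi>"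
  have iso': "cone_iso D C ?\<Psi>" by (rule cone_iso_inv[OF iso])
  have "inj_on \<Phi> (cone_set C)" using cone_isoD(1)[OF iso] by (auto simp: bij_betw_def)
  then have inv: "?\<Psi> ` \<Phi> ` P = P" if "P \<in> proj_points C" for P
    using proj_points_subset[OF that] by simp
  then have inv2: "(`) ?\<Psi> ` (`) \<Phi> ` U = U" if "U \<subseteq> proj_points C" for U
    unfolding image_comp using inv that by (intro image_cong[where g = id, simplified]) auto
  have open_iff: "proj_open C U \<longleftrightarrow> proj_open D ((`) \<Phi> ` U)" if "U \<subseteq> proj_points C" for U
    using cone_iso_proj_open[OF iso] cone_iso_proj_open[OF iso', of "(`) \<Phi> ` U"] inv2[OF that]
    by auto
  have "proj_regular C U (f \<circ> (`) \<Phi>) \<longleftrightarrow> proj_regular D ((`) \<Phi> ` U) f"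
    if U: "proj_open C U" for U f
  proof
    assume "proj_regular C U (f \<circ> (`) \<Phi>)"
    with U show "proj_regular D ((`) \<Phi> ` U) f" by (rule cone_iso_proj_regular[OF iso])
  next
    have sub: "U \<subseteq> proj_points C" using U by (auto simp: proj_open_def)
    assume "proj_regular D ((`) \<Phi> ` U) f"
    then have "proj_regular D ((`) \<Phi> ` U) ((f \<circ> (`) \<Phi>) \<circ> (`) ?\<Psi>)"
      by (rule proj_regular_cong) (use inv sub in auto)
    with cone_iso_proj_regular[OF iso' cone_iso_proj_open[OF iso U]] inv2[OF sub]
    show "proj_regular C U (f \<circ> (`) \<Phi>)" by simp
  qed
  then show ?thesis
    unfolding variety_iso_def wproj_def using open_iff cone_iso_bij_points[OF iso] by auto
qed

section \<open>Standard monomials are independent modulo an ideal with liftable S-pairs\<close>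

text \<open>The common shape of \<open>top_part\<close> and \<open>log_deriv\<close>: a map given on
  terms, additive in the coefficient, and extended to polynomials.\<close>

definition keys_sum :: "('m \<Rightarrow> 'a \<Rightarrow> 'b::comm_monoid_add) \<Rightarrow> ('m \<Rightarrow>\<^sub>0 'a::zero) \<Rightarrow> 'b" where
  "keys_sum g p = (\<Sum>m\<in>keys p. g m (lookup p m))"

lemma keys_sum_single: "g m 0 = 0 \<Longrightarrow> keys_sum g (single m c) = g m c"
  by (simp add: keys_sum_def)

lemma keys_sum_zero [simp]: "keys_sum g 0 = 0"
  by (simp add: keys_sum_def)

lemma keys_sum_add:
  assumes "\<And>m. g m 0 = 0" "\<And>m a b. g m (a + b) = g m a + g m b"
  shows "keys_sum g (p + q) = keys_sum g p + keys_sum g (q :: 'm \<Rightarrow>\<^sub>0 'a::comm_monoid_add)"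
proof -
  let ?A = "keys p \<union> keys q"
  have super: "keys_sum g r = (\<Sum>m\<in>?A. g m (lookup r m))"
    if "keys r \<subseteq> ?A" for r
    unfolding keys_sum_def using that assms(1)
    by (intro sum.mono_neutral_left) (auto simp: in_keys_iff)
  have "keys_sum g (p + q) = (\<Sum>m\<in>?A. g m (lookup (p + q) m))"
    using keys_add[of p q] by (intro super) auto
  also have "\<dots> = keys_sum g p + keys_sum g q"
    by (simp add: super lookup_add assms(2) sum.distrib)
  finally show ?thesis .
qed

text \<open>The bound \<open>n\<close> restricts a representation by multiples of the generators,
  not the polynomial itself: leading terms may cancel, and \<open>p\<close> may be much smaller than
  the multiples that produce it. Buchberger's criterion controls exactly this cancellation.\<close>

inductive low_comb :: "('v \<Rightarrow> nat) \<Rightarrow> 'i set \<Rightarrow> ('i \<Rightarrow> ('v, 'a::comm_ring_1) mpoly) \<Rightarrow>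
    ('i \<Rightarrow> ('v \<Rightarrow>\<^sub>0 nat)) \<Rightarrow> nat \<Rightarrow> ('v, 'a) mpoly \<Rightarrow> bool"
  for w I f e where
  zero: "low_comb w I f e n 0"
| add: "low_comb w I f e n p \<Longrightarrow> low_comb w I f e n q \<Longrightarrow> low_comb w I f e n (p + q)"
| gen: "i \<in> I \<Longrightarrow> mono_weight w M + mono_weight w (e i) < n \<Longrightarrow>
    low_comb w I f e n (single M c * f i)"

lemma low_comb_mono:
  assumes "low_comb w I f e n p" "n \<le> n'"
  shows "low_comb w I f e n' p"
  using assms by induction (auto intro: low_comb.intros)

lemma low_comb_sum:
  "(\<And>x. x \<in> A \<Longrightarrow> low_comb w I f e n (g x)) \<Longrightarrow> low_comb w I f e n (\<Sum>x\<in>A. g x)"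
  by (induction A rule: infinite_finite_induct) (auto intro: low_comb.intros)

lemma low_comb_mult_gen:
  assumes "i \<in> I" "\<And>k. k \<in> keys a \<Longrightarrow> mono_weight w k + mono_weight w (e i) < n"
  shows "low_comb w I f e n (a * f i)"
proof -
  have "low_comb w I f e n
      (\<Sum>k\<in>keys a. single k (lookup a k) * f i)"
    using assms by (intro low_comb_sum low_comb.gen) auto
  then show ?thesis
    by (simp flip: sum_distrib_right poly_mapping_sum_single)
qed

lemma low_comb_single_mult:
  assumes "low_comb w I f e n p"
  shows "low_comb w I f e (mono_weight w M + n) (single M c * p)"
  using assms
proof induction
  case (gen i M' n c')
  have "single M c * (single M' c' * f i)
      = single (M + M') (c * c') * f i"
    by (simp add: mult_single flip: mult.assoc)
  then show ?case using gen by (auto intro!: low_comb.gen)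
qed (auto intro: low_comb.intros simp: distrib_left)

lemma low_comb_Const_mult: "low_comb w I f e n p \<Longrightarrow> low_comb w I f e n (Const c * p)"
  using low_comb_single_mult[of w I f e n p 0 c] by (simp add: Const_def)

lemma low_comb_uminus: "low_comb w I f e n p \<Longrightarrow> low_comb w I f e n (- p)"
  using low_comb_Const_mult[of w I f e n p "-1"] by (simp add: Const_uminus)

lemma low_comb_diff:
  "low_comb w I f e n p \<Longrightarrow> low_comb w I f e n q \<Longrightarrow> low_comb w I f e n (p - q)"
  using low_comb.add[OF _ low_comb_uminus, of w I f e n p q] by simp

lemma low_comb_ex:
  assumes "i \<in> I"
  shows "\<exists>n. low_comb w I f e n (a * f i)"
proof -
  let ?n = "Suc (\<Sum>k\<in>keys a. mono_weight w k) + mono_weight w (e i)"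
  have "mono_weight w k \<le> (\<Sum>k\<in>keys a. mono_weight w k)"
    if "k \<in> keys a" for k
    using that by (intro member_le_sum) auto
  then have "low_comb w I f e ?n (a * f i)"
    using assms by (intro low_comb_mult_gen) force+
  then show ?thesis by blast
qed

text \<open>
  A form of Buchberger's criterion: modulo terms of smaller weight, the multiple of \<open>f i\<close> with leading
  monomial \<open>m\<close> is a polynomial \<open>B m\<close> that does not depend on \<open>i\<close>.
\<close>

locale liftable_pairs =
  fixes w :: "'v \<Rightarrow> nat" and I :: "'i set" and f :: "'i \<Rightarrow> ('v, 'a::comm_ring_1) mpoly"
    and e :: "'i \<Rightarrow> ('v \<Rightarrow>\<^sub>0 nat)" and B :: "('v \<Rightarrow>\<^sub>0 nat) \<Rightarrow> ('v, 'a) mpoly"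
  assumes lead: "i \<in> I \<Longrightarrow> k \<in> keys (f i - single (e i) 1) \<Longrightarrow>
      mono_weight w k < mono_weight w (e i)"
    and lift: "i \<in> I \<Longrightarrow> low_comb w I f e (mono_weight w (M + e i))
      (single M 1 * f i - B (M + e i))"
begin

definition top_part :: "nat \<Rightarrow> ('v, 'a) mpoly \<Rightarrow> ('v, 'a) mpoly" where
  "top_part n = keys_sum (\<lambda>m c. if mono_weight w m = n then Const c * B m else 0)"

lemma top_part_add: "top_part n (p + q) = top_part n p + top_part n q"
  unfolding top_part_def by (rule keys_sum_add) (auto simp: Const_add distrib_right)

lemma top_part_single:
  "top_part n (single m c) = (if mono_weight w m = n then Const c * B m else 0)"
  unfolding top_part_def by (subst keys_sum_single) auto

lemma top_part_eq_0:
  "(\<And>m. m \<in> keys p \<Longrightarrow> mono_weight w m \<noteq> n) \<Longrightarrow> top_part n p = 0"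
  unfolding top_part_def keys_sum_def by (intro sum.neutral) auto

text \<open>Both claims are compatible with sums, because \<open>top_part\<close> is additive and
  depends on \<open>p\<close> alone and not on its representation. For a single multiple of leading
  weight \<open>n\<close> the first claim is the lifting hypothesis, so cancellation between
  different generators needs no separate treatment.\<close>

lemma low_comb_step:
  assumes "low_comb w I f e (Suc n) p"
  shows "low_comb w I f e n (p - top_part n p) \<and>
    (\<forall>m \<in> keys p. mono_weight w m = n \<longrightarrow> (\<exists>i \<in> I. \<exists>M. m = M + e i))"
  using assms
proof (induction "Suc n" p)
  case zero
  then show ?case using top_part_eq_0[of 0 n] by (auto intro: low_comb.intros)
next
  case (add p q)
  have "p + q - top_part n (p + q) = (p - top_part n p) + (q - top_part n q)"
    by (simp add: top_part_add)
  then have "low_comb w I f e n (p + q - top_part n (p + q))"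
    using add by (simp only: low_comb.add)
  then show ?case using add keys_add[of p q] by auto
next
  case (gen i M c)
  define t where "t = f i - single (e i) 1"
  have eq: "single M c * f i
      = single (M + e i) c + single M c * t"
    by (simp add: t_def right_diff_distrib mult_single)
  have small: "mono_weight w k < n" if "k \<in> keys (single M c * t)" for k
  proof -
    obtain a b where "a \<in> keys (single M c)" "b \<in> keys t" "k = a + b"
      using \<open>k \<in> _\<close> by (rule keys_multE)
    then show ?thesis using lead[OF gen(1)] gen(2) by (fastforce simp: t_def split: if_splits)
  qed
  have top: "top_part n (single M c * f i)
      = (if mono_weight w (M + e i) = n then Const c * B (M + e i) else 0)"
    using small top_part_eq_0[of "single M c * t" n]
    by (auto simp: eq top_part_add top_part_single)
  have keys: "\<exists>i \<in> I. \<exists>M. m = M + e i"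
    if "m \<in> keys (single M c * f i)" "mono_weight w m = n" for m
    using that small keys_add[of "single (M + e i) c" "single M c * t"] gen(1)
    by (auto simp: eq subset_iff split: if_splits)
  show ?case
  proof (cases "mono_weight w (M + e i) = n")
    case True
    have "single M c * f i - Const c * B (M + e i)
        = Const c * (single M 1 * f i - B (M + e i))"
      by (simp add: right_diff_distrib Const_mult_single flip: mult.assoc)
    then show ?thesis
      using True keys low_comb_Const_mult[OF lift[OF gen(1), of M], of c] by (auto simp: top)
  next
    case False
    then show ?thesis using gen keys by (auto simp: top intro!: low_comb.gen)
  qed
qed

text \<open>For a standard polynomial \<open>top_part n p\<close> vanishes, since a monomial of
  weight \<open>n\<close> would be divisible by a leading monomial. So the bound descends to 0,
  where only the empty combination is left.\<close>

lemma low_comb_standard_eq_0: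
  assumes "low_comb w I f e n p"
    and "\<And>m i M. m \<in> keys p \<Longrightarrow> i \<in> I \<Longrightarrow> m \<noteq> M + e i"
  shows "p = 0"
  using assms(1)
proof (induction n)
  case 0
  then show ?case by (induction "0::nat" p) auto
next
  case (Suc n)
  have "top_part n p = 0"
    using low_comb_step[OF Suc.prems] assms(2) by (intro top_part_eq_0) blast
  then show ?case using low_comb_step[OF Suc.prems] Suc.IH by simp
qed

end

section \<open>Basis monomials and forms\<close>

lemma S_iff: "n \<in> S \<longleftrightarrow> n \<in> {0, 5, 6, 7, 8} \<or> 10 \<le> n"
proof
  assume "n \<in> S"
  then obtain a b c d where "n = 5 * a + 6 * b + 7 * c + 8 * d" by (auto simp: S_def)
  moreover have "10 \<le> 5 * a + 6 * b + 7 * c + 8 * d" if "2 \<le> a + b + c + d"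
    using that by linarith
  moreover have "(a, b, c, d) \<in> {(0,0,0,0), (1,0,0,0), (0,1,0,0), (0,0,1,0), (0,0,0,1)}"
    if "\<not> 2 \<le> a + b + c + d"
    using that by (cases a; cases b; cases c; cases d) simp_all
  ultimately show "n \<in> {0, 5, 6, 7, 8} \<or> 10 \<le> n" by auto
next
  have gen: "n \<in> S" if "n = 5 * a + 6 * b + 7 * c + 8 * d" for n a b c d
    using that by (auto simp: S_def)
  assume "n \<in> {0, 5, 6, 7, 8} \<or> 10 \<le> n"
  then consider "n \<in> {0, 5, 6, 7, 8}" | "10 \<le> n" by blast
  then show "n \<in> S"
  proof cases
    case 1
    then show ?thesis
      using gen[of n 0 0 0 0] gen[of n 1 0 0 0] gen[of n 0 1 0 0] gen[of n 0 0 1 0] gen[of n 0 0 0 1]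
      by auto
  next
    case 2
    then consider "n = 5 * (n div 5)" | "n = 5 * (n div 5 - 1) + 6" | "n = 5 * (n div 5 - 1) + 7"
      | "n = 5 * (n div 5 - 1) + 8" | "n = 5 * (n div 5 - 2) + 6 + 8" by linarith
    then show ?thesis
      using gen[of n "n div 5" 0 0 0] gen[of n "n div 5 - 1" 1 0 0] gen[of n "n div 5 - 1" 0 1 0]
        gen[of n "n div 5 - 1" 0 0 1] gen[of n "n div 5 - 2" 1 0 1]
      by cases auto
  qed
qed

lemma S_add: "m \<in> S \<Longrightarrow> n \<in> S \<Longrightarrow> m + n \<in> S"
  by (auto simp: S_iff)

section \<open>Exponent vectors and standard monomials\<close>

definition xmono :: "nat \<Rightarrow> nat \<Rightarrow> nat \<Rightarrow> nat \<Rightarrow> nat \<Rightarrow> (nat \<Rightarrow>\<^sub>0 nat)" where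
  "xmono a b c d e = single 0 a + single 5 b + single 6 c
     + single 7 d + single 8 e"

lemma lookup_xmono:
  "lookup (xmono a b c d e) v = (if v = 0 then a else if v = 5 then b else
     if v = 6 then c else if v = 7 then d else if v = 8 then e else 0)"
  by (simp add: xmono_def lookup_add lookup_single)

lemma keys_xmono: "keys (xmono a b c d e) \<subseteq> xvars"
  by (auto simp: in_keys_iff lookup_xmono xvars_def split: if_splits)

lemma xmono_add: "xmono a b c d e + xmono a' b' c' d' e' = xmono (a + a') (b + b') (c + c') (d + d') (e + e')"
  by (rule poly_mapping_eqI) (simp add: lookup_xmono lookup_add)

lemma xmono_eq_iff: "xmono a b c d e = xmono a' b' c' d' e' \<longleftrightarrow> a = a' \<and> b = b' \<and> c = c' \<and> d = d' \<and> e = e'"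
proof
  assume eq: "xmono a b c d e = xmono a' b' c' d' e'"
  have "lookup (xmono a b c d e) v = lookup (xmono a' b' c' d' e') v" for v
    by (simp only: eq)
  from this[of 0] this[of 5] this[of 6] this[of 7] this[of 8]
  show "a = a' \<and> b = b' \<and> c = c' \<and> d = d' \<and> e = e'" by (simp add: lookup_xmono)
qed simp

lemma single_xmono:
  "single 0 k = xmono k 0 0 0 0" "single 5 k = xmono 0 k 0 0 0"
  "single 6 k = xmono 0 0 k 0 0" "single 7 k = xmono 0 0 0 k 0"
  "single 8 k = xmono 0 0 0 0 k" "0 = xmono 0 0 0 0 0"
  by (simp_all add: xmono_def)

lemma xmonoE:
  assumes "keys m \<subseteq> xvars"
  obtains a b c d e where "m = xmono a b c d e"
proof -
  let ?l = "lookup m"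
  have "m = xmono (?l 0) (?l 5) (?l 6) (?l 7) (?l 8)"
    using assms by (intro poly_mapping_eqI) (auto simp: lookup_xmono xvars_def in_keys_iff subset_iff)
  then show ?thesis using that by blast
qed

lemma mono_weight_xmono: "mono_weight w (xmono a b c d e) = a * w 0 + b * w 5 + c * w 6 + d * w 7 + e * w 8"
  by (simp add: xmono_def)

text \<open>The monomials divisible by none of X_6^2, X_6 X_7, X_7^2, X_5^3, X_5^2 X_6; the
  exponents of X_0 and X_8 are free.\<close>

definition std_mono :: "(nat \<Rightarrow>\<^sub>0 nat) \<Rightarrow> bool" where
  "std_mono m \<longleftrightarrow> lookup m 5 \<le> 2 \<and> lookup m 6 + lookup m 7 \<le> 1
     \<and> (lookup m 6 = 0 \<or> lookup m 5 \<le> 1)"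

lemma std_mono_xmono: "std_mono (xmono a b c d e) \<longleftrightarrow> b \<le> 2 \<and> c + d \<le> 1 \<and> (c = 0 \<or> b \<le> 1)"
  by (simp add: std_mono_def lookup_xmono)

lemma deg2_monos_eq:
  "deg2_monos = {xmono 0 2 0 0 0, xmono 0 1 1 0 0, xmono 0 1 0 1 0, xmono 0 1 0 0 1,
     xmono 0 0 1 0 1, xmono 0 0 0 1 1, xmono 0 0 0 0 2}"
proof -
  have "deg2_monos = (\<lambda>(a, b). single a 1 + single b 1) `
      {(5,5), (5,6), (5,7), (5,8), (6,8), (7,8), (8,8)}"
    unfolding deg2_monos_def by (auto simp: image_iff)
  then show ?thesis by (simp add: single_xmono xmono_add numeral_2_eq_2)
qed

text \<open>Identifies the listed basis with the standard monomials of degree \<open>r\<close>, the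
  form in which division and Buchberger's criterion can use it.\<close>

lemma basis_monos_iff:
  assumes "2 \<le> r"
  shows "m \<in> basis_monos r \<longleftrightarrow> (\<exists>b c d e. m = xmono (r - (b + c + d + e)) b c d e \<and>
    b + c + d + e \<le> r \<and> b \<le> 2 \<and> c + d \<le> 1 \<and> (c = 0 \<or> b \<le> 1))" (is "_ \<longleftrightarrow> ?R m")
proof
  assume "m \<in> basis_monos r"
  then consider n where "n \<in> xvars" "m = single 0 (r - 1) + single n 1"
    | i M where "i + 2 \<le> r" "M \<in> deg2_monos"
      "m = single 0 (r - 2 - i) + M + single 8 i"
    | i where "i + 3 \<le> r" "m = single 0 (r - 3 - i) + single 5 2
        + single 7 1 + single 8 i"
    unfolding basis_monos_def by blast
  then show "?R m"
  proof cases
    case 1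
    then show ?thesis using assms
      by (auto simp: xvars_def single_xmono xmono_add xmono_eq_iff)
  next
    case 2
    then show ?thesis using assms
      by (auto simp: deg2_monos_eq single_xmono xmono_add xmono_eq_iff)
  next
    case 3
    then show ?thesis using assms
      by (auto simp: single_xmono xmono_add xmono_eq_iff)
  qed
next
  assume "?R m"
  then obtain b c d e where m: "m = xmono (r - (b + c + d + e)) b c d e" "b + c + d + e \<le> r"
    and bcd: "b \<le> 2" "c + d \<le> 1" "c = 0 \<or> b \<le> 1" by blast
  have A: "xmono (r - 1) 0 0 0 0 + single n 1 \<in> basis_monos r" if "n \<in> xvars" for n
    using that unfolding basis_monos_def by (auto simp: single_xmono)
  have B: "xmono (r - 2 - i) 0 0 0 i + M \<in> basis_monos r" if "i + 2 \<le> r" "M \<in> deg2_monos" for i M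
    using that unfolding basis_monos_def
    by (intro UnI1 UnI2 CollectI exI[of _ i] exI[of _ M])
      (auto simp: deg2_monos_eq single_xmono xmono_add)
  have C: "xmono (r - 3 - i) 2 0 1 i \<in> basis_monos r" if "i + 3 \<le> r" for i
    using that unfolding basis_monos_def
    by (intro UnI2 CollectI exI[of _ i]) (auto simp: single_xmono xmono_add xmono_eq_iff)
  have "b = 0 \<or> b = 1 \<or> b = 2" "c = 0 \<or> c = 1" "d = 0 \<or> d = 1" using bcd by linarith+
  with bcd consider "b = 0" "c = 0" "d = 0" | "b = 1" "c = 0" "d = 0" | "b = 0" "c = 1" "d = 0"
    | "b = 0" "c = 0" "d = 1" | "b = 2" "c = 0" "d = 0" | "b = 1" "c = 1" "d = 0"
    | "b = 1" "c = 0" "d = 1" | "b = 2" "c = 0" "d = 1"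
    by (elim disjE) simp_all
  then show "m \<in> basis_monos r"
  proof cases
    case 1
    consider "e = 0" | "e = 1" | k where "e = Suc (Suc k)"
      by (metis One_nat_def not0_implies_Suc)
    then show ?thesis
      using m 1 assms A[of 0] A[of 8] B[of "e - 2" "xmono 0 0 0 0 2"]
      by cases (simp_all add: xvars_def single_xmono xmono_add deg2_monos_eq)
  next
    case 2
    then show ?thesis
      using m assms A[of 5] B[of "e - 1" "xmono 0 1 0 0 1"]
      by (cases e) (simp_all add: xvars_def single_xmono xmono_add deg2_monos_eq)
  next
    case 3
    then show ?thesis
      using m assms A[of 6] B[of "e - 1" "xmono 0 0 1 0 1"]
      by (cases e) (simp_all add: xvars_def single_xmono xmono_add deg2_monos_eq)
  next
    case 4
    then show ?thesis
      using m assms A[of 7] B[of "e - 1" "xmono 0 0 0 1 1"]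
      by (cases e) (simp_all add: xvars_def single_xmono xmono_add deg2_monos_eq)
  next
    case 5
    then show ?thesis
      using m B[of e "xmono 0 2 0 0 0"] by (simp add: xmono_add deg2_monos_eq numeral_2_eq_2)
  next
    case 6
    then show ?thesis
      using m B[of e "xmono 0 1 1 0 0"] by (simp add: xmono_add deg2_monos_eq numeral_2_eq_2)
  next
    case 7
    then show ?thesis
      using m B[of e "xmono 0 1 0 1 0"] by (simp add: xmono_add deg2_monos_eq numeral_2_eq_2)
  next
    case 8
    then show ?thesis using m C[of e] by (simp add: eval_nat_numeral)
  qed
qed

lemma basis_monos_std: "2 \<le> r \<Longrightarrow> m \<in> basis_monos r \<Longrightarrow> std_mono m"
  by (auto simp: basis_monos_iff std_mono_xmono)

lemma basis_monosI:
  assumes "2 \<le> r" "keys m \<subseteq> xvars" "mono_weight (\<lambda>_. 1) m = r" "std_mono m"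
  shows "m \<in> basis_monos r"
proof -
  obtain a b c d e where m: "m = xmono a b c d e" using xmonoE[OF assms(2)] by blast
  with assms have "a = r - (b + c + d + e)" "b + c + d + e \<le> r"
    by (auto simp: mono_weight_xmono)
  with m assms show ?thesis by (auto simp: basis_monos_iff std_mono_xmono)
qed

text \<open>
  The eight possibilities for the exponents of \<open>X\<^sub>5\<close>, \<open>X\<^sub>6\<close>, \<open>X\<^sub>7\<close> have weights 0, 17, 10, 11, 12, 5,
  6, 7, one in each residue class modulo 8.
\<close>

lemma std_weight_inj:
  fixes b c d e b' c' d' e' :: nat
  assumes "5 * b + 6 * c + 7 * d + 8 * e = 5 * b' + 6 * c' + 7 * d' + 8 * e'"
    and "b \<le> 2" "c + d \<le> 1" "c = 0 \<or> b \<le> 1" and "b' \<le> 2" "c' + d' \<le> 1" "c' = 0 \<or> b' \<le> 1"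
  shows "b = b' \<and> c = c' \<and> d = d' \<and> e = e'"
proof -
  have "(5 * b + 6 * c + 7 * d + 8 * e) mod 8 = (5 * b' + 6 * c' + 7 * d' + 8 * e') mod 8"
    by (simp only: assms(1))
  then have mod: "(5 * b + 6 * c + 7 * d) mod 8 = (5 * b' + 6 * c' + 7 * d') mod 8" by simp
  have "b \<in> {0, 1, 2}" "b' \<in> {0, 1, 2}" using assms by auto
  moreover have "c = 0 \<and> d = 0 \<or> c = 1 \<and> d = 0 \<or> c = 0 \<and> d = 1"
    "c' = 0 \<and> d' = 0 \<or> c' = 1 \<and> d' = 0 \<or> c' = 0 \<and> d' = 1" using assms by linarith+
  ultimately have "b = b' \<and> c = c' \<and> d = d'" using assms(4,7) mod
    by (elim insertE emptyE disjE conjE) simp_all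
  then show ?thesis using assms(1) by simp
qed

lemma basis_monos_weight_inj:
  assumes "2 \<le> r" "m \<in> basis_monos r" "m' \<in> basis_monos r" "mono_weight id m = mono_weight id m'"
  shows "m = m'"
proof -
  obtain b c d e b' c' d' e' where
    m: "m = xmono (r - (b + c + d + e)) b c d e" "b \<le> 2" "c + d \<le> 1" "c = 0 \<or> b \<le> 1" and
    m': "m' = xmono (r - (b' + c' + d' + e')) b' c' d' e'" "b' \<le> 2" "c' + d' \<le> 1" "c' = 0 \<or> b' \<le> 1"
    using assms(2,3) unfolding basis_monos_iff[OF assms(1)] by metis
  have "5 * b + 6 * c + 7 * d + 8 * e = 5 * b' + 6 * c' + 7 * d' + 8 * e'"
    using assms(4) unfolding m(1) m'(1) mono_weight_xmono by (simp add: algebra_simps)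
  from std_weight_inj[OF this m(2-4) m'(2-4)] m(1) m'(1) show ?thesis by simp
qed

text \<open>The residue of \<open>n\<close> modulo 8 fixes the exponents of X_5, X_6, X_7; the
  exponent of X_8 is then the quotient minus 0, 1 or 2.\<close>

lemma basis_mono_exists:
  assumes "2 \<le> r" "n \<in> S" "n \<le> 8 * r"
  shows "\<exists>m \<in> basis_monos r. mono_weight id m = n"
proof -
  have *: ?thesis if "n = 5 * b + 6 * c + 7 * d + 8 * e" "b + c + d + e \<le> r"
    "b \<le> 2" "c + d \<le> 1" "c = 0 \<or> b \<le> 1" for b c d e
    using that assms(1)
    by (intro bexI[of _ "xmono (r - (b + c + d + e)) b c d e"])
      (auto simp: mono_weight_xmono basis_monos_iff)
  define q where "q = n div 8"
  have n: "n = 8 * q + n mod 8" by (simp add: q_def)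
  have "n \<noteq> 1" "n \<noteq> 2" "n \<noteq> 3" "n \<noteq> 4" "n \<noteq> 9" using assms(2) by (auto simp: S_iff)
  \<comment> \<open>The gaps 1, 2, 3, 4, 9 of \<open>S\<close> are exactly the values of
    \<open>n\<close> for which the exponent of X_8 would be negative.\<close>
  then have q: "n mod 8 \<in> {1, 2, 3, 4} \<Longrightarrow> q \<noteq> 0" "n mod 8 = 1 \<Longrightarrow> q \<noteq> 1"
    using n by auto
  have "n mod 8 < 8" by simp
  then have "n mod 8 \<in> {0, 1, 2, 3, 4, 5, 6, 7}"
    by (simp add: lessThan_nat_numeral lessThan_Suc flip: lessThan_iff) blast
  then consider "n mod 8 = 0" | "n mod 8 = 1" | "n mod 8 = 2" | "n mod 8 = 3" | "n mod 8 = 4"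
    | "n mod 8 = 5" | "n mod 8 = 6" | "n mod 8 = 7"
    by (elim insertE emptyE) blast+
  then show ?thesis
  proof cases
    case 1
    show ?thesis
      by (rule *[of 0 0 0 "q"]) (use n 1 assms(3) in auto)
  next
    case 2
    show ?thesis
      by (rule *[of 2 0 1 "q - 2"]) (use n 2 q assms(3) in auto)
  next
    case 3
    show ?thesis
      by (rule *[of 2 0 0 "q - 1"]) (use n 3 q assms(3) in auto)
  next
    case 4
    show ?thesis
      by (rule *[of 1 1 0 "q - 1"]) (use n 4 q assms(3) in auto)
  next
    case 5
    show ?thesis
      by (rule *[of 1 0 1 "q - 1"]) (use n 5 q assms(3) in auto)
  next
    case 6
    show ?thesis
      by (rule *[of 1 0 0 "q"]) (use n 6 assms(3) in auto)
  next
    case 7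
    show ?thesis
      by (rule *[of 0 1 0 "q"]) (use n 7 assms(3) in auto)
  next
    case 8
    show ?thesis
      by (rule *[of 0 0 1 "q"]) (use n 8 assms(3) in auto)
  qed
qed

lemma Z_eq:
  assumes "2 \<le> r" "m \<in> basis_monos r" "mono_weight id m = n"
  shows "Z r n = single m 1"
proof -
  have "(THE m. m \<in> basis_monos r \<and> mono_weight id m = n) = m"
    using assms basis_monos_weight_inj[OF assms(1)] by (intro the_equality) auto
  then show ?thesis by (simp add: Z_def)
qed

lemma coeff_index_form_weights: "(i, j) \<in> coeff_index \<Longrightarrow> i \<in> form_weights"
  and coeff_index_bounds: "(i, j) \<in> coeff_index \<Longrightarrow> 1 \<le> j \<and> j \<le> i \<and> i - j \<in> S"
  by (auto simp: coeff_index_def)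

lemma Z_form:
  assumes "(i, j) \<in> coeff_index"
  obtains m where "m \<in> basis_monos (form_degree i)" "mono_weight id m = i - j"
    "Z (form_degree i) (i - j) = single m (1::'a::comm_ring_1)"
proof -
  have "i \<le> 8 * form_degree i" "2 \<le> form_degree i"
    using coeff_index_form_weights[OF assms] by (auto simp: form_weights_def form_degree_def)
  then show ?thesis
    using basis_mono_exists[of "form_degree i" "i - j"] coeff_index_bounds[OF assms] that
      Z_eq[of "form_degree i" _ "i - j"] by fastforce
qed

lemma coeff_index_fibre_eqI:
  assumes "\<forall>j\<in>{0, 1, 2, 3, 4, 5, 6, 7, 8, 9, 10, 11, 12, 13, 14, 15, 16, 17, 18, 19, 20, 21}.
      (i, j) \<in> coeff_index \<longleftrightarrow> j \<in> A" "A \<subseteq> {..<22}"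
  shows "{j. (i, j) \<in> coeff_index} = A"
proof (intro set_eqI)
  fix j
  have "j < 22" if "(i, j) \<in> coeff_index"
    using coeff_index_form_weights[OF that] coeff_index_bounds[OF that] by (auto simp: form_weights_def)
  moreover have "j \<in> {0, 1, 2, 3, 4, 5, 6, 7, 8, 9, 10, 11, 12, 13, 14, 15, 16, 17, 18, 19, 20, 21}" if "j < 22"
    using that by (simp add: lessThan_nat_numeral lessThan_Suc flip: lessThan_iff) blast
  ultimately show "j \<in> {j. (i, j) \<in> coeff_index} \<longleftrightarrow> j \<in> A"
    using assms by blast
qed

lemma coeff_index_fibres:
  "{j. (12, j) \<in> coeff_index} = {4,5,6,12}"
  "{j. (13, j) \<in> coeff_index} = {5,6,7,13}"
  "{j. (14, j) \<in> coeff_index} = {1,2,3,4,6,7,8,9,14}"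
  "{j. (15, j) \<in> coeff_index} = {1,2,3,4,5,7,8,9,10,15}"
  "{j. (16, j) \<in> coeff_index} = {2,3,4,5,8,9,10,11,16}"
  "{j. (18, j) \<in> coeff_index} = {1,2,3,4,5,6,7,8,10,11,12,13,18}"
  "{j. (21, j) \<in> coeff_index} = {1,2,3,4,6,7,8,9,10,11,13,14,15,16,21}"
  by (rule coeff_index_fibre_eqI; simp add: coeff_index_def form_weights_def S_iff)+

lemma finite_coeff_fibre [simp]: "finite {j. (i, j) \<in> coeff_index}"
  by (rule finite_subset[of _ "{..i}"]) (auto simp: coeff_index_def)

section \<open>Specialization of the coefficients\<close>

text \<open>A point \<open>x\<close> satisfies the equations read off from \<open>R w\<close>
  exactly if \<open>spec x (R w)\<close> vanishes. Membership in \<open>Q\<close> thereby becomes a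
  statement about polynomials in the X_n over the field.\<close>

definition spec :: "(nat \<times> nat \<Rightarrow> 'a) \<Rightarrow> 'a::comm_ring_1 family_poly \<Rightarrow> (nat, 'a) mpoly" where
  "spec x = eval_mpoly (\<lambda>q. Const (eval_mpoly id x q)) Var"

lemmas eval_id_simps = coeff_hom.eval_simps[OF coeff_hom_id] coeff_hom.eval_zero[OF coeff_hom_id]
  coeff_hom.eval_one[OF coeff_hom_id] coeff_hom.eval_Var[OF coeff_hom_id]
  coeff_hom.eval_Const[OF coeff_hom_id]

lemma coeff_hom_spec: "coeff_hom (\<lambda>q. Const (eval_mpoly id x q) :: (nat, 'a::comm_ring_1) mpoly)"
  by (rule coeff_hom_comp[OF coeff_hom_Const coeff_hom.coeff_hom_eval[OF coeff_hom_id]])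

lemma spec_simps:
  "spec x (p + q) = spec x p + spec x q" "spec x (p * q) = spec x p * spec x q"
  "spec x (- p) = - spec x p" "spec x (p - q) = spec x p - spec x q"
  "spec x (p ^ k) = spec x p ^ k" "spec x (Const c) = Const (eval_mpoly id x c)"
  "spec x (Var v) = Var v" "spec x 0 = 0" "spec x 1 = 1"
  unfolding spec_def
  by (simp_all only: coeff_hom.eval_simps[OF coeff_hom_spec] coeff_hom.eval_Const[OF coeff_hom_spec]
    coeff_hom.eval_Var[OF coeff_hom_spec] coeff_hom.eval_zero[OF coeff_hom_spec]
    coeff_hom.eval_one[OF coeff_hom_spec])

lemma spec_sum: "spec x (\<Sum>i\<in>A. f i) = (\<Sum>i\<in>A. spec x (f i))"
  unfolding spec_def by (rule coeff_hom.eval_sum[OF coeff_hom_spec])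

lemma spec_single: "spec x (single m c) = single m (eval_mpoly id x c)"
  by (simp add: spec_def coeff_hom.eval_single[OF coeff_hom_spec] mono_eval_Var Const_mult_single)

lemma (in coeff_hom) lookup_eval_Const:
  "lookup (eval_mpoly (\<lambda>q. Const (h q)) Var p) m = h (lookup p m)"
proof (induction p rule: poly_mapping_induct)
  case zero
  then show ?case by (simp add: eval_mpoly_def)
next
  case (single m' c)
  then show ?case
    by (simp add: coeff_hom.eval_single[OF coeff_hom_comp[OF coeff_hom_Const coeff_hom_axioms]]
      mono_eval_Var Const_mult_single lookup_single when_def)
next
  case (add p q)
  then show ?case
    by (simp add: coeff_hom.eval_add[OF coeff_hom_comp[OF coeff_hom_Const coeff_hom_axioms]]
      lookup_add hom_add)
qed

lemma lookup_spec: "lookup (spec x p) m = eval_mpoly id x (lookup p m)"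
  unfolding spec_def
  by (rule coeff_hom.lookup_eval_Const[OF coeff_hom.coeff_hom_eval[OF coeff_hom_id]])

lemma keys_spec:
  fixes x :: "nat \<times> nat \<Rightarrow> 'a::comm_ring_1" and p :: "'a family_poly"
  shows "keys (spec x p) \<subseteq> keys p"
  by (auto simp: in_keys_iff lookup_spec eval_id_simps)

lemma spec_eq_0_iff:
  fixes x :: "nat \<times> nat \<Rightarrow> 'a::comm_ring_1" and p :: "'a family_poly"
  shows "spec x p = 0 \<longleftrightarrow> (\<forall>m. eval_mpoly id x (lookup p m) = 0)"
  by (simp add: poly_mapping_eq_iff fun_eq_iff lookup_spec)

lemma spec_initial_form: "spec x (initial_form i) = initial_form i"
  by (simp add: initial_form_def spec_simps)

lemma spec_Z: "spec x (Z r n) = Z r n"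
  by (simp add: Z_def spec_single eval_id_simps)

lemma spec_form: "spec x (form i) = initial_form i
   - (\<Sum>j \<in> {j. (i, j) \<in> coeff_index}. Const (x (i, j)) * Z (form_degree i) (i - j))"
  by (simp add: form_def spec_simps spec_sum spec_initial_form spec_Z eval_id_simps)

lemma pres_initial_form: "pres (initial_form i) = 0"
  by (simp add: initial_form_def pres_simps mult_monom monom_power monom_0[symmetric] del: monom_0)

lemma pres_Z_form:
  assumes "(i, j) \<in> coeff_index"
  shows "pres (Z (form_degree i) (i - j) :: (nat, 'a::field) mpoly) = monom 1 (i - j)"
  by (rule Z_form[OF assms, where 'a = 'a]) (simp add: pres_single)

text \<open>Under X_n -> t^n, with X_0 -> 1, the initial form vanishes and the basis monomial of
  weight \<open>i - j\<close> becomes a power of t. So the coefficients of one form can be read off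
  separately.\<close>

lemma coeff_pres_spec_form:
  fixes x :: "nat \<times> nat \<Rightarrow> 'a::field"
  shows "coeff (pres (spec x (form i))) n
     = (if n < i \<and> (i, i - n) \<in> coeff_index then - x (i, i - n) else 0)"
proof -
  let ?J = "{j. (i, j) \<in> coeff_index}"
  have "pres (spec x (form i)) = - (\<Sum>j\<in>?J. monom (x (i, j)) (i - j))"
    unfolding spec_form
    by (auto simp: pres_simps pres_sum pres_initial_form pres_Z_form smult_monom intro!: sum.cong)
  then have "coeff (pres (spec x (form i))) n = - (\<Sum>j\<in>?J. if i - j = n then x (i, j) else 0)"
    by (simp add: coeff_sum)
  also have "(\<Sum>j\<in>?J. if i - j = n then x (i, j) else 0)
      = (\<Sum>j\<in>?J. if j = i - n then if n < i then x (i, i - n) else 0 else 0)"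
  proof (intro sum.cong refl)
    fix j assume "j \<in> ?J"
    then have "1 \<le> j" "j \<le> i" using coeff_index_bounds[of i j] by auto
    then have "i - j = n \<longleftrightarrow> n < i \<and> j = i - n" by linarith
    then show "(if i - j = n then x (i, j) else 0)
      = (if j = i - n then if n < i then x (i, i - n) else 0 else 0)" by simp
  qed
  also have "\<dots> = (if n < i \<and> (i, i - n) \<in> coeff_index then x (i, i - n) else 0)"
    by (simp add: sum.delta)
  finally show ?thesis by simp
qed

section \<open>The linear part of the remainders\<close>

definition agree_below :: "nat \<Rightarrow> (nat \<times> nat \<Rightarrow> 'a) \<Rightarrow> (nat \<times> nat \<Rightarrow> 'a) \<Rightarrow> bool" where
  "agree_below j x y \<longleftrightarrow> (\<forall>ij \<in> coeff_index. snd ij < j \<longrightarrow> x ij = y ij)"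

text \<open>A variable occurring in a monomial of weight \<open>d\<close> has weight at most
  \<open>d\<close>.\<close>

lemma eval_isobaric_eq:
  fixes x y :: "nat \<times> nat \<Rightarrow> 'a::comm_ring_1" and q :: "(nat \<times> nat, 'a) mpoly"
  assumes "isobaric coeff_index snd d q" "d < j" "agree_below j x y"
  shows "eval_mpoly id x q = eval_mpoly id y q"
  unfolding eval_mpoly_alt
proof (intro sum.cong refl arg_cong2[of _ _ _ _ "(*)"])
  fix m assume m: "m \<in> keys q"
  have sub: "keys m \<subseteq> coeff_index" and w: "mono_weight snd m = d"
    using assms(1) m by (auto simp: isobaric_def polys_in_def)
  have "x v = y v" if "v \<in> keys m" for v
  proof -
    have "snd v \<le> lookup m v * snd v"
      using that by (simp add: in_keys_iff)
    also have "\<dots> \<le> mono_weight snd m"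
      unfolding mono_weight_def using that by (intro member_le_sum) auto
    finally show ?thesis
      using assms(2,3) w sub that by (auto simp: agree_below_def)
  qed
  then show "mono_eval x m = mono_eval y m"
    unfolding mono_eval_def by (intro prod.cong) auto
qed

lemma pres_spec_isobaric:
  fixes x :: "nat \<times> nat \<Rightarrow> 'a::field" and H :: "'a family_poly"
  assumes "isobaric V id h H"
  shows "pres (spec x H) = monom (\<Sum>m\<in>keys H. eval_mpoly id x (lookup H m)) h"
proof -
  have "pres (spec x H) = (\<Sum>m\<in>keys (spec x H).
      monom (eval_mpoly id x (lookup H m)) (mono_weight id m))"
    by (simp add: pres_expand lookup_spec)
  also have "\<dots> = (\<Sum>m\<in>keys H.
      monom (eval_mpoly id x (lookup H m)) (mono_weight id m))"
    using keys_spec[of x H]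
    by (intro sum.mono_neutral_left) (auto simp: in_keys_iff lookup_spec eval_id_simps)
  also have "\<dots> = (\<Sum>m\<in>keys H. monom (eval_mpoly id x (lookup H m)) h)"
    using assms by (intro sum.cong) (auto simp: isobaric_def)
  finally show ?thesis by (simp add: monom_sum)
qed

text \<open>At the exponent \<open>w - j\<close> of t, the subtracted product contributes a value of
  weight \<open>w - (h + i)\<close> times one coefficient of weight \<open>i - (w - j - h)\<close>.
  These weights add up to \<open>j\<close>. The first is positive by the strict inequality in a
  division step, the second because every index in \<open>coeff_index\<close> has positive weight.
  So both are below \<open>j\<close>, and the contribution is the same at \<open>x\<close> and at
  \<open>y\<close>.\<close>

lemma division_step_coeff:
  fixes x y :: "nat \<times> nat \<Rightarrow> 'a::field"
  assumes step: "division_step r w p q" and agree: "agree_below j x y" and j: "j \<le> w"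
  shows "coeff (pres (spec x q)) (w - j) - coeff (pres (spec y q)) (w - j)
       = coeff (pres (spec x p)) (w - j) - coeff (pres (spec y p)) (w - j)"
proof -
  obtain i H h where h: "h + i < w" and H: "isobaric xvars id h H"
    and c: "\<And>m. isobaric coeff_index snd (w - (h + i)) (lookup H m)"
    and q: "q = p - H * form i"
    using step unfolding division_step_def by blast
  let ?e = "\<lambda>x. \<Sum>m\<in>keys H. eval_mpoly id x (lookup H m)"
  have coeff: "coeff (pres (spec x (H * form i))) (w - j) =
      (if h \<le> w - j then ?e x * coeff (pres (spec x (form i))) (w - j - h) else 0)" for x
    by (simp add: spec_simps pres_simps pres_spec_isobaric[OF H] coeff_monom_mult)
  have "coeff (pres (spec x (H * form i))) (w - j) = coeff (pres (spec y (H * form i))) (w - j)"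
  proof (cases "h \<le> w - j \<and> w - j - h < i \<and> (i, i - (w - j - h)) \<in> coeff_index")
    case True
    define n where "n = w - j - h"
    have n: "w = n + j + h" "n < i" using True j by (auto simp: n_def)
    have less: "w - (h + i) < j" "i - (w - j - h) < j" using n h by auto
    have "?e x = ?e y" by (intro sum.cong refl eval_isobaric_eq[OF c less(1) agree])
    moreover have "x (i, i - (w - j - h)) = y (i, i - (w - j - h))"
      using agree True less(2) unfolding agree_below_def by (metis snd_conv)
    ultimately show ?thesis unfolding coeff coeff_pres_spec_form by (simp only:)
  next
    case False
    then show ?thesis unfolding coeff coeff_pres_spec_form by auto
  qed
  then show ?thesis by (simp add: q spec_simps pres_simps)
qed

lemma division_steps_coeff:
  fixes x y :: "nat \<times> nat \<Rightarrow> 'a::field"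
  assumes "(division_step r w)\<^sup>*\<^sup>* p q" "agree_below j x y" "j \<le> w"
  shows "coeff (pres (spec x q)) (w - j) - coeff (pres (spec y q)) (w - j)
       = coeff (pres (spec x p)) (w - j) - coeff (pres (spec y p)) (w - j)"
  using assms(1) by induction (use division_step_coeff[OF _ assms(2,3)] in auto)

lemma coeff_index_iff:
  "(12, j) \<in> coeff_index \<longleftrightarrow> j \<in> {4,5,6,12}"
  "(13, j) \<in> coeff_index \<longleftrightarrow> j \<in> {5,6,7,13}"
  "(14, j) \<in> coeff_index \<longleftrightarrow> j \<in> {1,2,3,4,6,7,8,9,14}"
  "(15, j) \<in> coeff_index \<longleftrightarrow> j \<in> {1,2,3,4,5,7,8,9,10,15}"
  "(16, j) \<in> coeff_index \<longleftrightarrow> j \<in> {2,3,4,5,8,9,10,11,16}"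
  "(18, j) \<in> coeff_index \<longleftrightarrow> j \<in> {1,2,3,4,5,6,7,8,10,11,12,13,18}"
  "(21, j) \<in> coeff_index \<longleftrightarrow> j \<in> {1,2,3,4,6,7,8,9,10,11,13,14,15,16,21}"
  by (simp_all only: mem_Collect_eq flip: coeff_index_fibres)

lemma coeff_pres_monom_form:
  fixes x :: "nat \<times> nat \<Rightarrow> 'a::field"
  assumes "\<And>ij. ij \<notin> coeff_index \<Longrightarrow> x ij = 0" "1 \<le> j" "j \<le> w" "w = k + i"
  shows "coeff (monom 1 k * pres (spec x (form i))) (w - j) = - x (i, j)"
proof (cases "j \<le> i")
  case True
  then have "k \<le> w - j" "w - j - k = i - j" "i - j < i" "i - (i - j) = j" using assms(2-) by auto
  then show ?thesis using assms(1) by (simp add: coeff_monom_mult coeff_pres_spec_form)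
next
  case False
  then have "(i, j) \<notin> coeff_index" using coeff_index_bounds[of i j] by auto
  then show ?thesis using assms False by (simp add: coeff_monom_mult)
qed

lemma pres_syzygy:
  "pres (spec x (syzygy 20 form))
    = monom 1 8 * pres (spec x (form 12)) - monom 1 7 * pres (spec x (form 13)) + monom 1 6 * pres (spec x (form 14))"
  "pres (spec x (syzygy 23 form))
    = monom 1 8 * pres (spec x (form 15)) - monom 1 11 * pres (spec x (form 12))
      + monom 1 5 * pres (spec x (form 18)) - monom 1 7 * pres (spec x (form 16))"
  "pres (spec x (syzygy 26 form))
    = monom 1 8 * pres (spec x (form 18)) - monom 1 5 * pres (spec x (form 21))
      + monom 1 12 * pres (spec x (form 14)) - monom 1 14 * pres (spec x (form 12))"
  "pres (spec x (syzygy 29 form))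
    = monom 1 8 * pres (spec x (form 21)) - monom 1 15 * pres (spec x (form 14)) - monom 1 16 * pres (spec x (form 13))"
  by (simp_all add: syzygy_def spec_simps pres_simps mult_monom monom_power)

text \<open>The equations that are linear in the coefficients of weight \<open>j\<close>, one for
  each syzygy.\<close>

lemma coeff_pres_syzygy:
  fixes x :: "nat \<times> nat \<Rightarrow> 'a::field"
  assumes x: "\<And>ij. ij \<notin> coeff_index \<Longrightarrow> x ij = 0" and j: "1 \<le> j"
  shows "j \<le> 20 \<Longrightarrow> coeff (pres (spec x (syzygy 20 form))) (20 - j)
      = - x (12, j) + x (13, j) - x (14, j)"
    and "j \<le> 23 \<Longrightarrow> coeff (pres (spec x (syzygy 23 form))) (23 - j)
      = - x (15, j) + x (12, j) - x (18, j) + x (16, j)"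
    and "j \<le> 26 \<Longrightarrow> coeff (pres (spec x (syzygy 26 form))) (26 - j)
      = - x (18, j) + x (21, j) - x (14, j) + x (12, j)"
    and "j \<le> 29 \<Longrightarrow> coeff (pres (spec x (syzygy 29 form))) (29 - j)
      = - x (21, j) + x (14, j) + x (13, j)"
  by (simp_all add: pres_syzygy coeff_pres_monom_form[OF x j])

lemma mem_moduli_cone:
  "x \<in> cone_set (moduli_cone R) \<longleftrightarrow>
    (\<forall>ij. ij \<notin> coeff_index \<longrightarrow> x ij = 0) \<and> (\<forall>w \<in> syzygy_weights. spec x (R w) = 0)"
  by (simp add: moduli_cone_def spec_eq_0_iff)

text \<open>The coordinates that the linear equations leave undetermined. Their weights are the
  entries of \<alpha>.\<close>

definition pivots :: "(nat \<times> nat) set" where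
  "pivots = {(12,4), (12,6), (15,2), (15,3), (15,4), (15,5), (15,7), (15,8), (15,9), (15,10)}"

text \<open>Induction on the weight \<open>j\<close>. For two points of \<open>Q\<close> that agree
  below \<open>j\<close>, the nonlinear contributions cancel, and the differences in weight
  \<open>j\<close> satisfy four homogeneous linear equations. These leave the differences at 12, 13
  and 15 free; gaps of \<open>S\<close>, the normalization and the pivots remove them.\<close>

lemma moduli_cone_unique:
  fixes R :: "nat \<Rightarrow> 'a::field family_poly"
  assumes R: "syzygy_remainders R" and x: "x \<in> cone_set (moduli_cone R)"
    and y: "y \<in> cone_set (moduli_cone R)" and piv: "\<And>ij. ij \<in> pivots \<Longrightarrow> x ij = y ij"
  shows "x = y"
proof -
  have x0: "x ij = 0" "y ij = 0" if "ij \<notin> coeff_index" for ij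
    using x y that unfolding mem_moduli_cone by blast+
  have Rxy: "spec x (R w) = 0" "spec y (R w) = 0" if "w \<in> syzygy_weights" for w
    using x y that unfolding mem_moduli_cone by blast+
  have "agree_below j x y" for j
  proof (induction j)
    case 0
    then show ?case by (simp add: agree_below_def)
  next
    case (Suc j)
    define d where "d = (\<lambda>i. x (i, j) - y (i, j))"
    have d0: "d i = 0" if "(i, j) \<notin> coeff_index" for i
      using x0 that by (simp add: d_def)
    have dp: "d i = 0" if "(i, j) \<in> pivots" for i
      using piv that by (simp add: d_def)
    have steps: "coeff (pres (spec x (syzygy w form))) (w - j) = coeff (pres (spec y (syzygy w form))) (w - j)"
      if "w \<in> {20, 23, 26, 29}" "j \<le> w" for w
    proof -
      have w: "w \<in> syzygy_weights" using that(1) by (simp add: syzygy_weights_def)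
      then have "(division_step (syzygy_degree w) w)\<^sup>*\<^sup>* (syzygy w form) (R w)"
        using R by (simp add: syzygy_remainders_def)
      from division_steps_coeff[OF this Suc that(2)] show ?thesis
        using Rxy[OF w] by (simp add: pres_simps)
    qed
    have "d i = 0" if i: "(i, j) \<in> coeff_index" for i
    proof -
      have j: "1 \<le> j" "j \<le> 21"
        using coeff_index_bounds[OF i] coeff_index_form_weights[OF i] by (auto simp: form_weights_def)
      note lin = coeff_pres_syzygy[of x, OF x0(1) j(1)] coeff_pres_syzygy[of y, OF x0(2) j(1)]
      have e1: "d 12 - d 13 + d 14 = 0"
      \<comment> \<open>Weight 21 exceeds the weight of the first syzygy, but there
        \<open>(21, 21)\<close> is the only index, so the three differences vanish anyway.\<close>
      proof (cases "j \<le> 20")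
        case True
        then show ?thesis using steps[of 20] by (simp add: lin d_def algebra_simps)
      next
        case False
        then show ?thesis by (simp add: d0 coeff_index_iff)
      qed
      have e2: "d 15 - d 12 + d 18 - d 16 = 0"
        using steps[of 23] j by (simp add: lin d_def algebra_simps)
      have e3: "d 18 - d 21 + d 14 - d 12 = 0"
        using steps[of 26] j by (simp add: lin d_def algebra_simps)
      have e4: "d 21 - d 14 - d 13 = 0"
        using steps[of 29] j by (simp add: lin d_def algebra_simps)
      from e1 have s14: "d 14 = d 13 - d 12" by (simp add: algebra_simps)
      from e4 s14 have s21: "d 21 = 2 * d 13 - d 12" by (simp add: algebra_simps)
      from e3 s14 s21 have s18: "d 18 = d 12 + d 13" by (simp add: algebra_simps)
      from e2 s18 have s16: "d 16 = d 15 + d 13" by (simp add: algebra_simps)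
      \<comment> \<open>The special weights rely on indices that do not occur: \<open>i - j\<close>
        is the gap 9 for \<open>(13, 4)\<close>, \<open>(14, 5)\<close>, \<open>(15, 6)\<close>,
        \<open>(16, 7)\<close>, it is 1 or 2 for \<open>(13, 12)\<close>, \<open>(14, 12)\<close>,
        \<open>(14, 13)\<close>, and \<open>(12, 7)\<close>, \<open>(16, 6)\<close>,
        \<open>(21, 5)\<close> are normalized to zero. In weight 5 this leaves
        \<open>d 13 = d 12\<close> together with \<open>2 * d 13 = d 12\<close>.\<close>
      have d12_13: "d 12 = 0 \<and> d 13 = 0"
      proof -
        consider "j \<in> {4, 6}" | "j = 5" | "j = 7" | "j = 12" | "j \<notin> {4, 5, 6, 7, 12}" by blast
        then show ?thesis
        proof cases
          case 1
          then have "d 12 = 0" "j = 4 \<Longrightarrow> d 13 = 0" "j = 6 \<Longrightarrow> d 15 = 0" "j = 6 \<Longrightarrow> d 16 = 0"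
            using d0 dp by (auto simp: pivots_def coeff_index_iff)
          then show ?thesis using 1 s16 by auto
        next
          case 2
          then have "d 14 = 0" "d 21 = 0" using d0 by (auto simp: coeff_index_iff)
          then show ?thesis using s14 s21 by (simp add: algebra_simps)
        next
          case 3
          then have "d 12 = 0" "d 15 = 0" "d 16 = 0" using d0 dp by (auto simp: pivots_def coeff_index_iff)
          then show ?thesis using s16 by simp
        next
          case 4
          then have "d 13 = 0" "d 14 = 0" using d0 by (auto simp: coeff_index_iff)
          then show ?thesis using s14 by simp
        next
          case 5
          then have "d 12 = 0" "j \<noteq> 13 \<Longrightarrow> d 13 = 0" "j = 13 \<Longrightarrow> d 14 = 0"
            using d0 by (auto simp: coeff_index_iff)
          then show ?thesis using s14 by fastforce
        qed
      qed
      have "d 15 = 0"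
      \<comment> \<open>In these weights \<open>d 15\<close> is not a pivot. It is killed through
        \<open>d 16\<close>: \<open>(16, 1)\<close> is normalized, and \<open>(16, 15)\<close> would
        need the gap 1.\<close>
      proof (cases "j \<in> {1, 15}")
        case True
        then have "d 16 = 0" using d0 by (auto simp: coeff_index_iff)
        then show ?thesis using s16 d12_13 by simp
      next
        case False
        then have "(15, j) \<in> pivots \<or> (15, j) \<notin> coeff_index"
          by (auto simp: pivots_def coeff_index_iff)
        then show ?thesis using d0 dp by blast
      qed
      then show ?thesis
        using coeff_index_form_weights[OF i] d12_13 s14 s16 s18 s21 by (auto simp: form_weights_def)
    qed
    then have "x (i, j) = y (i, j)" if "(i, j) \<in> coeff_index" for i
      using that by (simp add: d_def)
    then show ?case using Suc by (auto simp: agree_below_def less_Suc_eq)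
  qed
  then have "x ij = y ij" for ij
    using x0[of ij] by (cases "ij \<in> coeff_index") (auto simp: agree_below_def)
  then show ?thesis by blast
qed

section \<open>Division by the forms\<close>

lemma polys_in_zero [simp]: "0 \<in> polys_in V"
  by (simp add: polys_in_def)

lemma isobaric_zero [simp]: "isobaric V w d 0"
  by (simp add: isobaric_def)

lemma isobaric_add: "isobaric V w d p \<Longrightarrow> isobaric V w d q \<Longrightarrow> isobaric V w d (p + q)"
  using keys_add[of p q] by (fastforce simp: isobaric_def polys_in_def)

lemma isobaric_uminus: "isobaric V w d p \<Longrightarrow> isobaric V w d (- p)"
  by (simp add: isobaric_def polys_in_def keys_minus)

lemma isobaric_diff: "isobaric V w d p \<Longrightarrow> isobaric V w d q \<Longrightarrow> isobaric V w d (p - q)"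
  using isobaric_add[OF _ isobaric_uminus] by force

lemma isobaric_mult: "isobaric V w d p \<Longrightarrow> isobaric V w e q \<Longrightarrow> isobaric V w (d + e) (p * q)"
  unfolding isobaric_def polys_in_def
  by (auto elim!: keys_multE simp: keys_add_nat) blast+

lemma isobaric_single:
  "keys m \<subseteq> V \<Longrightarrow> mono_weight w m = d \<Longrightarrow> isobaric V w d (single m c)"
  by (auto simp: isobaric_def polys_in_def)

lemma isobaric_Var: "v \<in> V \<Longrightarrow> isobaric V w (w v) (Var v)"
  unfolding Var_def by (intro isobaric_single) auto

text \<open>Ten times the weight plus a correction 2, 3, 2, 0 for X_5, X_6, X_7, X_8. The correction
  makes the first term of each of the five initial forms larger than the second. A standard monomial
  collects at most 6 of it and a leading monomial at least 4, so a standard monomial of smaller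
  weight, losing at least 10, stays below the leading monomial.\<close>

definition tau :: "nat \<Rightarrow> nat" where
  "tau n = (if n = 5 then 52 else if n = 6 then 63 else if n = 7 then 72 else if n = 8 then 80 else 0)"

definition lead_mono :: "nat \<Rightarrow> (nat \<Rightarrow>\<^sub>0 nat)" where
  "lead_mono i = (if i = 12 then xmono 0 0 2 0 0 else if i = 13 then xmono 0 0 1 1 0
     else if i = 14 then xmono 0 0 0 2 0 else if i = 15 then xmono 0 3 0 0 0 else xmono 0 2 1 0 0)"

definition trail_mono :: "nat \<Rightarrow> (nat \<Rightarrow>\<^sub>0 nat)" where
  "trail_mono i = (if i = 12 then xmono 0 1 0 1 0 else if i = 13 then xmono 0 1 0 0 1
     else if i = 14 then xmono 0 0 1 0 1 else if i = 15 then xmono 1 0 0 1 1 else xmono 1 0 0 0 2)"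

definition lead_weights :: "nat set" where
  "lead_weights = {12, 13, 14, 15, 16}"

lemma Var_xmono:
  "Var 0 = single (xmono 1 0 0 0 0) 1" "Var 5 = single (xmono 0 1 0 0 0) 1"
  "Var 6 = single (xmono 0 0 1 0 0) 1" "Var 7 = single (xmono 0 0 0 1 0) 1"
  "Var 8 = single (xmono 0 0 0 0 1) 1"
  by (simp_all add: Var_def xmono_def)

lemma Var_power_xmono:
  "Var 5 ^ k = single (xmono 0 k 0 0 0) 1" "Var 6 ^ k = single (xmono 0 0 k 0 0) 1"
  "Var 7 ^ k = single (xmono 0 0 0 k 0) 1" "Var 8 ^ k = single (xmono 0 0 0 0 k) 1"
  by (simp_all only: Var_power single_xmono)

lemma initial_form_lead:
  assumes "i \<in> lead_weights"
  shows "initial_form i = single (lead_mono i) 1 - single (trail_mono i) 1"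
  using assms
  by (auto simp: lead_weights_def initial_form_def lead_mono_def trail_mono_def
      Var_power_xmono; simp add: Var_xmono mult_single xmono_add
      numeral_2_eq_2)

lemma lead_mono_facts:
  assumes "i \<in> lead_weights"
  shows "mono_weight id (lead_mono i) = i" "mono_weight id (trail_mono i) = i"
    "mono_weight (\<lambda>_. 1) (lead_mono i) = form_degree i" "mono_weight (\<lambda>_. 1) (trail_mono i) = form_degree i"
    "mono_weight tau (trail_mono i) < mono_weight tau (lead_mono i)"
    "10 * i + 4 \<le> mono_weight tau (lead_mono i)"
    "keys (lead_mono i) \<subseteq> xvars" "keys (trail_mono i) \<subseteq> xvars"
    "i \<in> form_weights"
  using assms keys_xmono
  by (auto simp: lead_weights_def lead_mono_def trail_mono_def mono_weight_xmono tau_def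
      form_degree_def form_weights_def)

lemma tau_std_mono:
  assumes "keys m \<subseteq> xvars" "std_mono m"
  shows "mono_weight tau m \<le> 10 * mono_weight id m + 6"
proof -
  obtain a b c d e where m: "m = xmono a b c d e" using xmonoE[OF assms(1)] by blast
  then show ?thesis using assms(2) by (auto simp: mono_weight_xmono std_mono_xmono tau_def)
qed

text \<open>A monomial that violates the bounds on the exponents is divisible by one of the five
  leading monomials; the forms of weights 18 and 21 add no further leading monomials.\<close>

lemma not_std_mono:
  assumes "keys m \<subseteq> xvars" "\<not> std_mono m"
  shows "\<exists>i \<in> lead_weights. \<exists>M. keys M \<subseteq> xvars \<and> m = M + lead_mono i"
proof -
  obtain a b c d e where m: "m = xmono a b c d e" using xmonoE[OF assms(1)] by blast
  have gen: ?thesis if "i \<in> lead_weights" "m = xmono a' b' c' d' e' + lead_mono i" for i a' b' c' d' e'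
    using that keys_xmono by blast
  consider "2 \<le> c" | "1 \<le> c" "1 \<le> d" | "2 \<le> d" | "3 \<le> b" | "2 \<le> b" "1 \<le> c"
    using assms(2) unfolding m std_mono_xmono by linarith
  then show ?thesis
  proof cases
    case 1 then show ?thesis
      by (intro gen[of 12 a b "c - 2" d e]) (auto simp: m lead_weights_def lead_mono_def xmono_add xmono_eq_iff)
  next
    case 2 then show ?thesis
      by (intro gen[of 13 a b "c - 1" "d - 1" e]) (auto simp: m lead_weights_def lead_mono_def xmono_add xmono_eq_iff)
  next
    case 3 then show ?thesis
      by (intro gen[of 14 a b c "d - 2" e]) (auto simp: m lead_weights_def lead_mono_def xmono_add xmono_eq_iff)
  next
    case 4 then show ?thesis
      by (intro gen[of 15 a "b - 3" c d e]) (auto simp: m lead_weights_def lead_mono_def xmono_add xmono_eq_iff)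
  next
    case 5 then show ?thesis
      by (intro gen[of 16 a "b - 2" "c - 1" d e]) (auto simp: m lead_weights_def lead_mono_def xmono_add xmono_eq_iff)
  qed
qed

lemma std_mono_not_lead: "i \<in> lead_weights \<Longrightarrow> std_mono m \<Longrightarrow> m \<noteq> M + lead_mono i"
  by (auto simp: lead_weights_def std_mono_def lead_mono_def lookup_add lookup_xmono)

section \<open>Existence of remainders\<close>

definition low_form :: "nat \<Rightarrow> 'a::comm_ring_1 family_poly" where
  "low_form i = (\<Sum>j \<in> {j. (i, j) \<in> coeff_index}. Const (Var (i, j)) * Z (form_degree i) (i - j))"

lemma form_low_form: "form i = initial_form i - low_form i"
  by (simp add: form_def low_form_def)

text \<open>The bihomogeneity that division preserves. The strict bound on the weight in the X_n is
  what provides \<open>h + i < w\<close> at every step.\<close>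

definition biisobaric :: "nat \<Rightarrow> nat \<Rightarrow> 'a::comm_ring_1 family_poly \<Rightarrow> bool" where
  "biisobaric r w p \<longleftrightarrow> (\<forall>m \<in> keys p. keys m \<subseteq> xvars \<and>
     mono_weight (\<lambda>_. 1) m = r \<and> mono_weight id m < w \<and>
     isobaric coeff_index snd (w - mono_weight id m) (lookup p m))"

lemma biisobaric_zero: "biisobaric r w 0"
  by (simp add: biisobaric_def)

lemma isobaric_lookup_biisobaric:
  "biisobaric r w p \<Longrightarrow> isobaric coeff_index snd (w - mono_weight id m) (lookup p m)"
  by (cases "m \<in> keys p") (auto simp: biisobaric_def in_keys_iff)

lemma biisobaric_add: "biisobaric r w p \<Longrightarrow> biisobaric r w q \<Longrightarrow> biisobaric r w (p + q)"
  using keys_add[of p q] isobaric_lookup_biisobaric[of r w p] isobaric_lookup_biisobaric[of r w q]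
  unfolding biisobaric_def by (fastforce simp: lookup_add intro: isobaric_add)

lemma biisobaric_uminus: "biisobaric r w p \<Longrightarrow> biisobaric r w (- p)"
  unfolding biisobaric_def by (auto simp: keys_minus intro: isobaric_uminus)

lemma biisobaric_diff: "biisobaric r w p \<Longrightarrow> biisobaric r w q \<Longrightarrow> biisobaric r w (p - q)"
  using biisobaric_add[OF _ biisobaric_uminus] by force

lemma biisobaric_sum: "(\<And>x. x \<in> A \<Longrightarrow> biisobaric r w (f x)) \<Longrightarrow> biisobaric r w (\<Sum>x\<in>A. f x)"
  by (induction A rule: infinite_finite_induct) (auto intro: biisobaric_zero biisobaric_add)

lemma biisobaric_single:
  assumes "keys m \<subseteq> xvars" "mono_weight (\<lambda>_. 1) m = r" "mono_weight id m < w"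
    "isobaric coeff_index snd (w - mono_weight id m) c"
  shows "biisobaric r w (single m c)"
  using assms by (auto simp: biisobaric_def)

lemma low_form_term:
  assumes "(i, j) \<in> coeff_index"
  obtains z where "keys z \<subseteq> xvars" "mono_weight (\<lambda>_. 1) z = form_degree i"
    "mono_weight id z = i - j" "std_mono z"
    "Const (Var (i, j)) * Z (form_degree i) (i - j) = single z (Var (i, j) :: (nat \<times> nat, 'a::comm_ring_1) mpoly)"
proof -
  obtain z where z: "z \<in> basis_monos (form_degree i)" "mono_weight id z = i - j"
    "Z (form_degree i) (i - j) = single z (1 :: (nat \<times> nat, 'a) mpoly)"
    using Z_form[OF assms, where 'a = "(nat \<times> nat, 'a) mpoly"] by blast
  have "2 \<le> form_degree i" by (simp add: form_degree_def)
  with z(1) obtain b c d e where "z = xmono (form_degree i - (b + c + d + e)) b c d e"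
    "b + c + d + e \<le> form_degree i" by (auto simp: basis_monos_iff)
  then have "keys z \<subseteq> xvars" "mono_weight (\<lambda>_. 1) z = form_degree i"
    using keys_xmono by (auto simp: mono_weight_xmono)
  then show ?thesis
    using that z basis_monos_std[OF \<open>2 \<le> form_degree i\<close> z(1)] by (simp add: Const_mult_single)
qed

lemma biisobaric_single_low_form:
  assumes M: "keys M \<subseteq> xvars" "mono_weight (\<lambda>_. 1) M + form_degree i = r"
    "mono_weight id M + i \<le> w" and c: "isobaric coeff_index snd (w - (mono_weight id M + i)) c"
  shows "biisobaric r w (single M c * low_form i)"
  unfolding low_form_def sum_distrib_left
proof (rule biisobaric_sum)
  fix j assume "j \<in> {j. (i, j) \<in> coeff_index}"
  then have ij: "(i, j) \<in> coeff_index" by simp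
  then have j: "1 \<le> j" "j \<le> i" using coeff_index_bounds[OF ij] by auto
  obtain z where z: "keys z \<subseteq> xvars" "mono_weight (\<lambda>_. 1) z = form_degree i"
    "mono_weight id z = i - j" "std_mono z"
    "Const (Var (i, j)) * Z (form_degree i) (i - j) = single z (Var (i, j) :: (nat \<times> nat, 'a) mpoly)"
    by (rule low_form_term[OF ij])
  have "isobaric coeff_index snd (w - (mono_weight id M + i) + j) (c * Var (i, j))"
    using isobaric_mult[OF c isobaric_Var[OF ij, of snd]] by simp
  also have "w - (mono_weight id M + i) + j = w - mono_weight id (M + z)"
    using M(3) j z(3) by simp
  finally show "biisobaric r w (single M c * (Const (Var (i, j)) * Z (form_degree i) (i - j)))"
    unfolding z(5) mult_single using M z j
    by (intro biisobaric_single) (auto simp: keys_add_nat)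
qed

lemma low_form_keys_tau:
  assumes "m \<in> keys (low_form i :: 'a::comm_ring_1 family_poly)" "i \<in> lead_weights"
  shows "mono_weight tau m < mono_weight tau (lead_mono i)"
proof -
  from assms(1) obtain j where ij: "(i, j) \<in> coeff_index" and
    m: "m \<in> keys (Const (Var (i, j)) * Z (form_degree i) (i - j) :: 'a family_poly)"
    unfolding low_form_def using keys_sum[of "\<lambda>j. Const (Var (i, j)) * Z (form_degree i) (i - j)"] by fastforce
  obtain z where z: "keys z \<subseteq> xvars" "mono_weight (\<lambda>_. 1) z = form_degree i"
    "mono_weight id z = i - j" "std_mono z"
    "Const (Var (i, j)) * Z (form_degree i) (i - j) = single z (Var (i, j) :: (nat \<times> nat, 'a) mpoly)"
    by (rule low_form_term[OF ij])
  then have "m = z" using m by (auto split: if_splits)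
  with tau_std_mono[OF z(1,4)] z(3) lead_mono_facts(6)[OF assms(2)] coeff_index_bounds[OF ij]
  show ?thesis by auto
qed

text \<open>Cancelling \<open>m\<close> brings in the trailing term, of equal weight but smaller
  \<open>tau\<close>, and terms of \<open>low_form\<close>, whose drop in weight outbalances the
  correction in \<open>tau\<close>.\<close>

lemma division_step_lead:
  fixes p :: "'a::comm_ring_1 family_poly"
  assumes p: "biisobaric r w p" and m: "m \<in> keys p" and i: "i \<in> lead_weights"
    and M: "keys M \<subseteq> xvars" "m = M + lead_mono i"
  obtains q where "division_step r w p q" "biisobaric r w q"
    "\<And>k. k \<in> keys q \<Longrightarrow>
      k \<in> keys p - {m} \<or> mono_weight tau k < mono_weight tau m"
proof -
  note lead = lead_mono_facts[OF i]
  define c where "c = lookup p m"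
  define H where "H = single M c"
  have pm: "mono_weight (\<lambda>_. 1) m = r" "mono_weight id m < w" "isobaric coeff_index snd (w - mono_weight id m) c"
    using p m by (auto simp: biisobaric_def c_def)
  then have Mw: "mono_weight (\<lambda>_. 1) M + form_degree i = r" "mono_weight id M + i = mono_weight id m"
    using lead M(2) by auto
  have eq: "H * form i = single m c
      - (single (M + trail_mono i) c + H * low_form i)"
    by (simp add: H_def form_low_form initial_form_lead[OF i] right_diff_distrib mult_single M(2) algebra_simps)
  show thesis
  proof (rule that)
    show "division_step r w p (p - H * form i)"
      unfolding division_step_def
    proof (intro exI conjI refl allI)
      show "isobaric xvars (\<lambda>_. 1) (r - form_degree i) H"
        unfolding H_def using M Mw by (intro isobaric_single) auto
      show "isobaric xvars id (mono_weight id M) H"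
        unfolding H_def using M by (intro isobaric_single) auto
      show "isobaric coeff_index snd (w - (mono_weight id M + i)) (lookup H k)" for k
        using pm(3) Mw(2) by (auto simp: H_def lookup_single when_def)
    qed (use lead Mw pm in auto)
  next
    have "biisobaric r w (single m c)"
      using pm p m by (intro biisobaric_single) (auto simp: biisobaric_def)
    moreover have "biisobaric r w (single (M + trail_mono i) c)"
      using M Mw lead pm by (intro biisobaric_single) (auto simp: keys_add_nat)
    moreover have "biisobaric r w (H * low_form i)"
      unfolding H_def using M Mw pm by (intro biisobaric_single_low_form) auto
    ultimately show "biisobaric r w (p - H * form i)"
      unfolding eq by (intro biisobaric_diff biisobaric_add p)
  next
    fix k assume k: "k \<in> keys (p - H * form i)"
    have "p - H * form i = (p - single m c)
        + (single (M + trail_mono i) c + H * low_form i)"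
      by (simp add: eq algebra_simps)
    then consider "k \<in> keys (p - single m c)"
      | "k \<in> keys (single (M + trail_mono i) c)"
      | "k \<in> keys (H * low_form i)"
      using k keys_add by (metis (no_types, lifting) UnE subsetD)
    then show "k \<in> keys p - {m} \<or> mono_weight tau k < mono_weight tau m"
    proof cases
      case 1
      then show ?thesis by (auto simp: in_keys_iff lookup_minus lookup_single when_def c_def split: if_splits)
    next
      case 2
      then show ?thesis using lead M by (auto split: if_splits)
    next
      case 3
      then obtain b where "b \<in> keys (low_form i :: 'a family_poly)" "k = M + b"
        unfolding H_def by (auto elim!: keys_multE split: if_splits)
      then show ?thesis using low_form_keys_tau[OF _ i] M by auto
    qed
  qed
qed

lemma division_exists:
  fixes p :: "'a::comm_ring_1 family_poly"
  assumes r: "2 \<le> r" and "biisobaric r w p"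
    and "\<And>m. m \<in> keys p \<Longrightarrow> \<not> std_mono m \<Longrightarrow> mono_weight tau m < n"
  shows "\<exists>q \<in> Lambda r. (division_step r w)\<^sup>*\<^sup>* p q"
  using assms(2,3)
proof (induction n arbitrary: p)
  case 0
  then have "p \<in> Lambda r"
    unfolding Lambda_def biisobaric_def using r by (auto intro!: basis_monosI)
  then show ?case by blast
next
  case (Suc n)
  define bad where
    "bad = (\<lambda>p :: 'a family_poly. {m \<in> keys p. \<not> std_mono m \<and> mono_weight tau m = n})"
  have "finite (bad p)" by (simp add: bad_def)
  from this Suc.prems show ?case
  proof (induction "bad p" arbitrary: p rule: finite_psubset_induct)
    case (psubset p)
    show ?case
    proof (cases "bad p = {}")
      case True
      then have "mono_weight tau m < n" if "m \<in> keys p" "\<not> std_mono m" for m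
        using psubset.prems(2)[OF that] that by (auto simp: bad_def less_Suc_eq)
      then show ?thesis using Suc.IH[OF psubset.prems(1)] by blast
    next
      case False
      then obtain m where m: "m \<in> keys p" "\<not> std_mono m" "mono_weight tau m = n"
        by (auto simp: bad_def)
      have "keys m \<subseteq> xvars" using psubset.prems(1) m(1) by (auto simp: biisobaric_def)
      then obtain i M where iM: "i \<in> lead_weights" "keys M \<subseteq> xvars" "m = M + lead_mono i"
        using not_std_mono m(2) by blast
      obtain q where q: "division_step r w p q" "biisobaric r w q"
        and keys: "\<And>k. k \<in> keys q \<Longrightarrow>
          k \<in> keys p - {m} \<or> mono_weight tau k < mono_weight tau m"
        using division_step_lead[OF psubset.prems(1) m(1) iM] by blast
      have "bad q \<subset> bad p"
        using keys m by (fastforce simp: bad_def)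
      moreover have "mono_weight tau k < Suc n" if "k \<in> keys q" "\<not> std_mono k" for k
        using keys[OF that(1)] psubset.prems(2)[of k] that m(3) by auto
      ultimately obtain q' where "q' \<in> Lambda r" "(division_step r w)\<^sup>*\<^sup>* q q'"
        using psubset.hyps(2)[OF _ q(2)] by blast
      then show ?thesis using q(1) by (meson converse_rtranclp_into_rtranclp)
    qed
  qed
qed

lemma syzygy_initial_form: "syzygy w initial_form = 0"
  by (simp add: syzygy_def initial_form_def power2_eq_square power3_eq_cube algebra_simps)

lemma syzygy_diff: "syzygy w (\<lambda>i. F i - G i) = syzygy w F - syzygy w G"
  unfolding syzygy_def by (simp add: algebra_simps)

text \<open>The syzygies are identities between the initial forms, so only the lower parts survive
  substitution, and their weights in the X_n are strictly below \<open>w\<close>.\<close>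

lemma biisobaric_syzygy_form:
  assumes w: "w \<in> syzygy_weights"
  shows "biisobaric (syzygy_degree w) w (syzygy w form :: 'a::comm_ring_1 family_poly)"
proof -
  have *: "biisobaric r v (single (xmono a b c d e) 1 * low_form i :: 'a family_poly)"
    if "a + b + c + d + e + form_degree i = r" "5 * b + 6 * c + 7 * d + 8 * e + i = v" for a b c d e i r v
  proof (rule biisobaric_single_low_form)
    show "isobaric coeff_index snd (v - (mono_weight id (xmono a b c d e) + i)) (1 :: (nat \<times> nat, 'a) mpoly)"
      using isobaric_single[of 0 coeff_index snd 0 "1::'a"] that by (simp add: mono_weight_xmono)
  qed (use that keys_xmono in \<open>auto simp: mono_weight_xmono\<close>)
  have "syzygy w (form :: nat \<Rightarrow> 'a family_poly) = - syzygy w low_form"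
    using syzygy_diff[of w initial_form "low_form :: nat \<Rightarrow> 'a family_poly"]
    by (simp add: syzygy_initial_form flip: form_low_form)
  also have "biisobaric (syzygy_degree w) w (- syzygy w low_form :: 'a family_poly)"
    using w unfolding syzygy_weights_def syzygy_def Var_xmono power2_eq_square mult_single xmono_add
    by (auto simp: syzygy_degree_def intro!: biisobaric_uminus biisobaric_add biisobaric_diff *
        simp: form_degree_def)
  finally show ?thesis .
qed

lemma syzygy_remainders_exist: "\<exists>R :: nat \<Rightarrow> 'a::comm_ring_1 family_poly. syzygy_remainders R"
proof -
  have "\<exists>q \<in> Lambda (syzygy_degree w). (division_step (syzygy_degree w) w)\<^sup>*\<^sup>* (syzygy w form :: 'a family_poly) q"
    if w: "w \<in> syzygy_weights" for w
  proof (rule division_exists[OF _ biisobaric_syzygy_form[OF w]])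
    let ?K = "keys (syzygy w form :: 'a family_poly)"
    show "mono_weight tau m < Suc (\<Sum>k\<in>?K. mono_weight tau k)" if "m \<in> ?K" for m
      using that by (intro le_imp_less_Suc member_le_sum) auto
  qed (simp add: syzygy_degree_def)
  then have "\<forall>w \<in> syzygy_weights. \<exists>q. (division_step (syzygy_degree w) w)\<^sup>*\<^sup>* (syzygy w form :: 'a family_poly) q \<and>
      q \<in> Lambda (syzygy_degree w)" by blast
  from bchoice[OF this] show ?thesis unfolding syzygy_remainders_def by blast
qed

section \<open>The Pfaffian family\<close>

lemma Const_numeral: "Const (numeral n) = numeral n"
  by (simp add: Const_def)

lemma Z_prod:
  assumes "2 \<le> r" "a + b + c + d + e = r" "5 * b + 6 * c + 7 * d + 8 * e = n"
    "std_mono (xmono a b c d e)"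
  shows "Z r n = Var 0 ^ a * Var 5 ^ b * Var 6 ^ c * Var 7 ^ d * Var 8 ^ e"
proof -
  have "Z r n = single (xmono a b c d e) 1"
    using assms keys_xmono by (intro Z_eq basis_monosI) (auto simp: mono_weight_xmono)
  then show ?thesis by (simp add: Var_power mult_single xmono_def)
qed

lemma Z_values:
  "Z 2 0 = Var 0 ^ 2"
  "Z 2 5 = Var 0 * Var 5"
  "Z 2 6 = Var 0 * Var 6"
  "Z 2 7 = Var 0 * Var 7"
  "Z 2 8 = Var 0 * Var 8"
  "Z 2 10 = Var 5 ^ 2"
  "Z 2 11 = Var 5 * Var 6"
  "Z 2 12 = Var 5 * Var 7"
  "Z 2 13 = Var 5 * Var 8"
  "Z 3 0 = Var 0 ^ 3"
  "Z 3 5 = Var 0 ^ 2 * Var 5"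
  "Z 3 6 = Var 0 ^ 2 * Var 6"
  "Z 3 7 = Var 0 ^ 2 * Var 7"
  "Z 3 8 = Var 0 ^ 2 * Var 8"
  "Z 3 10 = Var 0 * Var 5 ^ 2"
  "Z 3 11 = Var 0 * Var 5 * Var 6"
  "Z 3 12 = Var 0 * Var 5 * Var 7"
  "Z 3 13 = Var 0 * Var 5 * Var 8"
  "Z 3 14 = Var 0 * Var 6 * Var 8"
  "Z 3 15 = Var 0 * Var 7 * Var 8"
  "Z 3 16 = Var 0 * Var 8 ^ 2"
  "Z 3 17 = Var 5 ^ 2 * Var 7"
  "Z 3 18 = Var 5 ^ 2 * Var 8"
  "Z 3 19 = Var 5 * Var 6 * Var 8"
  "Z 3 20 = Var 5 * Var 7 * Var 8"
  using Z_prod[of 2 2 0 0 0 0 0]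
    Z_prod[of 2 1 1 0 0 0 5]
    Z_prod[of 2 1 0 1 0 0 6]
    Z_prod[of 2 1 0 0 1 0 7]
    Z_prod[of 2 1 0 0 0 1 8]
    Z_prod[of 2 0 2 0 0 0 10]
    Z_prod[of 2 0 1 1 0 0 11]
    Z_prod[of 2 0 1 0 1 0 12]
    Z_prod[of 2 0 1 0 0 1 13]
    Z_prod[of 3 3 0 0 0 0 0]
    Z_prod[of 3 2 1 0 0 0 5]
    Z_prod[of 3 2 0 1 0 0 6]
    Z_prod[of 3 2 0 0 1 0 7]
    Z_prod[of 3 2 0 0 0 1 8]
    Z_prod[of 3 1 2 0 0 0 10]
    Z_prod[of 3 1 1 1 0 0 11]
    Z_prod[of 3 1 1 0 1 0 12]
    Z_prod[of 3 1 1 0 0 1 13]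
    Z_prod[of 3 1 0 1 0 1 14]
    Z_prod[of 3 1 0 0 1 1 15]
    Z_prod[of 3 1 0 0 0 2 16]
    Z_prod[of 3 0 2 0 1 0 17]
    Z_prod[of 3 0 2 0 0 1 18]
    Z_prod[of 3 0 1 1 0 1 19]
    Z_prod[of 3 0 1 0 1 1 20]
  by (simp_all add: std_mono_xmono)

text \<open>
  The parameters \<open>a 0, ..., a 9\<close> are the coefficients \<open>d\<^bsub>15,2\<^esub>\<close>, \<open>d\<^bsub>15,3\<^esub>\<close>, \<open>c\<^bsub>12,4\<^esub>\<close>, \<open>d\<^bsub>15,4\<^esub>\<close>, \<open>d\<^bsub>15,5\<^esub>\<close>,
  \<open>c\<^bsub>12,6\<^esub>\<close>, \<open>d\<^bsub>15,7\<^esub>\<close>, \<open>d\<^bsub>15,8\<^esub>\<close>, \<open>d\<^bsub>15,9\<^esub>\<close>, \<open>d\<^bsub>15,10\<^esub>\<close>. The values are read off from the normal forms of the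
  initial forms modulo the Pfaffians \<open>pf a i\<close> below.
\<close>

definition family :: "(nat \<Rightarrow> 'a::comm_ring_1) \<Rightarrow> nat \<times> nat \<Rightarrow> 'a" where
  "family a = (\<lambda>(i, j).
    if i = 12 then
      (if j = 4 then a 2
       else if j = 6 then a 5
       else if j = 12 then a 2 * a 7 else 0)
    else if i = 13 then
      (if j = 7 then - a 6
       else if j = 13 then - (a 2 * a 8) else 0)
    else if i = 14 then
      (if j = 4 then - a 2
       else if j = 6 then a 2 * a 0 - a 5
       else if j = 7 then a 2 * a 1 - a 6
       else if j = 8 then a 2 * a 3
       else if j = 9 then a 2 * a 4
       else if j = 14 then a 2 * a 9 else 0)
    else if i = 15 then
      (if j = 2 then a 0
       else if j = 3 then a 1
       else if j = 4 then a 3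
       else if j = 5 then a 4
       else if j = 7 then a 6
       else if j = 8 then a 7
       else if j = 9 then a 8
       else if j = 10 then a 9
       else if j = 15 then a 6 * a 7 - a 8 * a 5 else 0)
    else if i = 16 then
      (if j = 2 then a 0
       else if j = 3 then a 1
       else if j = 4 then a 3
       else if j = 5 then a 4
       else if j = 8 then a 7 + a 2 * a 3
       else if j = 9 then a 8
       else if j = 10 then a 9 - a 1 * a 6 + a 3 * a 5
       else if j = 16 then a 2 * a 3 * a 7 - a 2 * a 1 * a 8 else 0)
    else if i = 18 then
      (if j = 4 then a 2
       else if j = 6 then a 5
       else if j = 7 then - a 6
       else if j = 10 then a 2 * a 5
       else if j = 12 then a 2 * a 7 + a 5 * a 5
       else if j = 13 then - (a 2 * a 8)
       else if j = 18 then a 2 * a 5 * a 7 else 0)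
    else if i = 21 then
      (if j = 4 then - a 2
       else if j = 6 then a 2 * a 0 - a 5
       else if j = 7 then a 2 * a 1 - a 6 - a 6
       else if j = 8 then a 2 * a 3
       else if j = 9 then a 2 * a 4
       else if j = 11 then (a 6 - a 2 * a 1) * a 2
       else if j = 13 then (a 6 - a 2 * a 1) * a 5 - (a 6 - a 2 * a 1) * a 2 * a 0 - a 2 * a 8
       else if j = 14 then a 2 * a 9 + (a 6 - a 2 * a 1) * (a 6 - a 2 * a 1)
       else if j = 15 then - (a 2 * a 3 * ((a 6 - a 2 * a 1) + a 6))
       else if j = 16 then - ((a 6 - a 2 * a 1) * a 2 * a 4)
       else if j = 21 then - ((a 6 - a 2 * a 1) * a 2 * a 9 + a 2 * a 2 * a 3 * a 8) else 0)
    else 0)"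

text \<open>
  With \<open>q = a 2\<close>, these are the Pfaffians of the skew-symmetric matrix whose entries above the diagonal
  are, row by row, \<open>C\<^sub>3, C\<^sub>2, X\<^sub>5, X\<^sub>6\<close>, then \<open>X\<^sub>5\<^sup>2 - C\<^sub>1, A\<^sub>2, X\<^sub>7\<close>, then \<open>A\<^sub>3, X\<^sub>8\<close>, then \<open>q\<close>.
\<close>

definition pfA2 :: "(nat \<Rightarrow> 'a::comm_ring_1) \<Rightarrow> (nat, 'a) mpoly" where
  "pfA2 a = Var 6 - Const (a 5) * Var 0"

definition pfA3 :: "(nat \<Rightarrow> 'a::comm_ring_1) \<Rightarrow> (nat, 'a) mpoly" where
  "pfA3 a = Var 7 + Const (a 6) * Var 0"

definition pfC1 :: "(nat \<Rightarrow> 'a::comm_ring_1) \<Rightarrow> (nat, 'a) mpoly" where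
  "pfC1 a = Const (a 0) * Var 0 * Var 8 + Const (a 1) * Var 0 * Var 7 + Const (a 3) * Var 0 * Var 6
     + Const (a 4) * Var 0 * Var 5 + Const (a 9) * Var 0 ^ 2"

definition pfC2 :: "(nat \<Rightarrow> 'a::comm_ring_1) \<Rightarrow> (nat, 'a) mpoly" where
  "pfC2 a = Const (a 8) * Var 0 ^ 2"

definition pfC3 :: "(nat \<Rightarrow> 'a::comm_ring_1) \<Rightarrow> (nat, 'a) mpoly" where
  "pfC3 a = - Var 0 * Var 8 - Const (a 7) * Var 0 ^ 2"

definition pf :: "(nat \<Rightarrow> 'a::comm_ring_1) \<Rightarrow> nat \<Rightarrow> (nat, 'a) mpoly" where
  "pf a i =
    (if i = 12 then pfA2 a * Var 6 - Var 5 * Var 7 + Const (a 2) * pfC3 a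
     else if i = 13 then pfA3 a * Var 6 - Var 5 * Var 8 + Const (a 2) * pfC2 a
     else if i = 14 then pfA3 a * Var 7 - pfA2 a * Var 8 + Const (a 2) * (Var 5 ^ 2 - pfC1 a)
     else if i = 15 then pfC3 a * pfA3 a - pfC2 a * pfA2 a + Var 5 * (Var 5 ^ 2 - pfC1 a)
     else pfC3 a * Var 8 - pfC2 a * Var 7 + Var 6 * (Var 5 ^ 2 - pfC1 a))"

text \<open>A skew-symmetric matrix of odd size annihilates the vector of its signed submaximal
  Pfaffians. These are its five rows, each solved for the difference that forms an S-pair.\<close>

lemma pf_relations:
  "Var 7 * pf a 12 - Var 6 * pf a 13 = Const (a 2) * pf a 15 - Var 5 * pf a 14
     - Const (a 6) * Var 0 * pf a 12 - Const (a 5) * Var 0 * pf a 13"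
  "Var 7 * pf a 13 - Var 6 * pf a 14 = Var 8 * pf a 12 - Const (a 2) * pf a 16"
  "Var 6 * pf a 15 - Var 5 * pf a 16 = pfC3 a * pf a 13 - pfC2 a * pf a 12"
  "Var 5 ^ 2 * pf a 12 - Var 6 * pf a 16 = pfC3 a * pf a 14 + pfC1 a * pf a 12 - Var 7 * pf a 15
     - Const (a 5) * Var 0 * pf a 16"
  "Var 5 ^ 2 * pf a 13 - Var 7 * pf a 16 = pfC2 a * pf a 14 + pfC1 a * pf a 13 - Var 8 * pf a 15
     + Const (a 6) * Var 0 * pf a 16"
  by (simp_all add: pf_def pfA2_def pfA3_def power2_eq_square algebra_simps)

text \<open>The correction terms remove nonstandard monomials. For example, X_6 times C_1 in
  \<open>pf a 16\<close> contains X_0 X_6 X_7 and X_0 X_6^2, which multiples of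
  \<open>pf a 13\<close> and \<open>pf a 12\<close> cancel. The expressions for 18 and 21 show that
  these two forms add nothing to the ideal of the Pfaffians.\<close>

lemma spec_family_forms:
  fixes a :: "nat \<Rightarrow> 'a::comm_ring_1"
  shows "spec (family a) (form 12) = pf a 12"
    and "spec (family a) (form 13) = pf a 13"
    and "spec (family a) (form 14) = pf a 14"
    and "spec (family a) (form 15) = pf a 15"
    and "spec (family a) (form 16) = pf a 16 + Const (a 1) * Var 0 * pf a 13 + Const (a 3) * Var 0 * pf a 12"
    and "spec (family a) (form 18) = Var 6 * pf a 12 + Var 5 * pf a 13 + Const (a 5) * Var 0 * pf a 12"
    and "spec (family a) (form 21) = Var 7 * pf a 14 + Var 8 * pf a 13
      - Const (a 6 - a 2 * a 1) * Var 0 * pf a 14 + Const (a 2 * a 3) * Var 0 * pf a 13"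
  by (simp_all add: spec_form coeff_index_fibres family_def form_degree_def Z_values initial_form_def
      pf_def pfA2_def pfA3_def pfC1_def pfC2_def pfC3_def Const_mult Const_add Const_diff Const_uminus
      Const_numeral algebra_simps power2_eq_square power3_eq_cube)

section \<open>Leading terms of the Pfaffians\<close>

definition tau_le :: "nat \<Rightarrow> (nat, 'a::comm_ring_1) mpoly \<Rightarrow> bool" where
  "tau_le n p \<longleftrightarrow> (\<forall>k \<in> keys p. mono_weight tau k \<le> n)"

lemma tau_le_weaken: "tau_le m p \<Longrightarrow> m \<le> n \<Longrightarrow> tau_le n p"
  by (fastforce simp: tau_le_def)

lemma tau_le_Var: "tau_le (tau v) (Var v)"
  by (simp add: tau_le_def Var_def)

lemma tau_le_Const: "tau_le 0 (Const c)"
  by (simp add: tau_le_def Const_def)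

lemma tau_le_uminus: "tau_le n p \<Longrightarrow> tau_le n (- p)"
  by (simp add: tau_le_def keys_minus)

lemma tau_le_add: "tau_le m p \<Longrightarrow> tau_le n q \<Longrightarrow> tau_le (max m n) (p + q)"
  using keys_add[of p q] unfolding tau_le_def by (fastforce simp: le_max_iff_disj)

lemma tau_le_diff: "tau_le m p \<Longrightarrow> tau_le n q \<Longrightarrow> tau_le (max m n) (p - q)"
  using tau_le_add[OF _ tau_le_uminus] by force

lemma tau_le_mult: "tau_le m p \<Longrightarrow> tau_le n q \<Longrightarrow> tau_le (m + n) (p * q)"
  unfolding tau_le_def by (auto elim!: keys_multE intro!: add_mono)

lemma tau_le_power2: "tau_le m p \<Longrightarrow> tau_le (m + m) (p ^ 2)"
  by (simp add: power2_eq_square tau_le_mult)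

lemmas tau_le_intros = tau_le_Var tau_le_Const tau_le_uminus tau_le_add tau_le_diff tau_le_mult
  tau_le_power2

definition pf_tail :: "(nat \<Rightarrow> 'a::comm_ring_1) \<Rightarrow> nat \<Rightarrow> (nat, 'a) mpoly" where
  "pf_tail a i =
    (if i = 12 then Const (a 2) * pfC3 a - Var 5 * Var 7 - Const (a 5) * Var 0 * Var 6
     else if i = 13 then Const (a 2) * pfC2 a - Var 5 * Var 8 + Const (a 6) * Var 0 * Var 6
     else if i = 14 then Const (a 2) * (Var 5 ^ 2 - pfC1 a) - pfA2 a * Var 8 + Const (a 6) * Var 0 * Var 7
     else if i = 15 then pfC3 a * pfA3 a - pfC2 a * pfA2 a - Var 5 * pfC1 a
     else pfC3 a * Var 8 - pfC2 a * Var 7 - Var 6 * pfC1 a)"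

lemma single_lead_mono:
  "single (lead_mono 12) 1 = Var 6 ^ 2" "single (lead_mono 13) 1 = Var 6 * Var 7"
  "single (lead_mono 14) 1 = Var 7 ^ 2" "single (lead_mono 15) 1 = Var 5 ^ 3"
  "single (lead_mono 16) 1 = Var 5 ^ 2 * Var 6"
  unfolding lead_mono_def xmono_def Var_power by (simp_all add: Var_def mult_single)

lemma pf_tail:
  assumes "i \<in> lead_weights"
  shows "pf a i = single (lead_mono i) 1 + pf_tail a i"
  using assms
  by (auto simp: lead_weights_def pf_def pf_tail_def single_lead_mono pfA2_def pfA3_def
      power2_eq_square power3_eq_cube algebra_simps)

lemma tau_lead_mono:
  "mono_weight tau (lead_mono 12) = 126" "mono_weight tau (lead_mono 13) = 135"
  "mono_weight tau (lead_mono 14) = 144" "mono_weight tau (lead_mono 15) = 156"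
  "mono_weight tau (lead_mono 16) = 167"
  by (simp_all add: lead_mono_def mono_weight_xmono tau_def)

lemma tau_le_entries:
  "tau_le 63 (pfA2 a)" "tau_le 72 (pfA3 a)" "tau_le 80 (pfC1 a)" "tau_le 0 (pfC2 a)" "tau_le 80 (pfC3 a)"
  unfolding pfA2_def pfA3_def pfC1_def pfC2_def pfC3_def
  by (rule tau_le_weaken, (rule tau_le_intros)+, simp add: tau_def)+

lemma tau_le_pf_tail:
  assumes "i \<in> lead_weights"
  shows "tau_le (mono_weight tau (lead_mono i) - 1) (pf_tail a i)"
proof -
  have "tau_le 125 (pf_tail a 12)" "tau_le 134 (pf_tail a 13)" "tau_le 143 (pf_tail a 14)"
    "tau_le 155 (pf_tail a 15)" "tau_le 166 (pf_tail a 16)"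
    unfolding pf_tail_def
    by (simp, rule tau_le_weaken, (rule tau_le_intros tau_le_entries)+, simp add: tau_def)+
  then show ?thesis using assms by (auto simp: lead_weights_def tau_lead_mono)
qed

abbreviation pf_low :: "(nat \<Rightarrow> 'a::comm_ring_1) \<Rightarrow> nat \<Rightarrow> (nat, 'a) mpoly \<Rightarrow> bool" where
  "pf_low a \<equiv> low_comb tau lead_weights (pf a) lead_mono"

lemma pf_low_mult:
  assumes "tau_le d p" "i \<in> lead_weights" "d + mono_weight tau (lead_mono i) < n"
  shows "pf_low a n (p * pf a i)"
  using assms by (intro low_comb_mult_gen) (fastforce simp: tau_le_def)+

lemma pf_low_mult':
  assumes "tau_le d p" "d + 126 < n \<or> i \<noteq> 12" "d + 135 < n \<or> i \<noteq> 13" "d + 144 < n \<or> i \<noteq> 14"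
    "d + 156 < n \<or> i \<noteq> 15" "d + 167 < n \<or> i \<noteq> 16" "i \<in> {12, 13, 14, 15, 16}"
  shows "pf_low a n (p * pf a i)"
  using assms by (intro pf_low_mult[OF assms(1)]) (auto simp: lead_weights_def tau_lead_mono)

section \<open>S-pairs of the Pfaffians\<close>

definition adds_mono :: "('v \<Rightarrow>\<^sub>0 nat) \<Rightarrow> ('v \<Rightarrow>\<^sub>0 nat) \<Rightarrow> bool" where
  "adds_mono e m \<longleftrightarrow> (\<exists>K. m = K + e)"

lemma adds_mono_iff: "adds_mono e m \<longleftrightarrow> (\<forall>v. lookup e v \<le> lookup m v)"
proof
  assume "\<forall>v. lookup e v \<le> lookup m v"
  then have "m = (m - e) + e"
    by (intro poly_mapping_eqI) (simp add: lookup_add lookup_minus)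
  then show "adds_mono e m" unfolding adds_mono_def by blast
qed (auto simp: adds_mono_def lookup_add)

lemma adds_xmono:
  "adds_mono (xmono a b c d e) m \<longleftrightarrow> a \<le> lookup m 0 \<and> b \<le> lookup m 5 \<and>
     c \<le> lookup m 6 \<and> d \<le> lookup m 7 \<and> e \<le> lookup m 8"
proof
  assume "adds_mono (xmono a b c d e) m"
  then have "lookup (xmono a b c d e) v \<le> lookup m v" for v
    by (simp add: adds_mono_iff)
  from this[of 0] this[of 5] this[of 6] this[of 7] this[of 8]
  show "a \<le> lookup m 0 \<and> b \<le> lookup m 5 \<and>
     c \<le> lookup m 6 \<and> d \<le> lookup m 7 \<and> e \<le> lookup m 8"
    by (simp add: lookup_xmono)
qed (simp add: adds_mono_iff lookup_xmono)

text \<open>Meaningful if \<open>lead_mono i\<close> divides \<open>m\<close>; then the product has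
  leading monomial \<open>m\<close>. Otherwise the subtraction of exponents is truncated.\<close>

definition pf_mult :: "(nat \<Rightarrow> 'a::comm_ring_1) \<Rightarrow> nat \<Rightarrow> (nat \<Rightarrow>\<^sub>0 nat) \<Rightarrow> (nat, 'a) mpoly" where
  "pf_mult a i m = single (m - lead_mono i) 1 * pf a i"

abbreviation pf_equiv :: "(nat \<Rightarrow> 'a::comm_ring_1) \<Rightarrow> nat \<Rightarrow> nat \<Rightarrow> (nat \<Rightarrow>\<^sub>0 nat) \<Rightarrow> bool" where
  "pf_equiv a i j m \<equiv> pf_low a (mono_weight tau m) (pf_mult a i m - pf_mult a j m)"

lemma pf_mult_pair:
  assumes low: "pf_low a (mono_weight tau l)
      (single u 1 * pf a i - single v 1 * pf a j)"
    and l: "l = u + lead_mono i" "l = v + lead_mono j" and m: "adds_mono l m"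
  shows "pf_equiv a i j m"
proof -
  obtain K where K: "m = K + l" using m by (auto simp: adds_mono_def)
  have "m = (K + u) + lead_mono i" "m = (K + v) + lead_mono j"
    using l by (simp_all add: K add.assoc)
  then have uv: "m - lead_mono i = K + u" "m - lead_mono j = K + v"
    by (metis add_diff_cancel_right')+
  have "pf_mult a i m - pf_mult a j m = single K 1 *
      (single u 1 * pf a i - single v 1 * pf a j)"
    by (simp add: pf_mult_def uv right_diff_distrib mult_single flip: mult.assoc)
  then show ?thesis
    using low_comb_single_mult[OF low, of K 1] by (simp add: K)
qed

text \<open>Five of the pairs come from the rows of the Pfaffian matrix, the last from coprimality
  of the leading monomials. The remaining pairs are covered by the choice made in
  \<open>pf_select\<close>.\<close>

lemma pf_mult_pairs:
  fixes a :: "nat \<Rightarrow> 'a::comm_ring_1"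
  shows "adds_mono (xmono 0 0 2 1 0) m \<Longrightarrow> pf_equiv a 12 13 m"
    and "adds_mono (xmono 0 0 1 2 0) m \<Longrightarrow> pf_equiv a 13 14 m"
    and "adds_mono (xmono 0 3 1 0 0) m \<Longrightarrow> pf_equiv a 15 16 m"
    and "adds_mono (xmono 0 2 2 0 0) m \<Longrightarrow> pf_equiv a 12 16 m"
    and "adds_mono (xmono 0 2 1 1 0) m \<Longrightarrow> pf_equiv a 13 16 m"
    and "adds_mono (xmono 0 3 0 2 0) m \<Longrightarrow> pf_equiv a 15 14 m"
proof -
  note lc = low_comb.add low_comb_diff
  note bounds = tau_le_intros tau_le_entries
  have pows: "single (xmono 0 1 0 0 0) 1 = (Var 5 :: (nat, 'a) mpoly)"
    "single (xmono 0 0 1 0 0) 1 = (Var 6 :: (nat, 'a) mpoly)"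
    "single (xmono 0 0 0 1 0) 1 = (Var 7 :: (nat, 'a) mpoly)"
    "single (xmono 0 2 0 0 0) 1 = (Var 5 ^ 2 :: (nat, 'a) mpoly)"
    "single (xmono 0 0 0 2 0) 1 = (Var 7 ^ 2 :: (nat, 'a) mpoly)"
    "single (xmono 0 3 0 0 0) 1 = (Var 5 ^ 3 :: (nat, 'a) mpoly)"
    by (rule Var_xmono[symmetric] Var_power_xmono[symmetric])+
  \<comment> \<open>198 is \<open>tau\<close> of the least common multiple X_6^2 X_7 of the two
    leading monomials; the bounds 207, 219, 230, 239 and 300 arise in the same way.\<close>
  have "pf_low a 198 (Var 7 * pf a 12 - Var 6 * pf a 13)"
    unfolding pf_relations by (intro lc; rule pf_low_mult', (rule bounds)+; simp add: tau_def)
  then show "adds_mono (xmono 0 0 2 1 0) m \<Longrightarrow> pf_equiv a 12 13 m"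
    by (intro pf_mult_pair[where u = "xmono 0 0 0 1 0" and v = "xmono 0 0 1 0 0"])
      (simp_all only: pows, simp_all add: lead_mono_def xmono_add mono_weight_xmono tau_def xmono_eq_iff)
  have "pf_low a 207 (Var 7 * pf a 13 - Var 6 * pf a 14)"
    unfolding pf_relations by (intro lc; rule pf_low_mult', (rule bounds)+; simp add: tau_def)
  then show "adds_mono (xmono 0 0 1 2 0) m \<Longrightarrow> pf_equiv a 13 14 m"
    by (intro pf_mult_pair[where u = "xmono 0 0 0 1 0" and v = "xmono 0 0 1 0 0"])
      (simp_all only: pows, simp_all add: lead_mono_def xmono_add mono_weight_xmono tau_def xmono_eq_iff)
  have "pf_low a 219 (Var 6 * pf a 15 - Var 5 * pf a 16)"
    unfolding pf_relations by (intro lc; rule pf_low_mult', (rule bounds)+; simp add: tau_def)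
  then show "adds_mono (xmono 0 3 1 0 0) m \<Longrightarrow> pf_equiv a 15 16 m"
    by (intro pf_mult_pair[where u = "xmono 0 0 1 0 0" and v = "xmono 0 1 0 0 0"])
      (simp_all only: pows, simp_all add: lead_mono_def xmono_add mono_weight_xmono tau_def xmono_eq_iff)
  have "pf_low a 230 (Var 5 ^ 2 * pf a 12 - Var 6 * pf a 16)"
    unfolding pf_relations by (intro lc; rule pf_low_mult', (rule bounds)+; simp add: tau_def)
  then show "adds_mono (xmono 0 2 2 0 0) m \<Longrightarrow> pf_equiv a 12 16 m"
    by (intro pf_mult_pair[where u = "xmono 0 2 0 0 0" and v = "xmono 0 0 1 0 0"])
      (simp_all only: pows, simp_all add: lead_mono_def xmono_add mono_weight_xmono tau_def xmono_eq_iff)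
  have "pf_low a 239 (Var 5 ^ 2 * pf a 13 - Var 7 * pf a 16)"
    unfolding pf_relations by (intro lc; rule pf_low_mult', (rule bounds)+; simp add: tau_def)
  then show "adds_mono (xmono 0 2 1 1 0) m \<Longrightarrow> pf_equiv a 13 16 m"
    by (intro pf_mult_pair[where u = "xmono 0 2 0 0 0" and v = "xmono 0 0 0 1 0"])
      (simp_all only: pows, simp_all add: lead_mono_def xmono_add mono_weight_xmono tau_def xmono_eq_iff)
  \<comment> \<open>Each leading monomial is its Pfaffian minus the tail, and the two products of
    the Pfaffians cancel. This is Buchberger's product criterion.\<close>
  have "Var 7 ^ 2 * pf a 15 - Var 5 ^ 3 * pf a 14 = pf_tail a 15 * pf a 14 - pf_tail a 14 * pf a 15"
    using pf_tail[of 14 a] pf_tail[of 15 a]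
    by (simp add: lead_weights_def single_lead_mono algebra_simps)
  moreover have "pf_low a 300 (pf_tail a 15 * pf a 14 - pf_tail a 14 * pf a 15)"
    using tau_le_pf_tail[of 14 a] tau_le_pf_tail[of 15 a]
    by (intro lc pf_low_mult) (auto simp: lead_weights_def tau_lead_mono)
  ultimately have "pf_low a 300 (Var 7 ^ 2 * pf a 15 - Var 5 ^ 3 * pf a 14)" by simp
  then show "adds_mono (xmono 0 3 0 2 0) m \<Longrightarrow> pf_equiv a 15 14 m"
    by (intro pf_mult_pair[where u = "xmono 0 0 0 2 0" and v = "xmono 0 3 0 0 0"])
      (simp_all only: pows, simp_all add: lead_mono_def xmono_add mono_weight_xmono tau_def xmono_eq_iff)
qed

text \<open>The priority exploits divisibility: X_6 together with X_7 gives X_6 X_7, and X_5^3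
  together with X_6 gives X_5^2 X_6. So each Pfaffian is compared with the selected one through one
  of the six pairs, except that 15 reaches 13 through 16.\<close>

definition pf_select :: "(nat \<Rightarrow>\<^sub>0 nat) \<Rightarrow> nat" where
  "pf_select m = (if adds_mono (lead_mono 13) m then 13 else if adds_mono (lead_mono 16) m then 16
     else if adds_mono (lead_mono 12) m then 12 else if adds_mono (lead_mono 14) m then 14 else 15)"

lemma pf_low_chain: "pf_low a n (p - q) \<Longrightarrow> pf_low a n (q - r) \<Longrightarrow> pf_low a n (p - r)"
  using low_comb.add[of tau lead_weights "pf a" lead_mono n "p - q" "q - r"] by simp

lemma pf_low_swap: "pf_low a n (p - q) \<Longrightarrow> pf_low a n (q - p)"
  using low_comb_uminus[of tau lead_weights "pf a" lead_mono n "p - q"] by simp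

lemma pf_mult_select:
  fixes a :: "nat \<Rightarrow> 'a::comm_ring_1"
  assumes i: "i \<in> lead_weights" and m: "adds_mono (lead_mono i) m"
  shows "pf_equiv a i (pf_select m) m"
proof -
  note adds = adds_xmono lead_mono_def
  note p = pf_mult_pairs[of m a]
  have zero: "pf_low a n (x - x)" for n x by (simp add: low_comb.zero)
  consider "i = 12" | "i = 13" | "i = 14" | "i = 15" | "i = 16" using i by (auto simp: lead_weights_def)
  then show ?thesis
  proof cases
    case 1
    show ?thesis using m p(1,4) zero unfolding 1 pf_select_def by (auto simp: adds)
  next
    case 2
    show ?thesis using m zero unfolding 2 pf_select_def by (auto simp: adds)
  next
    case 3
    show ?thesis using m pf_low_swap[OF p(2)] zero unfolding 3 pf_select_def by (auto simp: adds)
  next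
    case 4
    show ?thesis
      using m pf_low_chain[OF p(3) pf_low_swap[OF p(5)]] p(3,6) zero
      unfolding 4 pf_select_def by (auto simp: adds)
  next
    case 5
    show ?thesis using m pf_low_swap[OF p(5)] zero unfolding 5 pf_select_def by (auto simp: adds)
  qed
qed

lemma liftable_pairs_pf:
  "liftable_pairs tau lead_weights (pf a) lead_mono (\<lambda>m. pf_mult a (pf_select m) m)"
proof
  fix i k assume i: "i \<in> lead_weights" and "k \<in> keys (pf a i - single (lead_mono i) 1)"
  then have "mono_weight tau k \<le> mono_weight tau (lead_mono i) - 1"
    using tau_le_pf_tail[OF i, of a] by (simp add: pf_tail tau_le_def)
  then show "mono_weight tau k < mono_weight tau (lead_mono i)"
    using lead_mono_facts(6)[OF i] by linarith
next
  fix i M assume i: "i \<in> lead_weights"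
  have "adds_mono (lead_mono i) (M + lead_mono i)" unfolding adds_mono_def by blast
  from pf_mult_select[OF i this, of a] show "pf_low a (mono_weight tau (M + lead_mono i))
      (single M 1 * pf a i - pf_mult a (pf_select (M + lead_mono i)) (M + lead_mono i))"
    by (simp add: pf_mult_def)
qed

section \<open>The Pfaffian ideal and the remainders on the family\<close>

definition pf_ideal :: "(nat \<Rightarrow> 'a::comm_ring_1) \<Rightarrow> (nat, 'a) mpoly set" where
  "pf_ideal a = {p. \<exists>n. pf_low a n p}"

lemma pf_ideal_add: "p \<in> pf_ideal a \<Longrightarrow> q \<in> pf_ideal a \<Longrightarrow> p + q \<in> pf_ideal a"
proof -
  assume "p \<in> pf_ideal a" "q \<in> pf_ideal a"
  then obtain n n' where "pf_low a n p" "pf_low a n' q" by (auto simp: pf_ideal_def)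
  then have "pf_low a (max n n') p" "pf_low a (max n n') q" by (auto elim: low_comb_mono)
  then show ?thesis unfolding pf_ideal_def using low_comb.add by blast
qed

lemma pf_ideal_uminus: "p \<in> pf_ideal a \<Longrightarrow> - p \<in> pf_ideal a"
  unfolding pf_ideal_def using low_comb_uminus by blast

lemma pf_ideal_diff: "p \<in> pf_ideal a \<Longrightarrow> q \<in> pf_ideal a \<Longrightarrow> p - q \<in> pf_ideal a"
  using pf_ideal_add[OF _ pf_ideal_uminus, of p a q] by simp

lemma pf_ideal_mult: "p \<in> pf_ideal a \<Longrightarrow> q * p \<in> pf_ideal a"
proof (induction q rule: poly_mapping_induct)
  case zero
  have "pf_low a 0 0" by (rule low_comb.zero)
  then show ?case by (auto simp: pf_ideal_def)
next
  case (single m c)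
  then obtain n where "pf_low a n p" by (auto simp: pf_ideal_def)
  from low_comb_single_mult[OF this] show ?case by (auto simp: pf_ideal_def)
next
  case (add q r)
  then show ?case by (simp add: distrib_right pf_ideal_add)
qed

lemma pf_in_ideal: "i \<in> lead_weights \<Longrightarrow> pf a i \<in> pf_ideal a"
  using low_comb_ex[of i lead_weights tau "pf a" lead_mono 1] by (simp add: pf_ideal_def)

lemma pf_ideal_standard:
  assumes "p \<in> pf_ideal a" "\<And>m. m \<in> keys p \<Longrightarrow> std_mono m"
  shows "p = 0"
proof -
  interpret liftable_pairs tau lead_weights "pf a" lead_mono "\<lambda>m. pf_mult a (pf_select m) m"
    by (rule liftable_pairs_pf)
  obtain n where n: "pf_low a n p" using assms(1) by (auto simp: pf_ideal_def)
  show ?thesis using assms(2) std_mono_not_lead by (intro low_comb_standard_eq_0[OF n]) blast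
qed

lemma spec_family_form_in_ideal:
  assumes "i \<in> form_weights"
  shows "spec (family a) (form i) \<in> pf_ideal a"
proof -
  have m: "pf a 12 \<in> pf_ideal a" "pf a 13 \<in> pf_ideal a" "pf a 14 \<in> pf_ideal a"
    "pf a 15 \<in> pf_ideal a" "pf a 16 \<in> pf_ideal a"
    by (rule pf_in_ideal, simp add: lead_weights_def)+
  from assms show ?thesis
    unfolding form_weights_def
    by (elim insertE emptyE; simp only: spec_family_forms;
        intro pf_ideal_add pf_ideal_diff pf_ideal_mult m)
qed

text \<open>The specialized syzygy lies in the Pfaffian ideal and every division step stays in it,
  so the remainder lies in it too. Since it is supported on standard monomials, it vanishes.\<close>

lemma family_in_moduli_cone:
  fixes R :: "nat \<Rightarrow> 'a::field family_poly"
  assumes R: "syzygy_remainders R"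
  shows "family a \<in> cone_set (moduli_cone R)"
  unfolding mem_moduli_cone
proof (intro conjI allI impI ballI)
  fix ij :: "nat \<times> nat" assume ij: "ij \<notin> coeff_index"
  obtain i j where ij_eq: "ij = (i, j)" by (cases ij)
  consider "i = 12" | "i = 13" | "i = 14" | "i = 15" | "i = 16" | "i = 18" | "i = 21"
    | "i \<notin> {12, 13, 14, 15, 16, 18, 21}" by blast
  then show "family a ij = 0"
    by cases (use ij in \<open>simp_all add: ij_eq family_def coeff_index_iff\<close>)
next
  fix w assume w: "w \<in> syzygy_weights"
  have "spec (family a) (syzygy w form) \<in> pf_ideal a"
    using w unfolding syzygy_weights_def syzygy_def
    by (elim insertE emptyE; simp add: spec_simps;
        intro pf_ideal_add pf_ideal_diff pf_ideal_mult spec_family_form_in_ideal;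
        simp add: form_weights_def)
  moreover have "spec (family a) q \<in> pf_ideal a"
    if "(division_step (syzygy_degree w) w)\<^sup>*\<^sup>* p q" "spec (family a) p \<in> pf_ideal a"
    for p q :: "'a family_poly"
    using that
  proof induction
    case (step y z)
    then obtain i H where "i \<in> form_weights" "z = y - H * form i"
      unfolding division_step_def by blast
    then show ?case
      using step spec_family_form_in_ideal[of i a]
      by (simp add: spec_simps pf_ideal_diff pf_ideal_mult)
  qed
  ultimately have "spec (family a) (R w) \<in> pf_ideal a"
    using R w by (auto simp: syzygy_remainders_def)
  moreover have "std_mono m" if "m \<in> keys (spec (family a) (R w))" for m
  proof -
    have "m \<in> basis_monos (syzygy_degree w)"
      using that keys_spec[of "family a" "R w"] R w by (auto simp: syzygy_remainders_def Lambda_def)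
    then show ?thesis by (rule basis_monos_std[rotated]) (simp add: syzygy_degree_def)
  qed
  ultimately show "spec (family a) (R w) = 0" by (rule pf_ideal_standard)
qed

section \<open>The moduli cone is an affine space\<close>

definition param_weight :: "nat \<Rightarrow> nat" where
  "param_weight = (\<lambda>i. [2, 3, 4, 4, 5, 6, 7, 8, 9, 10] ! i)"

definition pivot :: "nat \<Rightarrow> nat \<times> nat" where
  "pivot i = [(15,2), (15,3), (12,4), (15,4), (15,5), (12,6), (15,7), (15,8), (15,9), (15,10)] ! i"

abbreviation param_cone :: "(nat \<Rightarrow> 'a::comm_ring_1, 'a) quasi_cone" where
  "param_cone \<equiv> affine_cone {..<10} param_weight"

lemma less_10_cases:
  assumes "i < (10::nat)"
  shows "i \<in> {0, 1, 2, 3, 4, 5, 6, 7, 8, 9}"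
  using assms by (simp add: lessThan_nat_numeral lessThan_Suc flip: lessThan_iff) blast

lemma pivot_facts:
  assumes "i < 10"
  shows "pivot i \<in> coeff_index" "snd (pivot i) = param_weight i" "family a (pivot i) = a i"
  using less_10_cases[OF assms]
  by (auto simp: pivot_def param_weight_def coeff_index_iff family_def)

lemma pivots_pivot: "ij \<in> pivots \<Longrightarrow> \<exists>i<10. ij = pivot i"
proof -
  assume "ij \<in> pivots"
  also have "pivots = pivot ` {0, 1, 2, 3, 4, 5, 6, 7, 8, 9}"
    by (simp add: pivots_def pivot_def insert_commute)
  finally obtain i where "i \<in> {0, 1, 2, 3, 4, 5, 6, 7, 8, 9}" "ij = pivot i" by blast
  then show ?thesis by (intro exI[of _ i]) auto
qed

lemma qhom_mult_eq: "qhom L d f \<Longrightarrow> qhom L e g \<Longrightarrow> d + e = n \<Longrightarrow> qhom L n (\<lambda>x. f x * g x)"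
  using qhom.mult by blast

lemma qhom_uminus: "qhom L d f \<Longrightarrow> qhom L d (\<lambda>x. - f x)"
  using qhom.mult[OF qhom.const[of L "-1"], of d f] by simp

lemma qhom_diff: "qhom L d f \<Longrightarrow> qhom L d g \<Longrightarrow> qhom L d (\<lambda>x. f x - g x)"
  using qhom.add[OF _ qhom_uminus, of L d f g] by simp

lemma qhom_param: "i < 10 \<Longrightarrow> param_weight i = n \<Longrightarrow> qhom (cone_coords param_cone) n (\<lambda>a. a i)"
  by (rule qhom.coord) (auto simp: affine_cone_def)

lemma qhom_family:
  assumes "(i, j) \<in> coeff_index"
  shows "qhom (cone_coords param_cone) j (\<lambda>a. family a (i, j))"
proof -
  note rules = qhom_param qhom.zero qhom.const qhom_mult_eq qhom_uminus qhom_diff qhom.add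
  consider "i = 12" | "i = 13" | "i = 14" | "i = 15" | "i = 16" | "i = 18" | "i = 21"
    using coeff_index_form_weights[OF assms] by (auto simp: form_weights_def)
  then show ?thesis
  proof cases
    case 1
    then have "j \<in> {4,5,6,12}" using assms by (simp add: coeff_index_iff)
    then show ?thesis unfolding 1
      by (elim insertE emptyE)
        (simp_all add: family_def, (rule rules refl | simp add: param_weight_def; fail)+)
  next
    case 2
    then have "j \<in> {5,6,7,13}" using assms by (simp add: coeff_index_iff)
    then show ?thesis unfolding 2
      by (elim insertE emptyE)
        (simp_all add: family_def, (rule rules refl | simp add: param_weight_def; fail)+)
  next
    case 3
    then have "j \<in> {1,2,3,4,6,7,8,9,14}" using assms by (simp add: coeff_index_iff)
    then show ?thesis unfolding 3
      by (elim insertE emptyE)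
        (simp_all add: family_def, (rule rules refl | simp add: param_weight_def; fail)+)
  next
    case 4
    then have "j \<in> {1,2,3,4,5,7,8,9,10,15}" using assms by (simp add: coeff_index_iff)
    then show ?thesis unfolding 4
      by (elim insertE emptyE)
        (simp_all add: family_def, (rule rules refl | simp add: param_weight_def; fail)+)
  next
    case 5
    then have "j \<in> {2,3,4,5,8,9,10,11,16}" using assms by (simp add: coeff_index_iff)
    then show ?thesis unfolding 5
      by (elim insertE emptyE)
        (simp_all add: family_def, (rule rules refl | simp add: param_weight_def; fail)+)
  next
    case 6
    then have "j \<in> {1,2,3,4,5,6,7,8,10,11,12,13,18}" using assms by (simp add: coeff_index_iff)
    then show ?thesis unfolding 6
      by (elim insertE emptyE)
        (simp_all add: family_def, (rule rules refl | simp add: param_weight_def; fail)+)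
  next
    case 7
    then have "j \<in> {1,2,3,4,6,7,8,9,10,11,13,14,15,16,21}" using assms by (simp add: coeff_index_iff)
    then show ?thesis unfolding 7
      by (elim insertE emptyE)
        (simp_all add: family_def, (rule rules refl | simp add: param_weight_def; fail)+)
  qed
qed

text \<open>Applied to the components of \<open>family\<close>, this turns quasi-homogeneity into
  equivariance without further computation.\<close>

lemma qhom_affine_cone_act:
  fixes f :: "('i \<Rightarrow> 'a::comm_ring_1) \<Rightarrow> 'a"
  assumes "qhom (cone_coords (affine_cone I w)) d f"
  shows "f (cone_act (affine_cone I w) c x) = c ^ d * f x"
  using assms
proof induction
  case (coord l s)
  then show ?case by (auto simp: affine_cone_def)
qed (simp_all add: algebra_simps power_add)

definition params_of :: "(nat \<times> nat \<Rightarrow> 'a) \<Rightarrow> nat \<Rightarrow> 'a::zero" where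
  "params_of x = (\<lambda>i. if i < 10 then x (pivot i) else 0)"

lemma moduli_cone_act: "cone_act (moduli_cone R) = (\<lambda>c x ij. c ^ snd ij * x ij)"
  by (simp add: moduli_cone_def affine_cone_def)

lemma moduli_cone_coords:
  "cone_coords (moduli_cone R) s = {\<lambda>x. x ij | ij. ij \<in> coeff_index \<and> snd ij = s}"
  by (simp add: moduli_cone_def affine_cone_def)

lemma moduli_cone_apex: "cone_apex (moduli_cone R) = (\<lambda>_. 0)"
  by (simp add: moduli_cone_def affine_cone_def)

lemma family_params_of:
  fixes R :: "nat \<Rightarrow> 'a::field family_poly"
  assumes R: "syzygy_remainders R" and x: "x \<in> cone_set (moduli_cone R)"
  shows "family (params_of x) = x"
proof (rule moduli_cone_unique[OF R family_in_moduli_cone[OF R] x])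
  fix ij assume "ij \<in> pivots"
  then obtain i where "i < 10" "ij = pivot i" using pivots_pivot by blast
  then show "family (params_of x) ij = x ij" by (simp add: pivot_facts params_of_def)
qed

text \<open>Projection to the pivots and \<open>family\<close> are mutually inverse by uniqueness.
  Both have quasi-homogeneous polynomial components, so the bijection identifies the functions as
  well as the points.\<close>

lemma moduli_cone_iso_params:
  fixes R :: "nat \<Rightarrow> 'a::field family_poly"
  assumes R: "syzygy_remainders R"
  shows "cone_iso (moduli_cone R) param_cone params_of"
proof -
  note fam = family_params_of[OF R]
  have fam0: "family a ij = 0" if "ij \<notin> coeff_index" for a :: "nat \<Rightarrow> 'a" and ij
    using family_in_moduli_cone[OF R, of a] that unfolding mem_moduli_cone by blast
  have act: "family (cone_act param_cone c a) = cone_act (moduli_cone R) c (family a)"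
    for c :: 'a and a
  proof
    fix ij show "family (cone_act param_cone c a) ij = cone_act (moduli_cone R) c (family a) ij"
    proof (cases "ij \<in> coeff_index")
      case True
      obtain i j where "ij = (i, j)" by (cases ij)
      then show ?thesis
        using qhom_affine_cone_act[OF qhom_family, of i j c a] True by (simp add: moduli_cone_act)
    qed (simp add: fam0 moduli_cone_act)
  qed
  have params_family: "params_of (family a) = a" if "a \<in> cone_set param_cone" for a :: "nat \<Rightarrow> 'a"
    using that by (auto simp: params_of_def pivot_facts affine_cone_def)
  have params_mem: "params_of x \<in> cone_set param_cone" for x :: "nat \<times> nat \<Rightarrow> 'a"
    by (simp add: params_of_def affine_cone_def)
  have "quasi_cone_iso (moduli_cone R) param_cone params_of"
  proof (rule quasi_cone_isoI)
    show "bij_betw params_of (cone_set (moduli_cone R)) (cone_set param_cone)"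
      by (rule bij_betw_byWitness[where f' = family])
        (use fam params_family params_mem family_in_moduli_cone[OF R] in auto)
  next
    fix c :: 'a and x
    show "params_of (cone_act (moduli_cone R) c x) = cone_act param_cone c (params_of x)"
      by (auto simp: params_of_def moduli_cone_act affine_cone_def pivot_facts)
  next
    fix s l assume "l \<in> cone_coords (param_cone :: (nat \<Rightarrow> 'a, 'a) quasi_cone) s"
    then obtain i where i: "i < 10" "param_weight i = s" "l = (\<lambda>x. x i)"
      by (auto simp: affine_cone_def)
    have "qhom (cone_coords (moduli_cone R)) s (\<lambda>x. x (pivot i))"
      by (rule qhom.coord, unfold moduli_cone_coords)
        (use pivot_facts(1,2)[OF i(1)] i(2) in \<open>intro CollectI exI[of _ "pivot i"] conjI; simp\<close>)
    then show "\<exists>g. qhom (cone_coords (moduli_cone R)) s g \<and>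
        (\<forall>x \<in> cone_set (moduli_cone R). g x = l (params_of x))"
      using i by (intro exI[of _ "\<lambda>x. x (pivot i)"]) (simp add: params_of_def)
  next
    fix s l assume "l \<in> cone_coords (moduli_cone R) s"
    then obtain i j where ij: "(i, j) \<in> coeff_index" "j = s" "l = (\<lambda>x. x (i, j))"
      by (auto simp: moduli_cone_coords)
    then show "\<exists>f. qhom (cone_coords param_cone) s f \<and>
        (\<forall>x \<in> cone_set (moduli_cone R). l x = f (params_of x))"
      using qhom_family[OF ij(1)] fam by (intro exI[of _ "\<lambda>a. family a (i, j)"]) auto
  qed
  moreover have "family (\<lambda>_. 0 :: 'a) = (\<lambda>_. 0)"
    by (rule ext) (simp add: family_def split_beta split del: if_split cong: if_cong)
  then have "cone_apex (moduli_cone R) \<in> cone_set (moduli_cone R)"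
    using family_in_moduli_cone[OF R, of "\<lambda>_. 0"] by (simp add: moduli_cone_apex)
  moreover have "params_of (cone_apex (moduli_cone R)) = cone_apex param_cone"
    by (simp add: moduli_cone_apex params_of_def affine_cone_def)
  moreover have "cone_act (moduli_cone R) c x \<in> cone_set (moduli_cone R)"
    if "x \<in> cone_set (moduli_cone R)" for c x
    using act[of c "params_of x"] fam[OF that] family_in_moduli_cone[OF R] by metis
  ultimately show ?thesis unfolding cone_iso_def by blast
qed

section \<open>Homomorphisms from the ideal of the monomial curve\<close>

lemma polys_in_add: "p \<in> polys_in V \<Longrightarrow> q \<in> polys_in V \<Longrightarrow> p + q \<in> polys_in V"
  using keys_add[of p q] unfolding polys_in_def by blast

lemma polys_in_uminus: "p \<in> polys_in V \<Longrightarrow> - p \<in> polys_in V"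
  by (simp add: polys_in_def keys_minus)

lemma polys_in_diff: "p \<in> polys_in V \<Longrightarrow> q \<in> polys_in V \<Longrightarrow> p - q \<in> polys_in V"
  using polys_in_add[OF _ polys_in_uminus, of p V q] by simp

lemma polys_in_mult: "p \<in> polys_in V \<Longrightarrow> q \<in> polys_in V \<Longrightarrow> p * q \<in> polys_in V"
  unfolding polys_in_def by (auto elim!: keys_multE simp: keys_add_nat) blast+

lemma polys_in_single: "keys m \<subseteq> V \<Longrightarrow> single m c \<in> polys_in V"
  by (simp add: polys_in_def)

lemma polys_in_Const: "Const c \<in> polys_in V"
  unfolding Const_def by (rule polys_in_single) simp

lemma polys_in_Var: "v \<in> V \<Longrightarrow> Var v \<in> polys_in V"
  unfolding Var_def by (rule polys_in_single) simp

lemma polys_in_sum: "(\<And>x. x \<in> A \<Longrightarrow> f x \<in> polys_in V) \<Longrightarrow> (\<Sum>x\<in>A. f x) \<in> polys_in V"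
  by (induction A rule: infinite_finite_induct) (auto intro: polys_in_add)

lemma polys_in_power: "p \<in> polys_in V \<Longrightarrow> p ^ n \<in> polys_in V"
  by (induction n) (use polys_in_Const[of 1] in \<open>auto intro: polys_in_mult\<close>)

section \<open>Generators of the ideal of the monomial curve\<close>

lemma keys_xmono_gen_vars: "keys (xmono 0 b c d e) \<subseteq> gen_vars"
  by (auto simp: in_keys_iff lookup_xmono gen_vars_def split: if_splits)

lemma gen_vars_xmonoE:
  assumes "keys m \<subseteq> gen_vars"
  obtains b c d e where "m = xmono 0 b c d e"
proof -
  have "keys m \<subseteq> xvars" using assms by (auto simp: gen_vars_def xvars_def)
  then obtain a b c d e where m: "m = xmono a b c d e" by (rule xmonoE)
  moreover have "a = 0"
  proof -
    have "0 \<notin> keys m" using assms by (auto simp: gen_vars_def)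
    then show ?thesis by (simp add: m in_keys_iff lookup_xmono)
  qed
  ultimately show ?thesis using that by blast
qed

text \<open>The trailing monomials of the five initial forms after setting X_0 to 1.\<close>

definition affine_trail :: "nat \<Rightarrow> (nat \<Rightarrow>\<^sub>0 nat)" where
  "affine_trail i = (if i = 12 then xmono 0 1 0 1 0 else if i = 13 then xmono 0 1 0 0 1
     else if i = 14 then xmono 0 0 1 0 1 else if i = 15 then xmono 0 0 0 1 1 else xmono 0 0 0 0 2)"

definition affine_gen :: "nat \<Rightarrow> (nat, 'a::comm_ring_1) mpoly" where
  "affine_gen i = single (lead_mono i) 1 - single (affine_trail i) 1"

lemma lead_mono_gen_vars: "keys (lead_mono i) \<subseteq> gen_vars"
  by (simp add: lead_mono_def keys_xmono_gen_vars)

lemma affine_trail_gen_vars: "keys (affine_trail i) \<subseteq> gen_vars"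
  by (simp add: affine_trail_def keys_xmono_gen_vars)

lemma affine_trail_weights:
  assumes "i \<in> lead_weights"
  shows "mono_weight id (affine_trail i) = i" "mono_weight tau (affine_trail i) < mono_weight tau (lead_mono i)"
  using assms by (auto simp: lead_weights_def affine_trail_def lead_mono_def mono_weight_xmono tau_def)

lemma affine_gen_polys: "affine_gen i \<in> polys_in gen_vars"
  unfolding affine_gen_def
  by (intro polys_in_diff polys_in_single lead_mono_gen_vars affine_trail_gen_vars)

lemma affine_gen_in_ideal:
  assumes "i \<in> lead_weights"
  shows "affine_gen i \<in> pres_ideal"
  using affine_gen_polys assms lead_mono_facts(1)[OF assms] affine_trail_weights(1)[OF assms]
  by (simp add: pres_ideal_def affine_gen_def pres_simps pres_single)

lemma affine_gen_isobaric: "i \<in> lead_weights \<Longrightarrow> isobaric gen_vars id i (affine_gen i)"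
  unfolding affine_gen_def
  by (intro isobaric_diff isobaric_single lead_mono_gen_vars affine_trail_gen_vars
      lead_mono_facts affine_trail_weights)

definition affine_ideal :: "(nat, 'a::comm_ring_1) mpoly set" where
  "affine_ideal = {p. \<exists>h. (\<forall>i \<in> lead_weights. h i \<in> polys_in gen_vars) \<and>
     p = (\<Sum>i\<in>lead_weights. h i * affine_gen i)}"

lemma affine_ideal_add: "p \<in> affine_ideal \<Longrightarrow> q \<in> affine_ideal \<Longrightarrow> p + q \<in> affine_ideal"
proof -
  assume "p \<in> affine_ideal" "q \<in> affine_ideal"
  then obtain g h where "\<forall>i \<in> lead_weights. g i \<in> polys_in gen_vars"
    "p = (\<Sum>i\<in>lead_weights. g i * affine_gen i)" "\<forall>i \<in> lead_weights. h i \<in> polys_in gen_vars"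
    "q = (\<Sum>i\<in>lead_weights. h i * affine_gen i)" unfolding affine_ideal_def by blast
  then have "(\<forall>i \<in> lead_weights. g i + h i \<in> polys_in gen_vars) \<and>
     p + q = (\<Sum>i\<in>lead_weights. (g i + h i) * affine_gen i)"
    by (auto intro: polys_in_add simp: distrib_right sum.distrib)
  then show ?thesis unfolding affine_ideal_def by (intro CollectI exI[of _ "\<lambda>i. g i + h i"])
qed

lemma finite_lead_weights [simp]: "finite lead_weights"
  by (simp add: lead_weights_def)

lemma affine_ideal_mult_gen:
  assumes "i \<in> lead_weights" "h \<in> polys_in gen_vars"
  shows "h * affine_gen i \<in> affine_ideal"
proof -
  have "(\<Sum>j\<in>lead_weights. (if j = i then h else 0) * affine_gen j) = h * affine_gen i"
    using assms(1) by (simp add: if_distrib[where f = "\<lambda>x. x * _"] cong: if_cong)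
  then show ?thesis
    unfolding affine_ideal_def using assms(2)
    by (intro CollectI exI[of _ "\<lambda>j. if j = i then h else 0"]) auto
qed

lemma affine_ideal_zero: "0 \<in> affine_ideal"
  using affine_ideal_mult_gen[of 12 0] by (simp add: lead_weights_def)

text \<open>The generators are binomials, so replacing a leading monomial by its trailing one turns
  a monomial into a monomial, with smaller \<open>tau\<close>.\<close>

lemma affine_division_mono:
  assumes "keys m \<subseteq> gen_vars"
  shows "\<exists>n. keys n \<subseteq> gen_vars \<and> std_mono n \<and> single m c - single n c \<in> affine_ideal"
  using assms
proof (induction "mono_weight tau m" arbitrary: m rule: less_induct)
  case less
  show ?case
  proof (cases "std_mono m")
    case True
    then show ?thesis using less.prems affine_ideal_zero by (intro exI[of _ m]) auto
  next
    case False
    have "keys m \<subseteq> xvars" using less.prems by (auto simp: gen_vars_def xvars_def)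
    then obtain i M where i: "i \<in> lead_weights" "m = M + lead_mono i"
      using not_std_mono False by blast
    then have M: "keys M \<subseteq> gen_vars" using less.prems by (auto simp: keys_add_nat)
    let ?m = "M + affine_trail i"
    have "mono_weight tau ?m < mono_weight tau m" using affine_trail_weights(2)[OF i(1)] i(2) by simp
    moreover have "keys ?m \<subseteq> gen_vars"
      using M affine_trail_gen_vars by (auto simp: keys_add_nat)
    ultimately obtain n where n: "keys n \<subseteq> gen_vars" "std_mono n"
      "single ?m c - single n c \<in> affine_ideal" using less.hyps by blast
    have "single M c * affine_gen i = single m c - single ?m c"
      by (simp add: affine_gen_def right_diff_distrib mult_single i(2))
    with affine_ideal_mult_gen[OF i(1) polys_in_single[OF M], of c]
    have "single m c - single ?m c \<in> affine_ideal" by simp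
    from affine_ideal_add[OF this n(3)] n(1,2) show ?thesis by auto
  qed
qed

lemma affine_division:
  assumes "p \<in> polys_in gen_vars"
  shows "\<exists>q. q \<in> polys_in gen_vars \<and> (\<forall>m \<in> keys q. std_mono m) \<and> p - q \<in> affine_ideal"
proof -
  have "\<exists>q. q \<in> polys_in gen_vars \<and> (\<forall>m \<in> keys q. std_mono m) \<and>
      (\<Sum>m\<in>A. single m (c m)) - q \<in> affine_ideal"
    if "finite A" "\<forall>m \<in> A. keys m \<subseteq> gen_vars" for A and c :: "_ \<Rightarrow> 'a"
    using that
  proof (induction A)
    case empty
    then show ?case using affine_ideal_zero by (intro exI[of _ 0]) auto
  next
    case (insert m A)
    then obtain q where q: "q \<in> polys_in gen_vars" "\<forall>m \<in> keys q. std_mono m"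
      "(\<Sum>m\<in>A. single m (c m)) - q \<in> affine_ideal" by auto
    obtain n where n: "keys n \<subseteq> gen_vars" "std_mono n"
      "single m (c m) - single n (c m) \<in> affine_ideal"
      using affine_division_mono[of m "c m"] insert.prems by auto
    have "(\<Sum>m\<in>insert m A. single m (c m)) - (single n (c m) + q) \<in> affine_ideal"
      using affine_ideal_add[OF n(3) q(3)] insert.hyps by (simp add: algebra_simps)
    moreover have "single n (c m) + q \<in> polys_in gen_vars"
      using n(1) q(1) by (intro polys_in_add polys_in_single)
    moreover have "\<forall>m \<in> keys (single n (c m) + q). std_mono m"
      using keys_add[of "single n (c m)" q] n(2) q(2) by (auto split: if_splits)
    ultimately show ?case by blast
  qed
  from this[of "keys p" "lookup p"] assms show ?thesis
    by (simp add: polys_in_def flip: poly_mapping_sum_single)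
qed

text \<open>Standard monomials without X_0 have pairwise distinct weights, so nothing cancels after
  X_n -> t^n.\<close>

lemma pres_std_inj:
  assumes q: "q \<in> polys_in gen_vars" "\<forall>m \<in> keys q. std_mono m" and 0: "pres q = 0"
  shows "q = (0 :: (nat, 'a::field) mpoly)"
proof (rule ccontr)
  assume "q \<noteq> 0"
  then obtain m where m: "m \<in> keys q"
    by (metis all_not_in_conv poly_mapping_sum_single sum.empty)
  have inj: "m' = m" if m': "m' \<in> keys q" "mono_weight id m' = mono_weight id m" for m'
  proof -
    have "keys m \<subseteq> gen_vars" "keys m' \<subseteq> gen_vars"
      using q(1) m m'(1) by (auto simp: polys_in_def)
    then obtain b c d e b' c' d' e' where mm: "m = xmono 0 b c d e" "m' = xmono 0 b' c' d' e'"
      by (elim gen_vars_xmonoE) blast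
    have std: "std_mono m" "std_mono m'" using q(2) m m'(1) by auto
    have "5 * b + 6 * c + 7 * d + 8 * e = 5 * b' + 6 * c' + 7 * d' + 8 * e'"
      using m'(2) unfolding mm mono_weight_xmono by (simp add: algebra_simps)
    from std_weight_inj[OF this] std show ?thesis by (simp add: mm std_mono_xmono)
  qed
  have "coeff (pres q) (mono_weight id m)
      = (\<Sum>m'\<in>keys q. if m' = m then lookup q m else 0)"
    unfolding pres_expand coeff_sum using inj by (intro sum.cong) auto
  also have "\<dots> = lookup q m" using m by simp
  finally show False using m 0 by (simp add: in_keys_iff)
qed

lemma pres_affine_gen: "i \<in> lead_weights \<Longrightarrow> pres (affine_gen i) = 0"
  using affine_gen_in_ideal by (auto simp: pres_ideal_def)

lemma pres_affine_ideal: "p \<in> affine_ideal \<Longrightarrow> pres p = 0"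
  by (auto simp: affine_ideal_def pres_sum pres_simps pres_affine_gen intro!: sum.neutral)

text \<open>Division leaves a standard remainder, which \<open>pres_std_inj\<close> forces to be
  zero for elements of the kernel. So the kernel is generated by the five binomials.\<close>

lemma pres_ideal_eq: "pres_ideal = (affine_ideal :: (nat, 'a::field) mpoly set)"
proof
  show "affine_ideal \<subseteq> (pres_ideal :: (nat, 'a) mpoly set)"
  proof
    fix p :: "(nat, 'a) mpoly" assume p: "p \<in> affine_ideal"
    then have "p \<in> polys_in gen_vars"
      unfolding affine_ideal_def by (auto intro!: polys_in_sum polys_in_mult affine_gen_polys)
    then show "p \<in> pres_ideal" using pres_affine_ideal[OF p] by (simp add: pres_ideal_def)
  qed
  show "pres_ideal \<subseteq> (affine_ideal :: (nat, 'a) mpoly set)"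
  proof
    fix p :: "(nat, 'a) mpoly" assume p: "p \<in> pres_ideal"
    then obtain q where q: "q \<in> polys_in gen_vars" "\<forall>m \<in> keys q. std_mono m"
      "p - q \<in> affine_ideal" using affine_division[of p] by (auto simp: pres_ideal_def)
    have "pres q = 0" using pres_affine_ideal[OF q(3)] p by (simp add: pres_simps pres_ideal_def)
    then have "q = 0" by (rule pres_std_inj[OF q(1,2)])
    then show "p \<in> affine_ideal" using q(3) by simp
  qed
qed

lemma pres_ideal_expand:
  assumes "p \<in> pres_ideal"
  obtains h where "\<And>i. i \<in> lead_weights \<Longrightarrow> h i \<in> polys_in gen_vars"
    "p = (\<Sum>i\<in>lead_weights. h i * affine_gen i)"
  using assms unfolding pres_ideal_eq affine_ideal_def by blast

lemma pres_ideal_add: "p \<in> pres_ideal \<Longrightarrow> q \<in> pres_ideal \<Longrightarrow> p + q \<in> pres_ideal"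
  by (simp add: pres_ideal_def polys_in_add pres_simps)

lemma pres_ideal_mult: "a \<in> polys_in gen_vars \<Longrightarrow> p \<in> pres_ideal \<Longrightarrow> a * p \<in> pres_ideal"
  by (simp add: pres_ideal_def polys_in_mult pres_simps)

lemma pres_ideal_zero: "0 \<in> pres_ideal"
  by (simp add: pres_ideal_def pres_simps)

text \<open>Shared by homomorphisms and by restrictions of derivations: on the kernel of
  \<open>pres\<close> one term of the Leibniz rule vanishes. Such maps are determined by five
  values.\<close>

definition ideal_linear :: "((nat, 'a::field) mpoly \<Rightarrow> 'a poly) \<Rightarrow> bool" where
  "ideal_linear \<phi> \<longleftrightarrow> (\<forall>p \<in> pres_ideal. \<forall>q \<in> pres_ideal. \<phi> (p + q) = \<phi> p + \<phi> q) \<and>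
     (\<forall>a \<in> polys_in gen_vars. \<forall>p \<in> pres_ideal. \<phi> (a * p) = pres a * \<phi> p)"

lemma ideal_linear_expand:
  assumes "ideal_linear \<phi>" "\<And>i. i \<in> lead_weights \<Longrightarrow> h i \<in> polys_in gen_vars"
  shows "\<phi> (\<Sum>i\<in>lead_weights. h i * affine_gen i) = (\<Sum>i\<in>lead_weights. pres (h i) * \<phi> (affine_gen i))"
proof -
  have zero: "\<phi> 0 = 0"
    using assms(1) pres_ideal_zero unfolding ideal_linear_def by (metis add_cancel_left_left)
  have "(\<Sum>i\<in>A. h i * affine_gen i) \<in> pres_ideal \<and>
      \<phi> (\<Sum>i\<in>A. h i * affine_gen i) = (\<Sum>i\<in>A. pres (h i) * \<phi> (affine_gen i))"
    if "finite A" "A \<subseteq> lead_weights" for A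
    using that
  proof (induction A)
    case (insert i A)
    then have "h i * affine_gen i \<in> pres_ideal"
      using assms(2) by (intro pres_ideal_mult affine_gen_in_ideal) auto
    moreover have "\<phi> (h i * affine_gen i) = pres (h i) * \<phi> (affine_gen i)"
      using insert.prems assms(1) assms(2)[of i] affine_gen_in_ideal[of i] unfolding ideal_linear_def
      by blast
    ultimately show ?case
      using insert assms(1) by (auto simp: pres_ideal_add ideal_linear_def)
  qed (simp_all add: zero pres_ideal_zero)
  from this[of lead_weights] show ?thesis by simp
qed

lemma ideal_linear_eqI:
  assumes "ideal_linear \<phi>" "ideal_linear \<psi>" "\<And>i. i \<in> lead_weights \<Longrightarrow> \<phi> (affine_gen i) = \<psi> (affine_gen i)"
    and "p \<in> pres_ideal"
  shows "\<phi> p = \<psi> p"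
proof -
  obtain h where h: "\<And>i. i \<in> lead_weights \<Longrightarrow> h i \<in> polys_in gen_vars"
    and p: "p = (\<Sum>i\<in>lead_weights. h i * affine_gen i)" by (rule pres_ideal_expand[OF assms(4)]) blast
  have "\<phi> p = (\<Sum>i\<in>lead_weights. pres (h i) * \<phi> (affine_gen i))"
    unfolding p by (rule ideal_linear_expand[OF assms(1)]) (rule h)
  also have "\<dots> = (\<Sum>i\<in>lead_weights. pres (h i) * \<psi> (affine_gen i))"
    using assms(3) by simp
  also have "\<dots> = \<psi> p"
    unfolding p by (rule ideal_linear_expand[OF assms(2), symmetric]) (rule h)
  finally show ?thesis .
qed

lemma normal_homs_linear: "\<phi> \<in> normal_homs \<Longrightarrow> ideal_linear \<phi>"
  unfolding normal_homs_def ideal_linear_def by blast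

lemma derivations_linear: "\<delta> \<in> derivations \<Longrightarrow> ideal_linear \<delta>"
  unfolding derivations_def ideal_linear_def pres_ideal_def by auto

subsection \<open>Logarithmic derivations\<close>

definition log_weight :: "(nat \<Rightarrow> 'a::field) \<Rightarrow> (nat \<Rightarrow>\<^sub>0 nat) \<Rightarrow> 'a" where
  "log_weight \<beta> m = (\<Sum>n\<in>gen_vars. of_nat (lookup m n) * \<beta> n)"

text \<open>The derivation with \<open>X\<^sub>n \<mapsto> \<beta> n t\<^sup>n\<close>; division by \<open>t\<^sup>s\<close> makes it homogeneous of degree \<open>-s\<close>.\<close>

definition log_deriv :: "(nat \<Rightarrow> 'a::field) \<Rightarrow> (nat, 'a) mpoly \<Rightarrow> 'a poly" where
  "log_deriv \<beta> = keys_sum (\<lambda>m c. monom (c * log_weight \<beta> m) (mono_weight id m))"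

lemma log_weight_add: "log_weight \<beta> (m + m') = log_weight \<beta> m + log_weight \<beta> m'"
  by (simp add: log_weight_def lookup_add distrib_right sum.distrib)

lemma log_weight_xmono:
  "log_weight \<beta> (xmono a b c d e) = of_nat b * \<beta> 5 + of_nat c * \<beta> 6 + of_nat d * \<beta> 7 + of_nat e * \<beta> 8"
  by (simp add: log_weight_def gen_vars_def lookup_xmono algebra_simps)

lemma log_deriv_add: "log_deriv \<beta> (p + q) = log_deriv \<beta> p + log_deriv \<beta> q"
  unfolding log_deriv_def by (rule keys_sum_add) (simp_all add: distrib_right add_monom)

lemma log_deriv_single:
  "log_deriv \<beta> (single m c) = monom (c * log_weight \<beta> m) (mono_weight id m)"
  unfolding log_deriv_def by (rule keys_sum_single) simp

lemma log_deriv_zero: "log_deriv \<beta> 0 = 0"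
  by (simp add: log_deriv_def)

lemma log_deriv_uminus: "log_deriv \<beta> (- p) = - log_deriv \<beta> p"
  using log_deriv_add[of \<beta> p "- p"] by (simp add: log_deriv_zero eq_neg_iff_add_eq_0 add.commute)

lemma log_deriv_diff: "log_deriv \<beta> (p - q) = log_deriv \<beta> p - log_deriv \<beta> q"
  using log_deriv_add[of \<beta> p "- q"] by (simp add: log_deriv_uminus)

lemma log_deriv_mult: "log_deriv \<beta> (p * q) = pres p * log_deriv \<beta> q + pres q * log_deriv \<beta> p"
proof (induction p rule: poly_mapping_induct)
  case (single m c)
  show ?case
  proof (induction q rule: poly_mapping_induct)
    case (single n d)
    show ?case
      by (simp add: mult_single log_deriv_single pres_single mult_monom log_weight_add add_monom
          algebra_simps)
  qed (simp_all add: log_deriv_zero pres_simps log_deriv_add algebra_simps)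
qed (simp_all add: log_deriv_zero pres_simps log_deriv_add algebra_simps)

definition log_value :: "(nat \<Rightarrow> 'a::field) \<Rightarrow> nat \<Rightarrow> 'a" where
  "log_value \<beta> i = log_weight \<beta> (lead_mono i) - log_weight \<beta> (affine_trail i)"

lemma log_deriv_affine_gen: "i \<in> lead_weights \<Longrightarrow> log_deriv \<beta> (affine_gen i) = monom (log_value \<beta> i) i"
  by (simp add: affine_gen_def log_deriv_diff log_deriv_single log_value_def lead_mono_facts(1)
      affine_trail_weights(1) diff_monom)

lemma log_value_simps:
  "log_value \<beta> 12 = 2 * \<beta> 6 - \<beta> 5 - \<beta> 7" "log_value \<beta> 13 = \<beta> 6 + \<beta> 7 - \<beta> 5 - \<beta> 8"
  "log_value \<beta> 14 = 2 * \<beta> 7 - \<beta> 6 - \<beta> 8" "log_value \<beta> 15 = 3 * \<beta> 5 - \<beta> 7 - \<beta> 8"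
  "log_value \<beta> 16 = 2 * \<beta> 5 + \<beta> 6 - 2 * \<beta> 8"
  by (simp_all add: log_value_def lead_mono_def affine_trail_def log_weight_xmono)

lemma semigroup_ring_monom: "c = 0 \<or> n \<in> S \<Longrightarrow> monom c n \<in> semigroup_ring"
  by (auto simp: semigroup_ring_def)

lemma semigroup_ring_zero: "0 \<in> semigroup_ring"
  by (simp add: semigroup_ring_def)

lemma semigroup_ring_add: "p \<in> semigroup_ring \<Longrightarrow> q \<in> semigroup_ring \<Longrightarrow> p + q \<in> semigroup_ring"
  unfolding semigroup_ring_def by (auto simp: coeff_add) (metis add.right_neutral)

lemma semigroup_ring_sum: "(\<And>x. x \<in> A \<Longrightarrow> f x \<in> semigroup_ring) \<Longrightarrow> (\<Sum>x\<in>A. f x) \<in> semigroup_ring"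
  by (induction A rule: infinite_finite_induct) (auto intro: semigroup_ring_add semigroup_ring_zero)

lemma semigroup_ring_smult: "p \<in> semigroup_ring \<Longrightarrow> smult c p \<in> semigroup_ring"
  by (auto simp: semigroup_ring_def)

lemma semigroup_ring_uminus: "p \<in> semigroup_ring \<Longrightarrow> - p \<in> semigroup_ring"
  by (auto simp: semigroup_ring_def)

lemma semigroup_ring_mult:
  assumes "p \<in> semigroup_ring" "q \<in> semigroup_ring"
  shows "p * q \<in> semigroup_ring"
  unfolding semigroup_ring_def
proof (intro CollectI allI impI)
  fix n assume "coeff (p * q) n \<noteq> 0"
  then obtain i where "i \<le> n" "coeff p i * coeff q (n - i) \<noteq> 0"
    unfolding coeff_mult by (metis (no_types, lifting) atMost_iff sum.neutral)
  then have "i \<in> S" "n - i \<in> S" "n = i + (n - i)" using assms by (auto simp: semigroup_ring_def)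
  then show "n \<in> S" using S_add by metis
qed

lemma mono_weight_gen_vars:
  assumes "keys m \<subseteq> gen_vars"
  shows "mono_weight id m \<in> S"
proof -
  obtain b c d e where "m = xmono 0 b c d e" using assms by (rule gen_vars_xmonoE)
  then have "mono_weight id m = 5 * b + 6 * c + 7 * d + 8 * e"
    by (simp add: mono_weight_xmono)
  then show ?thesis unfolding S_def by blast
qed

lemma pres_semigroup_ring: "p \<in> polys_in gen_vars \<Longrightarrow> pres p \<in> semigroup_ring"
  unfolding pres_expand
  by (intro semigroup_ring_sum semigroup_ring_monom disjI2 mono_weight_gen_vars) (auto simp: polys_in_def)

lemma poly_shift_monom_mult: "poly_shift s (monom 1 s * p) = (p :: 'a::comm_semiring_1 poly)"
  by (intro poly_eqI) (simp add: coeff_poly_shift coeff_monom_mult)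

text \<open>The values beta_n t^(n-s) may be Laurent monomials; working with t^s times them stays
  inside polynomials. On the ideal, divisibility by t^s with quotient in \<open>k[S]\<close> follows
  from the values on the five generators, even if it fails on single variables.\<close>

lemma log_deriv_ideal:
  assumes adm: "\<And>i. i \<in> lead_weights \<Longrightarrow> log_value \<beta> i \<noteq> 0 \<Longrightarrow> s \<le> i \<and> i - s \<in> S"
    and p: "p \<in> pres_ideal"
  shows "\<exists>r \<in> semigroup_ring. log_deriv \<beta> p = monom 1 s * r"
proof -
  obtain h where h: "\<And>i. i \<in> lead_weights \<Longrightarrow> h i \<in> polys_in gen_vars"
    and p: "p = (\<Sum>i\<in>lead_weights. h i * affine_gen i)" by (rule pres_ideal_expand[OF p]) blast
  have lin: "ideal_linear (log_deriv \<beta>)"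
    unfolding ideal_linear_def by (auto simp: log_deriv_add log_deriv_mult pres_ideal_def)
  define r where "r = (\<Sum>i\<in>lead_weights. pres (h i) * monom (log_value \<beta> i) (i - s))"
  have "monom 1 s * (pres (h i) * monom (log_value \<beta> i) (i - s)) = pres (h i) * monom (log_value \<beta> i) i"
    if "i \<in> lead_weights" for i
    using adm[OF that] by (cases "log_value \<beta> i = 0") (auto simp: mult_monom mult.left_commute)
  then have "monom 1 s * r = (\<Sum>i\<in>lead_weights. pres (h i) * log_deriv \<beta> (affine_gen i))"
    unfolding r_def sum_distrib_left by (intro sum.cong) (auto simp: log_deriv_affine_gen)
  also have "\<dots> = log_deriv \<beta> p"
    unfolding p by (rule ideal_linear_expand[OF lin, symmetric]) (rule h)
  finally have "log_deriv \<beta> p = monom 1 s * r" by (rule sym)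
  moreover have "r \<in> semigroup_ring"
    unfolding r_def using adm h
    by (intro semigroup_ring_sum semigroup_ring_mult pres_semigroup_ring semigroup_ring_monom) auto
  ultimately show ?thesis by blast
qed

definition log_hom :: "nat \<Rightarrow> (nat \<Rightarrow> 'a::field) \<Rightarrow> (nat, 'a) mpoly \<Rightarrow> 'a poly" where
  "log_hom s \<beta> p = (if p \<in> pres_ideal then poly_shift s (log_deriv \<beta> p) else 0)"

lemma log_hom_normal:
  assumes adm: "\<And>i. i \<in> lead_weights \<Longrightarrow> log_value \<beta> i \<noteq> 0 \<Longrightarrow> s \<le> i \<and> i - s \<in> S"
  shows "log_hom s \<beta> \<in> normal_homs_neg s"
proof -
  have ex: "\<exists>r \<in> semigroup_ring. log_deriv \<beta> p = monom 1 s * r \<and> log_hom s \<beta> p = r"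
    if p: "p \<in> pres_ideal" for p
  proof -
    have "\<exists>r \<in> semigroup_ring. log_deriv \<beta> p = monom 1 s * r"
      by (rule log_deriv_ideal[OF _ p]) (rule adm)
    then show ?thesis using p by (auto simp: log_hom_def poly_shift_monom_mult)
  qed
  have eqI: "log_hom s \<beta> p = r" if "p \<in> pres_ideal" "log_deriv \<beta> p = monom 1 s * r" for p r
    using that by (simp add: log_hom_def poly_shift_monom_mult)
  have "log_hom s \<beta> (p + q) = log_hom s \<beta> p + log_hom s \<beta> q" if "p \<in> pres_ideal" "q \<in> pres_ideal" for p q
    using ex[OF that(1)] ex[OF that(2)] that
    by (intro eqI pres_ideal_add) (auto simp: log_deriv_add distrib_left)
  moreover have "log_hom s \<beta> (a * p) = pres a * log_hom s \<beta> p"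
    if "a \<in> polys_in gen_vars" "p \<in> pres_ideal" for a p
    using ex[OF that(2)] that
    by (intro eqI pres_ideal_mult) (auto simp: log_deriv_mult pres_ideal_def mult.left_commute)
  moreover have "log_hom s \<beta> p \<in> semigroup_ring" if "p \<in> pres_ideal" for p
    using ex[OF that] by blast
  ultimately have "log_hom s \<beta> \<in> normal_homs"
    unfolding normal_homs_def by (auto simp: log_hom_def)
  moreover have "n + s = w" if p: "p \<in> pres_ideal" "isobaric gen_vars id w p"
    "coeff (log_hom s \<beta> p) n \<noteq> 0" for w p n
  proof -
    have "log_deriv \<beta> p = (\<Sum>m\<in>keys p. monom (lookup p m * log_weight \<beta> m) w)"
      unfolding log_deriv_def keys_sum_def using p(2) by (intro sum.cong) (auto simp: isobaric_def)
    then have "coeff (log_deriv \<beta> p) k = 0" if "k \<noteq> w" for k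
      using that by (simp add: coeff_sum)
    then show ?thesis using p(1,3) by (auto simp: log_hom_def coeff_poly_shift)
  qed
  ultimately show ?thesis by (simp add: normal_homs_neg_def)
qed

text \<open>A monomial with nonzero \<open>log_weight\<close> contains some X_n with
  \<open>\<beta> n \<noteq> 0\<close>. Splitting off this factor leaves a weight in
  \<open>S\<close>, to which \<open>n - s\<close> in \<open>S\<close> is added.\<close>

lemma log_deriv_polys:
  assumes adm: "\<And>n. n \<in> gen_vars \<Longrightarrow> \<beta> n \<noteq> 0 \<Longrightarrow> s \<le> n \<and> n - s \<in> S"
    and p: "p \<in> polys_in gen_vars"
  shows "\<exists>r \<in> semigroup_ring. log_deriv \<beta> p = monom 1 s * r"
proof -
  have weight: "s \<le> mono_weight id m \<and> mono_weight id m - s \<in> S"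
    if m: "m \<in> keys p" and nz: "log_weight \<beta> m \<noteq> 0" for m
  proof -
    have keys: "keys m \<subseteq> gen_vars" using p m by (auto simp: polys_in_def)
    obtain n where n: "n \<in> gen_vars" "lookup m n \<noteq> 0" "\<beta> n \<noteq> 0"
      using nz unfolding log_weight_def by (metis (no_types, lifting) mult_eq_0_iff of_nat_0 sum.neutral)
    define m' where "m' = m - single n 1"
    have m': "m = m' + single n 1"
      using n(2) by (intro poly_mapping_eqI) (auto simp: m'_def lookup_add lookup_minus lookup_single when_def)
    then have "keys m' \<subseteq> gen_vars" using keys by (auto simp: keys_add_nat)
    then have "mono_weight id m' \<in> S" by (rule mono_weight_gen_vars)
    moreover have "mono_weight id m = mono_weight id m' + n" by (simp add: m')
    moreover have "s \<le> n" "n - s \<in> S" using adm n by auto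
    ultimately show ?thesis using S_add[of "mono_weight id m'" "n - s"] by auto
  qed
  define r where "r = (\<Sum>m\<in>keys p.
    monom (lookup p m * log_weight \<beta> m) (mono_weight id m - s))"
  have "monom 1 s * monom (lookup p m * log_weight \<beta> m) (mono_weight id m - s)
      = monom (lookup p m * log_weight \<beta> m) (mono_weight id m)"
    if "m \<in> keys p" for m
    using weight[OF that] by (cases "log_weight \<beta> m = 0") (auto simp: mult_monom)
  then have "log_deriv \<beta> p = monom 1 s * r"
    unfolding log_deriv_def keys_sum_def r_def sum_distrib_left by (intro sum.cong) auto
  moreover have "r \<in> semigroup_ring"
    unfolding r_def using weight by (intro semigroup_ring_sum semigroup_ring_monom) auto
  ultimately show ?thesis by blast
qed

lemma log_deriv_derivation:
  assumes adm: "\<And>n. n \<in> gen_vars \<Longrightarrow> \<beta> n \<noteq> 0 \<Longrightarrow> s \<le> n \<and> n - s \<in> S"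
  shows "(\<lambda>p. poly_shift s (log_deriv \<beta> p)) \<in> derivations"
proof -
  let ?d = "\<lambda>p. poly_shift s (log_deriv \<beta> p)"
  have ex: "\<exists>r \<in> semigroup_ring. log_deriv \<beta> p = monom 1 s * r \<and> ?d p = r"
    if "p \<in> polys_in gen_vars" for p
  proof -
    have "\<exists>r \<in> semigroup_ring. log_deriv \<beta> p = monom 1 s * r"
      by (rule log_deriv_polys[OF _ that]) (rule adm)
    then show ?thesis by (auto simp: poly_shift_monom_mult)
  qed
  have eqI: "?d p = r" if "log_deriv \<beta> p = monom 1 s * r" for p r
    using that by (simp add: poly_shift_monom_mult)
  have "?d (Const a) = 0" for a
    by (simp add: Const_def log_deriv_single log_weight_def poly_eq_iff coeff_poly_shift)
  moreover have "?d (p + q) = ?d p + ?d q" if "p \<in> polys_in gen_vars" "q \<in> polys_in gen_vars" for p q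
    using ex[OF that(1)] ex[OF that(2)] by (intro eqI) (auto simp: log_deriv_add distrib_left)
  moreover have "?d (p * q) = pres p * ?d q + pres q * ?d p"
    if "p \<in> polys_in gen_vars" "q \<in> polys_in gen_vars" for p q
    using ex[OF that(1)] ex[OF that(2)]
    by (intro eqI) (auto simp: log_deriv_mult distrib_left mult.left_commute)
  moreover have "?d p \<in> semigroup_ring" if "p \<in> polys_in gen_vars" for p
    using ex[OF that] by blast
  ultimately show ?thesis unfolding derivations_def by blast
qed

section \<open>The negatively graded part of the cotangent module\<close>

lemma derivations_add:
  assumes "\<delta> \<in> derivations" "\<delta>' \<in> derivations"
  shows "(\<lambda>p. \<delta> p + \<delta>' p) \<in> derivations"
  using assms unfolding derivations_def
  by (auto simp: semigroup_ring_add algebra_simps)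

lemma derivations_uminus:
  assumes "\<delta> \<in> derivations"
  shows "(\<lambda>p. - \<delta> p) \<in> derivations"
  using assms unfolding derivations_def
  by (auto simp: semigroup_ring_uminus algebra_simps)

lemma derivations_zero: "(\<lambda>_. 0) \<in> derivations"
  by (simp add: derivations_def semigroup_ring_zero)

lemma derivations_smult:
  assumes "\<delta> \<in> derivations"
  shows "(\<lambda>p. smult c (\<delta> p)) \<in> derivations"
  using assms unfolding derivations_def
  by (auto simp: semigroup_ring_smult smult_add_right)

lemma normal_homs_add:
  assumes "\<phi> \<in> normal_homs" "\<psi> \<in> normal_homs"
  shows "(\<lambda>p. \<phi> p + \<psi> p) \<in> normal_homs"
  using assms unfolding normal_homs_def
  by (auto simp: semigroup_ring_add algebra_simps)

lemma normal_homs_smult: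
  assumes "\<phi> \<in> normal_homs"
  shows "(\<lambda>p. smult c (\<phi> p)) \<in> normal_homs"
  using assms unfolding normal_homs_def
  by (auto simp: semigroup_ring_smult smult_add_right)

lemma normal_homs_neg_add:
  assumes "\<phi> \<in> normal_homs_neg s" "\<psi> \<in> normal_homs_neg s"
  shows "(\<lambda>p. \<phi> p + \<psi> p) \<in> normal_homs_neg s"
  using assms normal_homs_add[of \<phi> \<psi>] unfolding normal_homs_neg_def
  by auto (metis add.right_neutral)

lemma normal_homs_neg_smult:
  assumes "\<phi> \<in> normal_homs_neg s"
  shows "(\<lambda>p. smult c (\<phi> p)) \<in> normal_homs_neg s"
  using assms normal_homs_smult[of \<phi> c] unfolding normal_homs_neg_def by auto

lemma normal_homs_neg_zero: "(\<lambda>_. 0) \<in> normal_homs_neg s"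
  by (simp add: normal_homs_neg_def normal_homs_def semigroup_ring_zero)

lemma normal_homs_neg_sum:
  assumes "\<And>k. k \<in> A \<Longrightarrow> \<phi> k \<in> normal_homs_neg s"
  shows "(\<lambda>p. \<Sum>k\<in>A. \<phi> k p) \<in> normal_homs_neg s"
  using assms
proof (induction A rule: infinite_finite_induct)
  case (insert k A)
  then have "(\<lambda>p. \<phi> k p + (\<Sum>k\<in>A. \<phi> k p)) \<in> normal_homs_neg s"
    by (intro normal_homs_neg_add) auto
  then show ?case using insert by simp
qed (simp_all add: normal_homs_neg_zero)

lemma normal_homs_neg_normal: "\<phi> \<in> normal_homs_neg s \<Longrightarrow> \<phi> \<in> normal_homs"
  by (simp add: normal_homs_neg_def)

lemma t1_class_refl: "\<phi> \<in> normal_homs \<Longrightarrow> \<phi> \<in> t1_class \<phi>"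
  unfolding t1_class_def using derivations_zero by (intro CollectI conjI bexI[of _ "\<lambda>_. 0"]) auto

lemma t1_class_eqI:
  assumes "\<delta> \<in> derivations" "\<And>p. p \<in> pres_ideal \<Longrightarrow> \<phi> p = \<psi> p + \<delta> p"
  shows "t1_class \<phi> = t1_class \<psi>"
proof -
  have sub: "t1_class \<phi> \<subseteq> t1_class \<psi>"
    if \<delta>: "\<delta> \<in> derivations" "\<And>p. p \<in> pres_ideal \<Longrightarrow> \<phi> p = \<psi> p + \<delta> p" for \<phi> \<psi> \<delta> :: "(nat, 'a) mpoly \<Rightarrow> 'a poly"
  proof
    fix \<chi> assume "\<chi> \<in> t1_class \<phi>"
    then obtain \<delta>' where "\<chi> \<in> normal_homs" "\<delta>' \<in> derivations" "\<forall>p \<in> pres_ideal. \<chi> p = \<phi> p + \<delta>' p"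
      by (auto simp: t1_class_def)
    then show "\<chi> \<in> t1_class \<psi>"
      using \<delta> derivations_add[OF \<delta>(1), of \<delta>'] unfolding t1_class_def
      by (intro CollectI conjI bexI[of _ "\<lambda>p. \<delta> p + \<delta>' p"]) (auto simp: add.assoc)
  qed
  show ?thesis
    using sub[OF assms] sub[OF derivations_uminus[OF assms(1)], of \<psi> \<phi>] assms(2) by auto
qed

lemma t1_class_mem:
  assumes "\<psi> \<in> t1_class \<phi>"
  shows "t1_class \<psi> = t1_class \<phi>"
proof -
  obtain \<delta> where "\<delta> \<in> derivations" "\<forall>p \<in> pres_ideal. \<psi> p = \<phi> p + \<delta> p"
    using assms by (auto simp: t1_class_def)
  then show ?thesis by (intro t1_class_eqI[of \<delta>]) auto
qed

lemma T1_negE: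
  assumes "C \<in> T1_neg s"
  obtains \<phi> where "\<phi> \<in> normal_homs_neg s" "C = t1_class \<phi>"
  using assms t1_class_mem unfolding T1_neg_def T1_def by blast

lemma T1_neg_class:
  assumes "\<phi> \<in> normal_homs_neg s"
  shows "t1_class \<phi> \<in> T1_neg s"
  using assms t1_class_refl[OF normal_homs_neg_normal[OF assms]] normal_homs_neg_normal[OF assms]
  unfolding T1_neg_def T1_def by blast

text \<open>A derivation that realizes equality of classes can be scaled along. The reverse
  inclusion divides by \<open>c\<close>.\<close>

lemma T1_scale_class:
  assumes "c \<noteq> 0"
  shows "T1_scale c (t1_class \<phi>) = t1_class (\<lambda>p. smult c (\<phi> p))"
proof
  show "T1_scale c (t1_class \<phi>) \<subseteq> t1_class (\<lambda>p. smult c (\<phi> p))"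
  proof
    fix \<chi> assume "\<chi> \<in> T1_scale c (t1_class \<phi>)"
    then obtain \<psi> \<delta> where \<psi>: "\<chi> = (\<lambda>p. smult c (\<psi> p))" "\<psi> \<in> normal_homs" "\<delta> \<in> derivations"
      "\<forall>p \<in> pres_ideal. \<psi> p = \<phi> p + \<delta> p" by (auto simp: T1_scale_def t1_class_def)
    then show "\<chi> \<in> t1_class (\<lambda>p. smult c (\<phi> p))"
      unfolding t1_class_def using normal_homs_smult derivations_smult
      by (intro CollectI conjI bexI[of _ "\<lambda>p. smult c (\<delta> p)"]) (auto simp: smult_add_right)
  qed
  show "t1_class (\<lambda>p. smult c (\<phi> p)) \<subseteq> T1_scale c (t1_class \<phi>)"
  proof
    fix \<chi> assume "\<chi> \<in> t1_class (\<lambda>p. smult c (\<phi> p))"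
    then obtain \<delta> where \<chi>: "\<chi> \<in> normal_homs" "\<delta> \<in> derivations"
      "\<forall>p \<in> pres_ideal. \<chi> p = smult c (\<phi> p) + \<delta> p" by (auto simp: t1_class_def)
    have "(\<lambda>p. smult (inverse c) (\<chi> p)) \<in> t1_class \<phi>"
      unfolding t1_class_def using normal_homs_smult[OF \<chi>(1)] derivations_smult[OF \<chi>(2)] \<chi>(3) assms
      by (intro CollectI conjI bexI[of _ "\<lambda>p. smult (inverse c) (\<delta> p)"]) (auto simp: smult_add_right)
    moreover have "\<chi> = (\<lambda>p. smult c (smult (inverse c) (\<chi> p)))" using assms by simp
    ultimately show "\<chi> \<in> T1_scale c (t1_class \<phi>)"
      unfolding T1_scale_def by (intro image_eqI[where x = "\<lambda>p. smult (inverse c) (\<chi> p)"])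
  qed
qed

text \<open>
  The value of a homomorphism of degree \<open>-s\<close> on the generator of weight \<open>i\<close> is
  \<open>gen_value s \<phi> i\<close> times \<open>t\<close> to the power \<open>i - s\<close>, and is zero if this exponent is negative.
\<close>

definition gen_value :: "nat \<Rightarrow> ((nat, 'a::field) mpoly \<Rightarrow> 'a poly) \<Rightarrow> nat \<Rightarrow> 'a" where
  "gen_value s \<phi> i = coeff (monom 1 s * \<phi> (affine_gen i)) i"

lemma gen_value_add: "gen_value s (\<lambda>p. \<phi> p + \<psi> p) i = gen_value s \<phi> i + gen_value s \<psi> i"
  by (simp add: gen_value_def distrib_left)

lemma gen_value_smult: "gen_value s (\<lambda>p. smult c (\<phi> p)) i = c * gen_value s \<phi> i"
  by (simp add: gen_value_def)

lemma gen_value_sum: "gen_value s (\<lambda>p. \<Sum>k\<in>A. \<phi> k p) i = (\<Sum>k\<in>A. gen_value s (\<phi> k) i)"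
  by (simp add: gen_value_def sum_distrib_left coeff_sum)

lemma hom_gen_value:
  assumes "\<phi> \<in> normal_homs_neg s" "i \<in> lead_weights"
  shows "monom 1 s * \<phi> (affine_gen i) = monom (gen_value s \<phi> i) i"
proof (rule poly_eqI)
  fix n
  have "n = i" if "coeff (monom 1 s * \<phi> (affine_gen i)) n \<noteq> 0"
  proof -
    from that have "s \<le> n" "coeff (\<phi> (affine_gen i)) (n - s) \<noteq> 0"
      by (auto simp: coeff_monom_mult split: if_splits)
    then have "n - s + s = i"
      using assms(1) affine_gen_in_ideal[OF assms(2)] affine_gen_isobaric[OF assms(2)]
      unfolding normal_homs_neg_def by blast
    then show ?thesis using \<open>s \<le> n\<close> by simp
  qed
  then show "coeff (monom 1 s * \<phi> (affine_gen i)) n = coeff (monom (gen_value s \<phi> i) i) n"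
    by (cases "n = i") (auto simp: gen_value_def)
qed

lemma gen_value_support:
  assumes "\<phi> \<in> normal_homs_neg s" "i \<in> lead_weights" "gen_value s \<phi> i \<noteq> 0"
  shows "s \<le> i \<and> i - s \<in> S"
proof -
  from assms(3) have "s \<le> i" "coeff (\<phi> (affine_gen i)) (i - s) \<noteq> 0"
    by (auto simp: gen_value_def coeff_monom_mult split: if_splits)
  moreover have "\<phi> (affine_gen i) \<in> semigroup_ring"
    using normal_homs_neg_normal[OF assms(1)] affine_gen_in_ideal[OF assms(2)]
    unfolding normal_homs_def by blast
  ultimately show ?thesis by (auto simp: semigroup_ring_def)
qed

section \<open>Values on the generators\<close>

lemma single_affine_trail:
  "single (affine_trail 12) 1 = Var 5 * Var 7" "single (affine_trail 13) 1 = Var 5 * Var 8"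
  "single (affine_trail 14) 1 = Var 6 * Var 8" "single (affine_trail 15) 1 = Var 7 * Var 8"
  "single (affine_trail 16) 1 = Var 8 ^ 2"
  unfolding affine_trail_def xmono_def Var_power by (simp_all add: Var_def mult_single)

lemma affine_gen_Var:
  "affine_gen 12 = Var 6 ^ 2 - Var 5 * Var 7" "affine_gen 13 = Var 6 * Var 7 - Var 5 * Var 8"
  "affine_gen 14 = Var 7 ^ 2 - Var 6 * Var 8" "affine_gen 15 = Var 5 ^ 3 - Var 7 * Var 8"
  "affine_gen 16 = Var 5 ^ 2 * Var 6 - Var 8 ^ 2"
  by (simp_all add: affine_gen_def single_lead_mono single_affine_trail)

text \<open>Write f_i for \<open>affine_gen i\<close>. The syzygies X_7 f_12 + X_5 f_14 = X_6 f_13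
  and X_8 f_15 + X_5^2 f_13 = X_7 f_16 express two values by those at 12, 13 and 15. The same
  relations hold identically for \<open>log_value\<close>.\<close>

lemma gen_value_relations:
  assumes \<phi>: "\<phi> \<in> normal_homs_neg s"
  shows "gen_value s \<phi> 14 = gen_value s \<phi> 13 - gen_value s \<phi> 12"
    and "gen_value s \<phi> 16 = gen_value s \<phi> 15 + gen_value s \<phi> 13"
proof -
  have lin: "ideal_linear \<phi>" by (rule normal_homs_linear[OF normal_homs_neg_normal[OF \<phi>]])
  have mult: "monom 1 s * \<phi> (h * affine_gen i) = pres h * monom (gen_value s \<phi> i) i"
    if "h \<in> polys_in gen_vars" "i \<in> lead_weights" for h i
  proof -
    have "\<phi> (h * affine_gen i) = pres h * \<phi> (affine_gen i)"
      using lin that affine_gen_in_ideal unfolding ideal_linear_def by blast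
    then show ?thesis by (simp add: mult.left_commute flip: hom_gen_value[OF \<phi> that(2)])
  qed
  have rel: "pres g * monom (gen_value s \<phi> i) i + pres h * monom (gen_value s \<phi> j) j
      = pres k * monom (gen_value s \<phi> l) l"
    if eq: "g * affine_gen i + h * affine_gen j = k * affine_gen l"
      and ghk: "g \<in> polys_in gen_vars" "h \<in> polys_in gen_vars" "k \<in> polys_in gen_vars"
      and ijl: "i \<in> lead_weights" "j \<in> lead_weights" "l \<in> lead_weights" for g h k i j l
  proof -
    have "\<phi> (g * affine_gen i + h * affine_gen j) = \<phi> (g * affine_gen i) + \<phi> (h * affine_gen j)"
      using lin pres_ideal_mult affine_gen_in_ideal ghk ijl unfolding ideal_linear_def by blast
    then have "monom 1 s * \<phi> (k * affine_gen l)
        = monom 1 s * (\<phi> (g * affine_gen i) + \<phi> (h * affine_gen j))" by (simp only: eq)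
    then show ?thesis by (simp only: distrib_left mult ghk ijl)
  qed
  note ring = affine_gen_Var power2_eq_square power3_eq_cube algebra_simps
  note eval = pres_simps mult_monom monom_power add_monom algebra_simps
  have "pres (Var 7) * monom (gen_value s \<phi> 12) 12 + pres (Var 5) * monom (gen_value s \<phi> 14) 14
      = pres (Var 6) * monom (gen_value s \<phi> 13) 13"
    by (rule rel, simp add: ring)
      (auto intro: polys_in_Var simp: gen_vars_def lead_weights_def)
  then have "gen_value s \<phi> 12 + gen_value s \<phi> 14 = gen_value s \<phi> 13" by (simp add: eval)
  then show "gen_value s \<phi> 14 = gen_value s \<phi> 13 - gen_value s \<phi> 12" by (simp add: algebra_simps)
  have "pres (Var 8) * monom (gen_value s \<phi> 15) 15 + pres (Var 5 ^ 2) * monom (gen_value s \<phi> 13) 13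
      = pres (Var 7) * monom (gen_value s \<phi> 16) 16"
    by (rule rel, simp add: ring)
      (auto intro: polys_in_Var polys_in_power simp: gen_vars_def lead_weights_def)
  then show "gen_value s \<phi> 16 = gen_value s \<phi> 15 + gen_value s \<phi> 13" by (simp add: eval)
qed

lemma gen_value_log_hom:
  assumes "\<And>i. i \<in> lead_weights \<Longrightarrow> log_value \<beta> i \<noteq> 0 \<Longrightarrow> s \<le> i \<and> i - s \<in> S" "i \<in> lead_weights"
  shows "gen_value s (log_hom s \<beta>) i = log_value \<beta> i"
  using assms(1)[OF assms(2)] affine_gen_in_ideal[OF assms(2)]
  by (cases "log_value \<beta> i = 0")
    (auto simp: gen_value_def log_hom_def log_deriv_affine_gen[OF assms(2)] coeff_monom_mult coeff_poly_shift)

text \<open>The derivation need not be homogeneous: \<beta> extracts its part of degree -s.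
  Multiplying by t^s before reading off a coefficient yields 0 for \<open>n < s\<close>, where the
  exponent \<open>n - s\<close> would be truncated.\<close>

lemma derivation_gen_value:
  assumes \<delta>: "\<delta> \<in> derivations"
  obtains \<beta> where "\<And>n. n \<in> gen_vars \<Longrightarrow> \<beta> n \<noteq> 0 \<Longrightarrow> s \<le> n \<and> n - s \<in> S"
    "\<And>i. i \<in> lead_weights \<Longrightarrow> gen_value s \<delta> i = log_value \<beta> i"
proof -
  define \<beta> where "\<beta> = (\<lambda>n. coeff (monom 1 s * \<delta> (Var n)) n)"
  have v: "Var v \<in> polys_in gen_vars" if "v \<in> gen_vars" for v
    using that by (rule polys_in_Var)
  have ring: "\<delta> p \<in> semigroup_ring" if "p \<in> polys_in gen_vars" for p
    using \<delta> that by (auto simp: derivations_def)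
  have add: "\<delta> (p + q) = \<delta> p + \<delta> q" if "p \<in> polys_in gen_vars" "q \<in> polys_in gen_vars" for p q
    using \<delta> that by (auto simp: derivations_def)
  have mult: "\<delta> (p * q) = pres p * \<delta> q + pres q * \<delta> p"
    if "p \<in> polys_in gen_vars" "q \<in> polys_in gen_vars" for p q
    using \<delta> that by (auto simp: derivations_def)
  have diff: "\<delta> (p - q) = \<delta> p - \<delta> q" if "p \<in> polys_in gen_vars" "q \<in> polys_in gen_vars" for p q
    using add[OF polys_in_diff[OF that] that(2)] by simp
  have supp: "s \<le> n \<and> n - s \<in> S" if "n \<in> gen_vars" "\<beta> n \<noteq> 0" for n
    using that(2) ring[OF v[OF that(1)]]
    by (auto simp: \<beta>_def coeff_monom_mult semigroup_ring_def split: if_splits)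
  have V: "Var 5 \<in> polys_in gen_vars" "Var 6 \<in> polys_in gen_vars" "Var 7 \<in> polys_in gen_vars"
    "Var 8 \<in> polys_in gen_vars" by (rule v, simp add: gen_vars_def)+
  have value_at: "coeff (monom 1 k * \<delta> (Var n)) i = \<beta> n" if "k + n = s + i" for k n i
  proof -
    have "i < k \<longleftrightarrow> n < s" "i - k = n - s" using that by linarith+
    then show ?thesis unfolding \<beta>_def coeff_monom_mult by (simp only:)
  qed
  have merge: "monom 1 k * (monom 1 l * q) = monom 1 (k + l) * q" for k l and q :: "'a poly"
    by (simp add: mult_monom flip: mult.assoc)
  note rules = gen_value_def affine_gen_Var power2_eq_square power3_eq_cube diff mult polys_in_mult V
    pres_simps mult_monom mult_1 distrib_left right_diff_distrib merge coeff_add coeff_diff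
  have "gen_value s \<delta> 12 = log_value \<beta> 12" "gen_value s \<delta> 13 = log_value \<beta> 13"
    "gen_value s \<delta> 14 = log_value \<beta> 14" "gen_value s \<delta> 15 = log_value \<beta> 15"
    "gen_value s \<delta> 16 = log_value \<beta> 16"
    by (simp_all only: rules) (simp_all add: value_at log_value_simps)
  then have "gen_value s \<delta> i = log_value \<beta> i" if "i \<in> lead_weights" for i
    using that by (auto simp: lead_weights_def)
  then show thesis using that supp by blast
qed

section \<open>Linear algebra in each degree\<close>

definition admissible :: "nat \<Rightarrow> (nat \<Rightarrow> 'a::zero) \<Rightarrow> bool" where
  "admissible s \<beta> \<longleftrightarrow> (\<forall>n \<in> gen_vars. \<beta> n \<noteq> 0 \<longrightarrow> s \<le> n \<and> n - s \<in> S)"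

text \<open>Together with \<open>t1_class_eq_gen_value\<close> this replaces equality of classes in
  degree -s by a linear condition: the values on the generators differ by those of an admissible
  vector.\<close>

lemma t1_class_eq_admissible:
  assumes \<phi>: "\<phi> \<in> normal_homs_neg s" and \<psi>: "\<psi> \<in> normal_homs_neg s" and adm: "admissible s \<beta>"
    and eq: "\<And>i. i \<in> lead_weights \<Longrightarrow> gen_value s \<phi> i = gen_value s \<psi> i + log_value \<beta> i"
  shows "t1_class \<phi> = t1_class \<psi>"
proof -
  let ?d = "\<lambda>p. poly_shift s (log_deriv \<beta> p)"
  have d: "?d \<in> derivations"
    by (rule log_deriv_derivation) (use adm in \<open>auto simp: admissible_def\<close>)
  have lin: "ideal_linear \<phi>" "ideal_linear \<psi>" "ideal_linear ?d"
    using \<phi> \<psi> d by (auto intro: normal_homs_linear derivations_linear normal_homs_neg_normal)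
  from lin(2,3) have lin': "ideal_linear (\<lambda>p. \<psi> p + ?d p)"
    unfolding ideal_linear_def by (auto simp: algebra_simps)
  have "\<phi> (affine_gen i) = \<psi> (affine_gen i) + ?d (affine_gen i)" if i: "i \<in> lead_weights" for i
  proof -
    have "\<exists>r \<in> semigroup_ring. log_deriv \<beta> (affine_gen i) = monom 1 s * r"
      by (rule log_deriv_polys[OF _ affine_gen_polys]) (use adm in \<open>auto simp: admissible_def\<close>)
    then have "monom 1 s * ?d (affine_gen i) = monom (log_value \<beta> i) i"
      using log_deriv_affine_gen[OF i, of \<beta>] by (auto simp: poly_shift_monom_mult)
    then have "monom 1 s * \<phi> (affine_gen i) = monom 1 s * (\<psi> (affine_gen i) + ?d (affine_gen i))"
      by (simp add: hom_gen_value[OF \<phi> i] hom_gen_value[OF \<psi> i] eq[OF i] distrib_left add_monom)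
    then show ?thesis by (simp only: mult_cancel_left monom_eq_0_iff) simp
  qed
  then have "\<phi> p = \<psi> p + ?d p" if "p \<in> pres_ideal" for p
    by (rule ideal_linear_eqI[OF lin(1) lin' _ that])
  then show ?thesis by (rule t1_class_eqI[OF d])
qed

lemma t1_class_eq_gen_value:
  assumes "\<phi> \<in> normal_homs_neg s" "t1_class \<phi> = t1_class \<psi>"
  obtains \<beta> where "admissible s \<beta>"
    "\<And>i. i \<in> lead_weights \<Longrightarrow> gen_value s \<phi> i = gen_value s \<psi> i + log_value \<beta> i"
proof -
  have "\<phi> \<in> t1_class \<psi>" using t1_class_refl[OF normal_homs_neg_normal[OF assms(1)]] assms(2) by simp
  then obtain \<delta> where \<delta>: "\<delta> \<in> derivations" "\<forall>p \<in> pres_ideal. \<phi> p = \<psi> p + \<delta> p"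
    by (auto simp: t1_class_def)
  obtain \<beta> where \<beta>: "\<And>n. n \<in> gen_vars \<Longrightarrow> \<beta> n \<noteq> 0 \<Longrightarrow> s \<le> n \<and> n - s \<in> S"
    "\<And>i. i \<in> lead_weights \<Longrightarrow> gen_value s \<delta> i = log_value \<beta> i"
    using derivation_gen_value[OF \<delta>(1), of s] by blast
  have "gen_value s \<phi> i = gen_value s \<psi> i + log_value \<beta> i" if "i \<in> lead_weights" for i
  proof -
    have "\<phi> (affine_gen i) = \<psi> (affine_gen i) + \<delta> (affine_gen i)"
      using \<delta>(2) affine_gen_in_ideal[OF that] by blast
    then show ?thesis using \<beta>(2)[OF that] unfolding gen_value_def by (simp add: distrib_left)
  qed
  then show thesis using that \<beta>(1) unfolding admissible_def by blast
qed

text \<open>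
  Admissible vectors are those of derivations of degree \<open>-s\<close>. In every degree the following linear
  forms span the forms on the values \<open>g i\<close> of homomorphisms that vanish on derivations.
\<close>

definition t1_coord :: "nat \<Rightarrow> (nat \<Rightarrow> 'a::field) \<Rightarrow> 'a" where
  "t1_coord k g = (if k = 0 then g 15 - 2 * g 12 - g 13 else if k = 1 \<or> k = 7 then g 15 - g 13
     else if k = 2 then g 12 else if k = 4 then 3 * g 12 + g 15 else if k = 5 then g 12 - 2 * g 13
     else if k = 6 then g 12 + g 13 else g 15)"

lemma t1_coord_add: "t1_coord k (\<lambda>i. g i + h i) = t1_coord k g + t1_coord k h"
  by (simp add: t1_coord_def algebra_simps)

lemma t1_coord_smult: "t1_coord k (\<lambda>i. c * g i) = c * t1_coord k g"
  by (simp add: t1_coord_def algebra_simps)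

lemma t1_coord_sum: "t1_coord k (\<lambda>i. \<Sum>j\<in>A. c j * g j i) = (\<Sum>j\<in>A. c j * t1_coord k (g j))"
proof (induction A rule: infinite_finite_induct)
  case (insert j A)
  have "t1_coord k (\<lambda>i. \<Sum>j\<in>insert j A. c j * g j i)
      = t1_coord k (\<lambda>i. c j * g j i + (\<Sum>j\<in>A. c j * g j i))"
    using insert.hyps by simp
  then show ?case using insert by (simp only: t1_coord_add t1_coord_smult) simp
qed (simp_all add: t1_coord_def)

lemma t1_coord_cong:
  "(\<And>i. i \<in> lead_weights \<Longrightarrow> g i = h i) \<Longrightarrow> t1_coord k g = t1_coord k h"
  by (simp add: t1_coord_def lead_weights_def)

lemma t1_coord_admissible:
  assumes "k < 10" "admissible (param_weight k) \<beta>"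
  shows "t1_coord k (log_value \<beta>) = 0"
  using less_10_cases[OF assms(1)] assms(2)
  by (elim insertE emptyE)
    (auto simp: admissible_def gen_vars_def param_weight_def S_iff t1_coord_def log_value_simps algebra_simps)

text \<open>The two solutions with \<open>\<beta> 5 = 0\<close> whose values at 12, 13, 15 are (1,
  0, 0) and (0, 0, 1). Weight 4 needs both, for \<open>k = 2\<close> and \<open>k = 3\<close>. For
  \<open>k = 5\<close> and \<open>k = 6\<close> the second is impossible: its values at 15 and 16
  would have to sit at 15 - 6 = 9 and 16 - 7 = 9, a gap of \<open>S\<close>.\<close>

definition basis_vector :: "nat \<Rightarrow> nat \<Rightarrow> 'a::field" where
  "basis_vector k n = (if k \<in> {2, 5, 6}
     then (if n = 6 then 2 / 5 else if n = 7 then - 1 / 5 else if n = 8 then 1 / 5 else 0)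
     else (if n = 6 then - 1 / 5 else if n = 7 then - 2 / 5 else if n = 8 then - 3 / 5 else 0))"

definition weight_indices :: "nat \<Rightarrow> nat set" where
  "weight_indices s = {k. k < 10 \<and> param_weight k = s}"

lemma param_weight_simps:
  "param_weight 0 = 2" "param_weight (Suc 0) = 3" "param_weight 2 = 4" "param_weight 3 = 4"
  "param_weight 4 = 5" "param_weight 5 = 6" "param_weight 6 = 7" "param_weight 7 = 8"
  "param_weight 8 = 9" "param_weight 9 = 10"
  by (simp_all add: param_weight_def)

lemma weight_indices_eq:
  "weight_indices s = (if s = 2 then {0} else if s = 3 then {1} else if s = 4 then {2, 3}
     else if s = 5 then {4} else if s = 6 then {5} else if s = 7 then {6} else if s = 8 then {7}
     else if s = 9 then {8} else if s = 10 then {9} else {})"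
proof -
  have eq: "weight_indices s = {k. k \<in> {0, 1, 2, 3, 4, 5, 6, 7, 8, 9} \<and> param_weight k = s}"
    unfolding weight_indices_def using less_10_cases by auto
  consider "s = 2" | "s = 3" | "s = 4" | "s = 5" | "s = 6" | "s = 7" | "s = 8" | "s = 9" | "s = 10"
    | "s \<notin> {2, 3, 4, 5, 6, 7, 8, 9, 10}" by blast
  then show ?thesis
  proof cases
    case 10
    have "param_weight k \<in> {2, 3, 4, 5, 6, 7, 8, 9, 10}" if "k < 10" for k
      using less_10_cases[OF that] by (elim insertE emptyE) (simp_all add: param_weight_simps)
    then have "weight_indices s = {}" using 10 unfolding weight_indices_def by blast
    then show ?thesis using 10 by simp
  qed (unfold eq, auto simp: param_weight_simps)
qed

lemma finite_weight_indices [simp]: "finite (weight_indices s)"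
  by (simp add: weight_indices_def)

context
  assumes five: "(5 :: 'a::field) \<noteq> 0"
begin

lemma twenty_five: "(25 :: 'a) \<noteq> 0"
proof -
  have "(5 :: 'a) * 5 \<noteq> 0" using five by (simp only: mult_eq_0_iff) simp
  then show ?thesis by simp
qed

lemma log_value_basis_vector:
  "log_value (basis_vector k :: nat \<Rightarrow> 'a) 12 = (if k \<in> {2, 5, 6} then 1 else 0)"
  "log_value (basis_vector k :: nat \<Rightarrow> 'a) 13 = 0"
  "log_value (basis_vector k :: nat \<Rightarrow> 'a) 14 = (if k \<in> {2, 5, 6} then - 1 else 0)"
  "log_value (basis_vector k :: nat \<Rightarrow> 'a) 15 = (if k \<in> {2, 5, 6} then 0 else 1)"
  "log_value (basis_vector k :: nat \<Rightarrow> 'a) 16 = (if k \<in> {2, 5, 6} then 0 else 1)"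
  using five twenty_five by (simp_all add: log_value_simps basis_vector_def field_simps)

definition basis_hom :: "nat \<Rightarrow> (nat, 'a) mpoly \<Rightarrow> 'a poly" where
  "basis_hom k = log_hom (param_weight k) (basis_vector k)"

lemma basis_vector_support:
  assumes "k < 10" "i \<in> lead_weights" "log_value (basis_vector k :: nat \<Rightarrow> 'a) i \<noteq> 0"
  shows "param_weight k \<le> i \<and> i - param_weight k \<in> S"
  using less_10_cases[OF assms(1)] assms(2,3)
  by (elim insertE emptyE) (auto simp: lead_weights_def log_value_basis_vector param_weight_def S_iff)

lemma basis_hom_normal: "k < 10 \<Longrightarrow> basis_hom k \<in> normal_homs_neg (param_weight k)"
  unfolding basis_hom_def by (rule log_hom_normal) (rule basis_vector_support)

lemma gen_value_basis_hom:
  assumes "k < 10" "i \<in> lead_weights"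
  shows "gen_value (param_weight k) (basis_hom k) i = log_value (basis_vector k) i"
  unfolding basis_hom_def using basis_vector_support[OF assms(1)] assms(2) by (rule gen_value_log_hom)

lemma t1_coord_basis_vector:
  assumes "j < 10" "k < 10" "param_weight j = param_weight k"
  shows "t1_coord j (log_value (basis_vector k :: nat \<Rightarrow> 'a)) = (if j = k then 1 else 0)"
  using less_10_cases[OF assms(1)] less_10_cases[OF assms(2)] assms(3)
  by (elim insertE emptyE) (simp_all add: param_weight_def t1_coord_def log_value_basis_vector)

text \<open>The combination of basis vectors matches the forms \<open>t1_coord\<close> on \<phi>, so
  the rest must come from an admissible vector. In each degree gaps of \<open>S\<close> force some
  values to vanish, and the witness solves the three remaining equations in the entries \<beta> n
  that are allowed in this degree.\<close>

lemma gen_value_span: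
  fixes \<phi> :: "(nat, 'a) mpoly \<Rightarrow> 'a poly"
  assumes \<phi>: "\<phi> \<in> normal_homs_neg s" and s: "1 \<le> s"
  obtains \<beta> where "admissible s \<beta>" "\<And>i. i \<in> lead_weights \<Longrightarrow> gen_value s \<phi> i =
      (\<Sum>k\<in>weight_indices s. t1_coord k (gen_value s \<phi>) * log_value (basis_vector k) i) + log_value \<beta> i"
proof -
  define g where "g = gen_value s \<phi>"
  define c where "c = (\<lambda>i. \<Sum>k\<in>weight_indices s. t1_coord k g * log_value (basis_vector k) i)"
  have g: "g 14 = g 13 - g 12" "g 16 = g 15 + g 13"
    using gen_value_relations[OF \<phi>] by (simp_all add: g_def)
  have supp: "g i = 0" if "i \<in> lead_weights" "i < s \<or> i - s \<notin> S" for i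
    using gen_value_support[OF \<phi> that(1)] that(2) unfolding g_def by (meson not_less)
  have l: "log_value \<beta> 14 = log_value \<beta> 13 - log_value \<beta> 12" "log_value \<beta> 16 = log_value \<beta> 15 + log_value \<beta> 13"
    for \<beta> :: "nat \<Rightarrow> 'a" by (simp_all add: log_value_simps)
  have c: "c 14 = c 13 - c 12" "c 16 = c 15 + c 13"
    unfolding c_def by (simp_all add: l[of "basis_vector _"] algebra_simps sum.distrib sum_subtractf)
  have reduce: "\<exists>\<beta>. admissible s \<beta> \<and> (\<forall>i \<in> lead_weights. g i = c i + log_value \<beta> i)"
    if "admissible s \<beta>" "g 12 = c 12 + (2 * \<beta> 6 - \<beta> 5 - \<beta> 7)"
      "g 13 = c 13 + (\<beta> 6 + \<beta> 7 - \<beta> 5 - \<beta> 8)" "g 15 = c 15 + (3 * \<beta> 5 - \<beta> 7 - \<beta> 8)" for \<beta>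
    using that unfolding log_value_simps[symmetric]
    by (intro exI[of _ \<beta>]) (auto simp: lead_weights_def g c l[of \<beta>] algebra_simps)
  have "\<exists>\<beta>. admissible s \<beta> \<and> (\<forall>i \<in> lead_weights. g i = c i + log_value \<beta> i)"
  proof -
    note defs = c_def weight_indices_eq t1_coord_def log_value_basis_vector admissible_def gen_vars_def S_iff
    have z: "i \<in> {12, 13, 14, 15, 16} \<Longrightarrow> i < s \<or> i - s \<notin> S \<Longrightarrow> g i = 0" for i
      by (rule supp) (simp add: lead_weights_def)
    consider "s = 1" | "s = 2" | "s = 3" | "s = 4" | "s = 5" | "s = 6" | "s = 7" | "s = 8"
      | "s = 9" | "s = 10" | "11 \<le> s"
    proof (cases "11 \<le> s")
      case False
      then have "s - 1 < 10" by simp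
      from less_10_cases[OF this] s that show ?thesis by auto
    qed (use that in blast)
    then show ?thesis
    proof cases
      case 1
      \<comment> \<open>In degree -1 the entries at 6, 7 and 8 are free and no basis vector is
        available, so the full 3 x 3 system has to be solved; 5 is its determinant up to
        sign.\<close>
      define x where "x = (2 * g 12 + g 13 - g 15) / 5"
      have x: "5 * x = 2 * g 12 + g 13 - g 15" using five by (simp add: x_def)
      show ?thesis
        by (rule reduce[of "\<lambda>n. if n = 6 then x else if n = 7 then 2 * x - g 12
            else if n = 8 then 3 * x - g 12 - g 13 else 0"])
          (use x 1 in \<open>simp_all add: defs algebra_simps\<close>)
    next
      case 2
      show ?thesis
        by (rule reduce[of "\<lambda>n. if n = 7 then - g 12 else if n = 8 then - g 12 - g 13 else 0"])
          (use 2 in \<open>simp_all add: defs algebra_simps\<close>)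
    next
      case 3
      have "g 12 = 0" using z[of 12] 3 by (simp add: S_iff)
      then show ?thesis
        by (intro reduce[of "\<lambda>n. if n = 8 then - g 13 else 0"]) (use 3 in \<open>simp_all add: defs algebra_simps\<close>)
    next
      case 4
      have "g 13 = 0" using z[of 13] 4 by (simp add: S_iff)
      then show ?thesis
        by (intro reduce[of "\<lambda>_. 0"]) (use 4 in \<open>simp_all add: defs algebra_simps\<close>)
    next
      case 5
      have "g 14 = 0" using z[of 14] 5 by (simp add: S_iff)
      then have "g 13 = g 12" using g by simp
      then show ?thesis
        by (intro reduce[of "\<lambda>n. if n = 5 then - g 12 else 0"]) (use 5 in \<open>simp_all add: defs algebra_simps\<close>)
    next
      case 6
      have "g 15 = 0" using z[of 15] 6 by (simp add: S_iff)
      then show ?thesis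
        by (intro reduce[of "\<lambda>n. if n = 6 then g 13 else 0"]) (use 6 in \<open>simp_all add: defs algebra_simps\<close>)
    next
      case 7
      have "g 16 = 0" using z[of 16] 7 by (simp add: S_iff)
      then have "g 15 = - g 13" using g by (simp add: eq_neg_iff_add_eq_0)
      then show ?thesis
        by (intro reduce[of "\<lambda>n. if n = 7 then g 13 else 0"]) (use 7 in \<open>simp_all add: defs algebra_simps\<close>)
    next
      case 8
      have "g 12 = 0" using z[of 12] 8 by (simp add: S_iff)
      then show ?thesis
        by (intro reduce[of "\<lambda>n. if n = 8 then - g 13 else 0"]) (use 8 in \<open>simp_all add: defs algebra_simps\<close>)
    next
      case 9
      have "g 12 = 0" "g 13 = 0" using z[of 12] z[of 13] 9 by (simp_all add: S_iff)
      then show ?thesis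
        by (intro reduce[of "\<lambda>_. 0"]) (use 9 in \<open>simp_all add: defs algebra_simps\<close>)
    next
      case 10
      have "g 12 = 0" "g 13 = 0" using z[of 12] z[of 13] 10 by (simp_all add: S_iff)
      then show ?thesis
        by (intro reduce[of "\<lambda>_. 0"]) (use 10 in \<open>simp_all add: defs algebra_simps\<close>)
    next
      case 11
      \<comment> \<open>For these \<open>s\<close> the value on a generator of weight at most 15 can
        be nonzero only if its weight is \<open>s\<close>. Each relation among the values involves
        three distinct weights, so it kills that value as well.\<close>
      have zz: "g i = 0" if i: "i \<in> {12, 13, 14, 15}" "s \<noteq> i" for i
      proof (rule z)
        show "i < s \<or> i - s \<notin> S"
        proof (cases "i < s")
          case False
          then have "0 < i - s" "i - s < 5" using i 11 by auto
          then show ?thesis by (auto simp: S_iff)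
        qed simp
      qed (use i in auto)
      have "g 16 = 0" if "s = 15" using z[of 16] that by (simp add: S_iff)
      then have "g 15 = 0" using zz[of 13] zz[of 15] g(2) by fastforce
      moreover have "g 12 = 0" using zz[of 12] zz[of 13] zz[of 14] g(1) by fastforce
      moreover have "g 13 = 0" using zz[of 12] zz[of 13] zz[of 14] g(1) by fastforce
      ultimately have "g 12 = 0" "g 13 = 0" "g 15 = 0" by blast+
      then show ?thesis
        by (intro reduce[of "\<lambda>_. 0"]) (use 11 in \<open>simp_all add: defs algebra_simps\<close>)
    qed
  qed
  then show thesis using that unfolding g_def c_def by blast
qed

text \<open>The representative is arbitrary: two of degree -s in one class differ on the generators
  by an admissible vector, on which \<open>t1_coord\<close> vanishes.\<close>

definition t1_functional :: "nat \<Rightarrow> ((nat, 'a) mpoly \<Rightarrow> 'a poly) set \<Rightarrow> 'a" where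
  "t1_functional k C =
     t1_coord k (gen_value (param_weight k) (SOME \<phi>. \<phi> \<in> C \<inter> normal_homs_neg (param_weight k)))"

lemma t1_functional_class:
  assumes k: "k < 10" and \<phi>: "\<phi> \<in> normal_homs_neg (param_weight k)"
  shows "t1_functional k (t1_class \<phi>) = t1_coord k (gen_value (param_weight k) \<phi>)"
proof -
  let ?s = "param_weight k"
  define \<psi> where "\<psi> = (SOME \<psi>. \<psi> \<in> t1_class \<phi> \<inter> normal_homs_neg ?s)"
  have "\<phi> \<in> t1_class \<phi> \<inter> normal_homs_neg ?s"
    using \<phi> t1_class_refl[OF normal_homs_neg_normal[OF \<phi>]] by blast
  then have \<psi>: "\<psi> \<in> t1_class \<phi> \<inter> normal_homs_neg ?s" 
    unfolding \<psi>_def by (rule someI[of "\<lambda>\<psi>. \<psi> \<in> t1_class \<phi> \<inter> normal_homs_neg ?s"])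
  then have "t1_class \<psi> = t1_class \<phi>" using t1_class_mem by blast
  then obtain \<beta> where \<beta>: "admissible ?s \<beta>"
    "\<And>i. i \<in> lead_weights \<Longrightarrow> gen_value ?s \<psi> i = gen_value ?s \<phi> i + log_value \<beta> i"
    using t1_class_eq_gen_value[of \<psi> ?s \<phi>] \<psi> by blast
  have "t1_coord k (gen_value ?s \<psi>) = t1_coord k (\<lambda>i. gen_value ?s \<phi> i + log_value \<beta> i)"
    by (rule t1_coord_cong) (rule \<beta>(2))
  also have "\<dots> = t1_coord k (gen_value ?s \<phi>)"
    unfolding t1_coord_add t1_coord_admissible[OF k \<beta>(1)] by simp
  finally show ?thesis by (simp add: t1_functional_def \<psi>_def)
qed

lemma t1_functional_linear:
  assumes k: "k < 10"
  shows "T1_linear (param_weight k) (t1_functional k)"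
  unfolding T1_linear_def
proof (intro conjI ballI allI)
  fix \<phi> \<psi> :: "(nat, 'a) mpoly \<Rightarrow> 'a poly" and c :: 'a
  assume \<phi>: "\<phi> \<in> normal_homs_neg (param_weight k)"
  show "t1_functional k (t1_class (\<lambda>p. smult c (\<phi> p))) = c * t1_functional k (t1_class \<phi>)"
    using t1_functional_class[OF k] \<phi> normal_homs_neg_smult[OF \<phi>]
    by (simp add: gen_value_smult[abs_def] t1_coord_smult)
  assume \<psi>: "\<psi> \<in> normal_homs_neg (param_weight k)"
  show "t1_functional k (t1_class (\<lambda>p. \<phi> p + \<psi> p)) = t1_functional k (t1_class \<phi>) + t1_functional k (t1_class \<psi>)"
    using t1_functional_class[OF k] \<phi> \<psi> normal_homs_neg_add[OF \<phi> \<psi>]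
    by (simp add: gen_value_add[abs_def] t1_coord_add)
qed

section \<open>Coordinates on the negatively graded part\<close>

definition comb_hom :: "(nat \<Rightarrow> 'a) \<Rightarrow> nat \<Rightarrow> (nat, 'a) mpoly \<Rightarrow> 'a poly" where
  "comb_hom a s = (\<lambda>p. \<Sum>k\<in>weight_indices s. smult (a k) (basis_hom k p))"

lemma comb_hom_normal: "comb_hom a s \<in> normal_homs_neg s"
  unfolding comb_hom_def
proof (rule normal_homs_neg_sum)
  fix k assume "k \<in> weight_indices s"
  then show "(\<lambda>p. smult (a k) (basis_hom k p)) \<in> normal_homs_neg s"
    using normal_homs_neg_smult[OF basis_hom_normal] by (auto simp: weight_indices_def)
qed

lemma gen_value_comb_hom:
  assumes "i \<in> lead_weights"
  shows "gen_value s (comb_hom a s) i = (\<Sum>k\<in>weight_indices s. a k * log_value (basis_vector k) i)"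
  unfolding comb_hom_def gen_value_sum gen_value_smult
  using gen_value_basis_hom assms by (intro sum.cong) (auto simp: weight_indices_def)

lemma t1_coord_comb_hom:
  assumes j: "j < 10"
  shows "t1_coord j (gen_value (param_weight j) (comb_hom a (param_weight j))) = a j"
proof -
  let ?s = "param_weight j"
  have "t1_coord j (gen_value ?s (comb_hom a ?s))
      = t1_coord j (\<lambda>i. \<Sum>k\<in>weight_indices ?s. a k * log_value (basis_vector k) i)"
    by (rule t1_coord_cong) (rule gen_value_comb_hom)
  also have "\<dots> = (\<Sum>k\<in>weight_indices ?s. a k * t1_coord j (log_value (basis_vector k)))"
    by (rule t1_coord_sum)
  also have "\<dots> = (\<Sum>k\<in>weight_indices ?s. if k = j then a k else 0)"
    using t1_coord_basis_vector[OF j] by (intro sum.cong) (auto simp: weight_indices_def)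
  also have "\<dots> = a j" using j by (simp add: weight_indices_def)
  finally show ?thesis .
qed

definition t1_point :: "(nat \<Rightarrow> 'a) \<Rightarrow> nat \<Rightarrow> ((nat, 'a) mpoly \<Rightarrow> 'a poly) set" where
  "t1_point a s = t1_class (comb_hom a s)"

definition t1_params :: "(nat \<Rightarrow> ((nat, 'a) mpoly \<Rightarrow> 'a poly) set) \<Rightarrow> nat \<Rightarrow> 'a" where
  "t1_params v = (\<lambda>k. if k < 10 then t1_functional k (v (param_weight k)) else 0)"

lemma t1_point_trivial: "weight_indices s = {} \<Longrightarrow> t1_point a s = T1_zero"
  by (simp add: t1_point_def comb_hom_def T1_zero_def)

lemma t1_point_mem: "t1_point a \<in> cone_set T1_minus"
proof -
  have "finite {s. t1_point a s \<noteq> T1_zero}"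
    by (rule finite_subset[of _ "{2..10}"]) (auto intro!: t1_point_trivial simp: weight_indices_eq)
  moreover have "t1_point a 0 = T1_zero"
    by (rule t1_point_trivial) (simp add: weight_indices_eq)
  moreover have "t1_point a s \<in> T1_neg s" for s
    unfolding t1_point_def by (rule T1_neg_class[OF comb_hom_normal])
  ultimately show ?thesis by (simp add: T1_minus_def)
qed

lemma t1_params_point: "a \<in> cone_set param_cone \<Longrightarrow> t1_params (t1_point a) = a"
  by (rule ext) (auto simp: t1_params_def t1_point_def t1_functional_class comb_hom_normal
      t1_coord_comb_hom affine_cone_def)

text \<open>Every class of degree -s contains a combination of the basis homomorphisms, because
  \<open>gen_value_span\<close> supplies the derivation that connects the two.\<close>

lemma t1_point_params:
  assumes v: "v \<in> cone_set T1_minus"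
  shows "t1_point (t1_params v) = v"
proof
  fix s
  show "t1_point (t1_params v) s = v s"
  proof (cases "s = 0")
    case True
    then show ?thesis using v t1_point_trivial[of 0] by (simp add: T1_minus_def weight_indices_eq)
  next
    case False
    then have s: "1 \<le> s" by simp
    then have "v s \<in> T1_neg s" using v by (simp add: T1_minus_def)
    then obtain \<phi> where \<phi>: "\<phi> \<in> normal_homs_neg s" "v s = t1_class \<phi>" by (rule T1_negE)
    obtain \<beta> where \<beta>: "admissible s \<beta>" "\<And>i. i \<in> lead_weights \<Longrightarrow> gen_value s \<phi> i =
      (\<Sum>k\<in>weight_indices s. t1_coord k (gen_value s \<phi>) * log_value (basis_vector k) i) + log_value \<beta> i"
      by (rule gen_value_span[OF \<phi>(1) s]) blast
    have "t1_params v k = t1_coord k (gen_value s \<phi>)" if "k \<in> weight_indices s" for k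
      using that \<phi> t1_functional_class[of k \<phi>] by (auto simp: t1_params_def weight_indices_def)
    then have "gen_value s \<phi> i = gen_value s (comb_hom (t1_params v) s) i + log_value \<beta> i"
      if "i \<in> lead_weights" for i
      using \<beta>(2)[OF that] gen_value_comb_hom[OF that] by simp
    from t1_class_eq_admissible[OF \<phi>(1) comb_hom_normal \<beta>(1) this]
    show ?thesis by (simp add: t1_point_def \<phi>(2))
  qed
qed

lemma qhom_sum:
  "finite A \<Longrightarrow> (\<And>k. k \<in> A \<Longrightarrow> qhom L d (f k)) \<Longrightarrow> qhom L d (\<lambda>x. \<Sum>k\<in>A. f k x)"
  by (induction A rule: finite_induct) (auto intro: qhom.intros)

text \<open>Linearity of \<open>l\<close> is assumed on classes of homomorphisms of degree -s only,
  so the sum is built up one summand at a time within that degree.\<close>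

lemma T1_linear_comb:
  assumes l: "T1_linear s l"
  shows "l (t1_point a s) = (\<Sum>k\<in>weight_indices s. a k * l (t1_class (basis_hom k)))"
proof -
  have b: "basis_hom k \<in> normal_homs_neg s" if "k \<in> weight_indices s" for k
    using that basis_hom_normal[of k] by (auto simp: weight_indices_def)
  have add: "l (t1_class (\<lambda>p. \<phi> p + \<psi> p)) = l (t1_class \<phi>) + l (t1_class \<psi>)"
    if "\<phi> \<in> normal_homs_neg s" "\<psi> \<in> normal_homs_neg s" for \<phi> \<psi>
    using l that unfolding T1_linear_def by blast
  have scale: "l (t1_class (\<lambda>p. smult c (\<phi> p))) = c * l (t1_class \<phi>)" if "\<phi> \<in> normal_homs_neg s" for c \<phi>
    using l that unfolding T1_linear_def by blast
  have "l (t1_class (\<lambda>p. \<Sum>k\<in>A. smult (a k) (basis_hom k p))) = (\<Sum>k\<in>A. a k * l (t1_class (basis_hom k)))"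
    if "finite A" "A \<subseteq> weight_indices s" for A
    using that
  proof (induction A)
    case empty
    show ?case using scale[OF normal_homs_neg_zero, of 0] by simp
  next
    case (insert k A)
    have "(\<lambda>p. \<Sum>k\<in>A. smult (a k) (basis_hom k p)) \<in> normal_homs_neg s"
      using insert.prems by (intro normal_homs_neg_sum normal_homs_neg_smult b) auto
    moreover have "(\<lambda>p. smult (a k) (basis_hom k p)) \<in> normal_homs_neg s"
      using insert.prems by (intro normal_homs_neg_smult b) auto
    ultimately show ?case
      using insert add scale[OF b, of k "a k"] by simp
  qed
  then show ?thesis by (simp add: t1_point_def comb_hom_def)
qed

lemma cone_iso_T1_minus: "cone_iso param_cone T1_minus t1_point"
proof -
  have "quasi_cone_iso param_cone T1_minus t1_point"
  proof (rule quasi_cone_isoI)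
    show "bij_betw t1_point (cone_set param_cone) (cone_set T1_minus)"
    proof (rule bij_betw_byWitness[where f' = t1_params])
      show "t1_params ` cone_set T1_minus \<subseteq> cone_set param_cone"
        by (auto simp: t1_params_def affine_cone_def)
    qed (use t1_params_point t1_point_params t1_point_mem in auto)
  next
    fix c :: 'a and a :: "nat \<Rightarrow> 'a" assume c: "c \<noteq> 0"
    have "comb_hom (cone_act param_cone c a) s = (\<lambda>p. smult (c ^ s) (comb_hom a s p))" for s
      unfolding comb_hom_def
      by (rule ext, rule poly_eqI)
        (auto simp: coeff_sum sum_distrib_left affine_cone_def weight_indices_def intro!: sum.cong)
    then show "t1_point (cone_act param_cone c a) = cone_act T1_minus c (t1_point a)"
      using c by (simp add: t1_point_def[abs_def] T1_minus_def T1_scale_class)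
  next
    fix s and l :: "(nat \<Rightarrow> ((nat, 'a) mpoly \<Rightarrow> 'a poly) set) \<Rightarrow> 'a"
    assume "l \<in> cone_coords T1_minus s"
    then obtain l' where l: "l = (\<lambda>v. l' (v s))" "T1_linear s l'" by (auto simp: T1_minus_def)
    have "qhom (cone_coords param_cone) s (\<lambda>a. \<Sum>k\<in>weight_indices s. a k * l' (t1_class (basis_hom k)))"
    proof (rule qhom_sum)
      fix k assume "k \<in> weight_indices s"
      then have "qhom (cone_coords param_cone) s (\<lambda>a :: nat \<Rightarrow> 'a. a k)"
        by (intro qhom_param) (auto simp: weight_indices_def)
      then show "qhom (cone_coords param_cone) s (\<lambda>a. a k * l' (t1_class (basis_hom k)))"
        by (rule qhom_mult_eq[OF _ qhom.const]) simp
    qed simp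
    then show "\<exists>g. qhom (cone_coords param_cone) s g \<and> (\<forall>a \<in> cone_set param_cone. g a = l (t1_point a))"
      using T1_linear_comb[OF l(2)] l(1) by (intro exI conjI) auto
  next
    fix s and l :: "(nat \<Rightarrow> 'a) \<Rightarrow> 'a"
    assume "l \<in> cone_coords param_cone s"
    then obtain k where k: "k < 10" "param_weight k = s" "l = (\<lambda>a. a k)" by (auto simp: affine_cone_def)
    have "1 \<le> s" using less_10_cases[OF k(1)] k(2) by (auto simp: param_weight_def)
    then have "(\<lambda>v. t1_functional k (v s)) \<in> cone_coords T1_minus s"
      using t1_functional_linear[OF k(1)] k(2) by (auto simp: T1_minus_def)
    then have "qhom (cone_coords T1_minus) s (\<lambda>v. t1_functional k (v s))" by (rule qhom.coord)
    moreover have "l a = t1_functional k (t1_point a s)" if "a \<in> cone_set param_cone" for a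
      using fun_cong[OF t1_params_point[OF that], of k] k by (simp add: t1_params_def)
    ultimately show "\<exists>f. qhom (cone_coords T1_minus) s f \<and> (\<forall>a \<in> cone_set param_cone. l a = f (t1_point a))"
      by blast
  qed
  moreover have "t1_point (\<lambda>_. 0) = (\<lambda>_. T1_zero)"
    by (rule ext) (simp add: t1_point_def comb_hom_def T1_zero_def)
  then have "t1_point (cone_apex param_cone) = cone_apex T1_minus"
    by (simp add: affine_cone_def T1_minus_def)
  ultimately show ?thesis
    unfolding cone_iso_def by (auto simp: affine_cone_def)
qed

end

theorem mainTheorem3:
  assumes "CHAR('k::alg_closed_field) = 0 \<or>
    prime CHAR('k) \<and>
    (\<forall>m \<in> {0, 5, 6, 7, 8::nat}. \<forall>n \<in> {0, 5, 6, 7, 8}. m < n \<longrightarrow> \<not> CHAR('k) dvd n - m)"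
  shows "(\<exists>R :: nat \<Rightarrow> 'k family_poly. syzygy_remainders R) \<and>
    (\<forall>R :: nat \<Rightarrow> 'k family_poly. syzygy_remainders R \<longrightarrow>
      (\<exists>\<Phi>. quasi_cone_iso (moduli_cone R) T1_minus \<Phi> \<and>
           variety_iso (moduli_space R) (wproj T1_minus) (\<lambda>P. \<Phi> ` P))) \<and>
    isomorphic_varieties
      (wproj (T1_minus :: (_, 'k) quasi_cone))
      (wproj (affine_cone {..<10} (\<lambda>i. [2, 3, 4, 4, 5, 6, 7, 8, 9, 10] ! i)))"
proof (intro conjI allI impI)
  show "\<exists>R :: nat \<Rightarrow> 'k family_poly. syzygy_remainders R"
    by (rule syzygy_remainders_exist)
  \<comment> \<open>The pair 0, 5 in the assumption; in characteristic 0 this says that 0 does not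
    divide 5.\<close>
  have "\<not> CHAR('k) dvd 5" using assms by auto
  then have five: "(5 :: 'k) \<noteq> 0"
    using of_nat_eq_0_iff_char_dvd[of 5, where 'a = 'k] by simp
  note T1 = cone_iso_T1_minus[OF five]
  show "\<exists>\<Phi>. quasi_cone_iso (moduli_cone R) T1_minus \<Phi> \<and>
      variety_iso (moduli_space R) (wproj T1_minus) (\<lambda>P. \<Phi> ` P)"
    if R: "syzygy_remainders R" for R :: "nat \<Rightarrow> 'k family_poly"
  proof -
    have "cone_iso (moduli_cone R) T1_minus (t1_point \<circ> params_of)"
      by (rule cone_iso_comp[OF moduli_cone_iso_params[OF R] T1])
    then show ?thesis
      using cone_iso_variety_iso unfolding moduli_space_def cone_iso_def by blast
  qed
  show "isomorphic_varieties (wproj (T1_minus :: (_, 'k) quasi_cone))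
      (wproj (affine_cone {..<10} (\<lambda>i. [2, 3, 4, 4, 5, 6, 7, 8, 9, 10] ! i)))"
    using cone_iso_variety_iso[OF cone_iso_inv[OF T1]]
    unfolding isomorphic_varieties_def param_weight_def by blast
qed

end
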